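(* Let $m,n\ge 1$, let $(\mathbb M,g)$ be a complete, connected, smooth, $n$-dimensional Riemannian manifold without boundary, let $H_i\in C^1(\mathbb R^m)$ for $1\le i\le m$, and let $u=(u_i)_{i=1}^m$, $u_i\in C^3(\mathbb M)$, be a stable solution of $$-\Delta_g u_i = H_i(u_1,\dots,u_m)\quad\text{on } \mathbb M,\qquad i=1,\dots,m.$$ Then for any $\eta=(\eta_k)_{k=1}^m$ with $\eta_k\in C_c^1(\mathbb M)$, $$\begin{aligned} &\sum_{i=1}^m \int_{\mathbb M} \left( \mathrm{Ric}_g(\nabla_g u_i,\nabla_g u_i) +|\mathcal H_{u_i}|^2-\big|\nabla_g |\nabla_g u_i| \big|^2 \right)\eta_i^2 \, dV_g\\ &\quad+\sum_{\substack{i,j=1\\ i\neq j}}^m \int_{\mathbb M} \left(\sqrt{\partial_j H_i(u)\, \partial_i H_j(u)}\; |\nabla_g u_i|\, |\nabla_g u_j|\, \eta_i \eta_j- \partial_j H_i(u)\, \nabla_g u_i \cdot\nabla_g u_j\, \eta_i^2 \right) dV_g\\ &\le \sum_{i=1}^m \int_{\mathbb M} |\nabla_g u_i|^2\, |\nabla_g \eta_i|^2\, dV_g . \end{aligned}$$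
   Context: Notation: $\Delta_g$ is the Laplace-Beltrami operator, $\nabla_g$ the Riemannian gradient, $\mathrm{Ric}_g$ the Ricci curvature, $dV_g$ the Riemannian volume element, and $\partial_j H_i(u)=\frac{\partial H_i}{\partial u_j}(u)$, where $u$ denotes the solution evaluated at points of $\mathbb M$. For a function $f$, $\mathcal H_f$ is its Hessian, the symmetric 2-tensor given in local coordinates by $(\mathcal H_f)_{ij}=\partial_{ij}f-\Gamma_{ij}^k\partial_k f$, with $\Gamma_{ij}^k$ the Christoffel symbols of $g$, and $|\mathcal H_f|$ is its norm with respect to $g$. Standing assumption: $\partial_i H_j(u)\,\partial_j H_i(u)>0$ for all $1\le i,j\le m$. Definition (stable solution): a solution $u=(u_i)_{i=1}^m$ of the system is stable if there exist functions $\zeta=(\zeta_i)_{i=1}^m$, where each $\zeta_i\in C^3(\mathbb M)$ does not change sign, and a nonnegative constant $\lambda$ such that $$-\Delta_g \zeta_i=\sum_{j=1}^m \partial_jH_i(u)\,\zeta_j+\lambda\zeta_i\quad\text{on }\mathbb M,\qquad i=1,\dots,m,$$ and moreover $\partial_jH_i(u)\,\zeta_i\zeta_j>0$ for all $1\le i,j\le m$. *)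

theory Defs
  imports "HOL-Analysis.Analysis"
begin

section \<open>Differentiability classes in Euclidean space\<close>

text \<open>\<open>Ck_on S f k\<close>: the function \<open>f\<close> is of class \<open>C^k\<close> on \<open>S\<close>. It is only used for open \<open>S\<close>.\<close>

primrec Ck_on :: "'a::real_normed_vector set \<Rightarrow> ('a \<Rightarrow> 'b::real_normed_vector) \<Rightarrow> nat \<Rightarrow> bool" where
  "Ck_on S f 0 \<longleftrightarrow> continuous_on S f"
| "Ck_on S f (Suc k) \<longleftrightarrow>
     (\<forall>x\<in>S. f differentiable (at x)) \<and> (\<forall>v. Ck_on S (\<lambda>x. frechet_derivative f (at x) v) k)"

definition smooth_on :: "'a::real_normed_vector set \<Rightarrow> ('a \<Rightarrow> 'b::real_normed_vector) \<Rightarrow> bool" where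
  "smooth_on S f \<longleftrightarrow> (\<forall>k. Ck_on S f k)"

definition pder :: "'n \<Rightarrow> (real ^ 'n \<Rightarrow> real) \<Rightarrow> real ^ 'n \<Rightarrow> real" where
  "pder i f x = frechet_derivative f (at x) (axis i 1)"

section \<open>Riemannian manifolds\<close>

text \<open>A chart \<open>(U, \<phi>)\<close> consists of its domain and its coordinate map; the values of \<open>\<phi>\<close> outside
  \<open>U\<close> are irrelevant. The manifold is the whole type \<open>'a\<close>, its dimension is \<open>CARD('n)\<close>.\<close>

type_synonym ('a, 'n) chart = "'a set \<times> ('a \<Rightarrow> real ^ 'n)"

abbreviation dom_chart :: "('a, 'n) chart \<Rightarrow> 'a set" where
  "dom_chart c \<equiv> fst c"

abbreviation map_chart :: "('a, 'n) chart \<Rightarrow> 'a \<Rightarrow> real ^ 'n" where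
  "map_chart c \<equiv> snd c"

abbreviation img_chart :: "('a, 'n) chart \<Rightarrow> (real ^ 'n) set" where
  "img_chart c \<equiv> map_chart c ` dom_chart c"

abbreviation inv_chart :: "('a, 'n) chart \<Rightarrow> real ^ 'n \<Rightarrow> 'a" where
  "inv_chart c \<equiv> inv_into (dom_chart c) (map_chart c)"

text \<open>Images of charts are open in \<open>real ^ 'n\<close>, so the manifold has no boundary.\<close>

locale smooth_manifold =
  fixes A :: "('a::{t2_space, second_countable_topology}, 'n::finite) chart set"
  assumes charts_cover: "(\<Union>c\<in>A. dom_chart c) = UNIV"
    and open_dom: "c \<in> A \<Longrightarrow> open (dom_chart c)"
    and open_img: "c \<in> A \<Longrightarrow> open (img_chart c)"
    and chart_homeomorphism:
      "c \<in> A \<Longrightarrow> homeomorphism (dom_chart c) (img_chart c) (map_chart c) (inv_chart c)"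
    and smooth_transition: "c \<in> A \<Longrightarrow> d \<in> A \<Longrightarrow>
      smooth_on (map_chart c ` (dom_chart c \<inter> dom_chart d)) (map_chart d \<circ> inv_chart c)"

text \<open>A metric is given by its coefficient matrices \<open>g c x = (g\<^sub>i\<^sub>j(x))\<close> in each chart \<open>c\<close>, as functions
  of the coordinates \<open>x \<in> img_chart c\<close>, subject to the transformation law of covariant 2-tensors.\<close>

type_synonym ('a, 'n) metric = "('a, 'n) chart \<Rightarrow> real ^ 'n \<Rightarrow> real ^ 'n ^ 'n"

locale riemannian_manifold = smooth_manifold A
  for A :: "('a::{t2_space, second_countable_topology}, 'n::finite) chart set" +
  fixes g :: "('a, 'n) metric"
  assumes metric_smooth: "c \<in> A \<Longrightarrow> smooth_on (img_chart c) (g c)"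
    and metric_symmetric: "c \<in> A \<Longrightarrow> x \<in> img_chart c \<Longrightarrow> transpose (g c x) = g c x"
    and metric_pos_def: "c \<in> A \<Longrightarrow> x \<in> img_chart c \<Longrightarrow> v \<noteq> 0 \<Longrightarrow> v \<bullet> (g c x *v v) > 0"
    and metric_transform: "c \<in> A \<Longrightarrow> d \<in> A \<Longrightarrow> p \<in> dom_chart c \<inter> dom_chart d \<Longrightarrow>
      g c (map_chart c p) =
        (let J = matrix (frechet_derivative (map_chart d \<circ> inv_chart c) (at (map_chart c p)))
         in transpose J ** g d (map_chart d p) ** J)"

definition Ck_fun :: "('a, 'n::finite) chart set \<Rightarrow> nat \<Rightarrow> ('a \<Rightarrow> real) \<Rightarrow> bool" where
  "Ck_fun A k f \<longleftrightarrow> (\<forall>c\<in>A. Ck_on (img_chart c) (f \<circ> inv_chart c) k)"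

section \<open>Local coordinate expressions\<close>

text \<open>Here \<open>G\<close> is the coefficient matrix of the metric and \<open>f\<close> the coordinate representation of a
  function in a fixed chart.\<close>

definition christoffel ::
  "(real ^ 'n \<Rightarrow> real ^ 'n ^ 'n) \<Rightarrow> 'n::finite \<Rightarrow> 'n \<Rightarrow> 'n \<Rightarrow> real ^ 'n \<Rightarrow> real" where
  "christoffel G k i j x = 1 / 2 * (\<Sum>l\<in>UNIV. matrix_inv (G x) $ k $ l *
     (pder i (\<lambda>y. G y $ j $ l) x + pder j (\<lambda>y. G y $ i $ l) x - pder l (\<lambda>y. G y $ i $ j) x))"

text \<open>\<open>Ric\<^sub>i\<^sub>j = \<partial>\<^sub>k \<Gamma>\<^sup>k\<^sub>i\<^sub>j - \<partial>\<^sub>j \<Gamma>\<^sup>k\<^sub>i\<^sub>k + \<Gamma>\<^sup>k\<^sub>k\<^sub>l \<Gamma>\<^sup>l\<^sub>i\<^sub>j - \<Gamma>\<^sup>k\<^sub>j\<^sub>l \<Gamma>\<^sup>l\<^sub>i\<^sub>k\<close> (summed over \<open>k\<close>, \<open>l\<close>); with this sign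
  convention round spheres have positive Ricci curvature.\<close>

definition ricci_coeff ::
  "(real ^ 'n \<Rightarrow> real ^ 'n ^ 'n) \<Rightarrow> 'n::finite \<Rightarrow> 'n \<Rightarrow> real ^ 'n \<Rightarrow> real" where
  "ricci_coeff G i j x = (\<Sum>k\<in>UNIV.
     pder k (christoffel G k i j) x - pder j (christoffel G k i k) x +
     (\<Sum>l\<in>UNIV. christoffel G k k l x * christoffel G l i j x
             - christoffel G k j l x * christoffel G l i k x))"

text \<open>The contravariant components of the gradient. At points where \<open>f\<close> is not differentiable the
  gradient is set to \<open>0\<close>; this is relevant only for locally Lipschitz \<open>f\<close> such as \<open>|\<nabla>u|\<close>, which
  are differentiable almost everywhere.\<close>

definition grad_coeff ::
  "(real ^ 'n \<Rightarrow> real ^ 'n ^ 'n) \<Rightarrow> (real ^ 'n \<Rightarrow> real) \<Rightarrow> real ^ 'n::finite \<Rightarrow> real ^ 'n" where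
  "grad_coeff G f x =
     (if f differentiable (at x) then matrix_inv (G x) *v (\<chi> j. pder j f x) else 0)"

definition hessian_coeff ::
  "(real ^ 'n \<Rightarrow> real ^ 'n ^ 'n) \<Rightarrow> (real ^ 'n \<Rightarrow> real) \<Rightarrow> 'n::finite \<Rightarrow> 'n \<Rightarrow> real ^ 'n \<Rightarrow> real" where
  "hessian_coeff G f i j x =
     pder i (pder j f) x - (\<Sum>k\<in>UNIV. christoffel G k i j x * pder k f x)"

text \<open>\<open>|H\<^sub>f|\<^sup>2 = g\<^sup>i\<^sup>k g\<^sup>j\<^sup>l (H\<^sub>f)\<^sub>i\<^sub>j (H\<^sub>f)\<^sub>k\<^sub>l\<close>\<close>

definition hessian_norm_coeff ::
  "(real ^ 'n \<Rightarrow> real ^ 'n ^ 'n) \<Rightarrow> (real ^ 'n \<Rightarrow> real) \<Rightarrow> real ^ 'n::finite \<Rightarrow> real" where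
  "hessian_norm_coeff G f x = sqrt (\<Sum>i\<in>UNIV. \<Sum>j\<in>UNIV. \<Sum>k\<in>UNIV. \<Sum>l\<in>UNIV.
     matrix_inv (G x) $ i $ k * matrix_inv (G x) $ j $ l *
     hessian_coeff G f i j x * hessian_coeff G f k l x)"

text \<open>\<open>\<Delta> f = det(g)\<^sup>-\<^sup>1\<^sup>/\<^sup>2 \<partial>\<^sub>i (det(g)\<^sup>1\<^sup>/\<^sup>2 g\<^sup>i\<^sup>j \<partial>\<^sub>j f)\<close>\<close>

definition laplace_coeff ::
  "(real ^ 'n \<Rightarrow> real ^ 'n ^ 'n) \<Rightarrow> (real ^ 'n \<Rightarrow> real) \<Rightarrow> real ^ 'n::finite \<Rightarrow> real" where
  "laplace_coeff G f x = 1 / sqrt (det (G x)) *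
     (\<Sum>i\<in>UNIV. pder i (\<lambda>y. sqrt (det (G y)) * (\<Sum>j\<in>UNIV. matrix_inv (G y) $ i $ j * pder j f y)) x)"

section \<open>Geometric objects on the manifold\<close>

text \<open>Tangent vectors at \<open>p\<close> are represented by their components in the chart \<open>chart_at A p\<close>. The
  scalars defined below do not depend on the choice of that chart.\<close>

definition chart_at :: "('a, 'n) chart set \<Rightarrow> 'a \<Rightarrow> ('a, 'n) chart" where
  "chart_at A p = (SOME c. c \<in> A \<and> p \<in> dom_chart c)"

definition ginner ::
  "('a, 'n::finite) chart set \<Rightarrow> ('a, 'n) metric \<Rightarrow> 'a \<Rightarrow> real ^ 'n \<Rightarrow> real ^ 'n \<Rightarrow> real" where
  "ginner A g p v w = (let c = chart_at A p in v \<bullet> (g c (map_chart c p) *v w))"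

definition gnorm ::
  "('a, 'n::finite) chart set \<Rightarrow> ('a, 'n) metric \<Rightarrow> 'a \<Rightarrow> real ^ 'n \<Rightarrow> real" where
  "gnorm A g p v = sqrt (ginner A g p v v)"

definition grad ::
  "('a, 'n::finite) chart set \<Rightarrow> ('a, 'n) metric \<Rightarrow> ('a \<Rightarrow> real) \<Rightarrow> 'a \<Rightarrow> real ^ 'n" where
  "grad A g f p = (let c = chart_at A p in grad_coeff (g c) (f \<circ> inv_chart c) (map_chart c p))"

definition laplace_beltrami ::
  "('a, 'n::finite) chart set \<Rightarrow> ('a, 'n) metric \<Rightarrow> ('a \<Rightarrow> real) \<Rightarrow> 'a \<Rightarrow> real" where
  "laplace_beltrami A g f p =
     (let c = chart_at A p in laplace_coeff (g c) (f \<circ> inv_chart c) (map_chart c p))"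

definition hessian_norm ::
  "('a, 'n::finite) chart set \<Rightarrow> ('a, 'n) metric \<Rightarrow> ('a \<Rightarrow> real) \<Rightarrow> 'a \<Rightarrow> real" where
  "hessian_norm A g f p =
     (let c = chart_at A p in hessian_norm_coeff (g c) (f \<circ> inv_chart c) (map_chart c p))"

definition ricci ::
  "('a, 'n::finite) chart set \<Rightarrow> ('a, 'n) metric \<Rightarrow> 'a \<Rightarrow> real ^ 'n \<Rightarrow> real ^ 'n \<Rightarrow> real" where
  "ricci A g p v w = (let c = chart_at A p in
     \<Sum>i\<in>UNIV. \<Sum>j\<in>UNIV. ricci_coeff (g c) i j (map_chart c p) * v $ i * w $ j)"

text \<open>The Riemannian volume is the unique Borel measure that has density \<open>det(g)\<^sup>1\<^sup>/\<^sup>2\<close> with respect to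
  Lebesgue measure in every chart.\<close>

definition riemannian_volume ::
  "('a::topological_space, 'n::finite) chart set \<Rightarrow> ('a, 'n) metric \<Rightarrow> 'a measure" where
  "riemannian_volume A g = (THE V. sets V = sets borel \<and>
     (\<forall>c\<in>A. \<forall>B\<in>sets borel. B \<subseteq> dom_chart c \<longrightarrow>
       emeasure V B = (\<integral>\<^sup>+x. ennreal (sqrt (det (g c x))) * indicator (map_chart c ` B) x \<partial>lborel)))"

section \<open>Completeness\<close>

definition piecewise_C1_curve ::
  "('a::topological_space, 'n::finite) chart set \<Rightarrow> (real \<Rightarrow> 'a) \<Rightarrow> bool" where
  "piecewise_C1_curve A \<gamma> \<longleftrightarrow> continuous_on {0..1} \<gamma> \<and>
     (\<exists>S. finite S \<and> (\<forall>c\<in>A.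
        (map_chart c \<circ> \<gamma>) C1_differentiable_on {t \<in> {0<..<1} - S. \<gamma> t \<in> dom_chart c}))"

definition curve_length ::
  "('a, 'n::finite) chart set \<Rightarrow> ('a, 'n) metric \<Rightarrow> (real \<Rightarrow> 'a) \<Rightarrow> ennreal" where
  "curve_length A g \<gamma> = (\<integral>\<^sup>+t. ennreal (gnorm A g (\<gamma> t)
       (vector_derivative (map_chart (chart_at A (\<gamma> t)) \<circ> \<gamma>) (at t))) * indicator {0<..<1} t \<partial>lborel)"

definition riemannian_dist ::
  "('a::topological_space, 'n::finite) chart set \<Rightarrow> ('a, 'n) metric \<Rightarrow> 'a \<Rightarrow> 'a \<Rightarrow> ennreal" where
  "riemannian_dist A g p q =
     (INF \<gamma>\<in>{\<gamma>. piecewise_C1_curve A \<gamma> \<and> \<gamma> 0 = p \<and> \<gamma> 1 = q}. curve_length A g \<gamma>)"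

definition riemannian_complete ::
  "('a::topological_space, 'n::finite) chart set \<Rightarrow> ('a, 'n) metric \<Rightarrow> bool" where
  "riemannian_complete A g \<longleftrightarrow> (\<forall>X :: nat \<Rightarrow> 'a.
     (\<forall>e>0. \<exists>N. \<forall>k\<ge>N. \<forall>l\<ge>N. riemannian_dist A g (X k) (X l) < e) \<longrightarrow>
     (\<exists>p. (\<lambda>k. riemannian_dist A g (X k) p) \<longlonglongrightarrow> 0))"

section \<open>The elliptic system and stability\<close>

text \<open>The components of the system are indexed by the finite type \<open>'m\<close>; \<open>dH H u i j p\<close> is
  \<open>\<partial>\<^sub>j H\<^sub>i(u)\<close> at the point \<open>p\<close>.\<close>

definition dH ::
  "('m \<Rightarrow> real ^ 'm::finite \<Rightarrow> real) \<Rightarrow> ('m \<Rightarrow> 'a \<Rightarrow> real) \<Rightarrow> 'm \<Rightarrow> 'm \<Rightarrow> 'a \<Rightarrow> real" where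
  "dH H u i j p = pder j (H i) (\<chi> k. u k p)"

definition solves_system ::
  "('a, 'n::finite) chart set \<Rightarrow> ('a, 'n) metric \<Rightarrow> ('m \<Rightarrow> real ^ 'm::finite \<Rightarrow> real) \<Rightarrow>
   ('m \<Rightarrow> 'a \<Rightarrow> real) \<Rightarrow> bool" where
  "solves_system A g H u \<longleftrightarrow> (\<forall>i p. - laplace_beltrami A g (u i) p = H i (\<chi> k. u k p))"

definition stable_solution ::
  "('a, 'n::finite) chart set \<Rightarrow> ('a, 'n) metric \<Rightarrow> ('m \<Rightarrow> real ^ 'm::finite \<Rightarrow> real) \<Rightarrow>
   ('m \<Rightarrow> 'a \<Rightarrow> real) \<Rightarrow> bool" where
  "stable_solution A g H u \<longleftrightarrow> solves_system A g H u \<and>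
     (\<exists>(\<zeta> :: 'm \<Rightarrow> 'a \<Rightarrow> real) lam::real. lam \<ge> 0 \<and>
        (\<forall>i. Ck_fun A 3 (\<zeta> i)) \<and>
        (\<forall>i. (\<forall>p. \<zeta> i p \<ge> 0) \<or> (\<forall>p. \<zeta> i p \<le> 0)) \<and>
        (\<forall>i p. - laplace_beltrami A g (\<zeta> i) p =
                 (\<Sum>j\<in>UNIV. dH H u i j p * \<zeta> j p) + lam * \<zeta> i p) \<and>
        (\<forall>i j p. dH H u i j p * \<zeta> i p * \<zeta> j p > 0))"

end

theory Submission
  imports Defs
begin

text \<open>Write \<open>w\<^sub>i = |\<nabla>u\<^sub>i|\<^sup>2\<close>. With the Bochner formula and the stability equations the difference of the two
  integrands is bounded pointwise by the sum over \<open>i\<close> of the divergences of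
  \<open>\<eta>\<^sub>i\<^sup>2 (1/2 \<nabla>w\<^sub>i - w\<^sub>i \<nabla>\<zeta>\<^sub>i / \<zeta>\<^sub>i)\<close>: one completes the square in \<open>\<nabla>(\<eta>\<^sub>i sqrt w\<^sub>i)\<close> and \<open>\<nabla>\<zeta>\<^sub>i / \<zeta>\<^sub>i\<close> and symmetrises the
  coupling terms. These fields are of class \<open>C\<^sup>1\<close> with compact support, so Green's identity finishes the
  proof; in this form no test function of low regularity such as \<open>|\<nabla>u\<^sub>i| \<eta>\<^sub>i\<close> is needed. The invariance of the
  Laplacian under coordinate changes follows from its weak form, which only involves first
  derivatives, and the Bochner formula is then needed in one chart at a time only.\<close>

section \<open>Calculus in Euclidean space\<close>

text \<open>Geometric quantities are defined at \<open>p\<close> through the chart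
  \<open>chart_at A p\<close>, which may jump with \<open>p\<close>. Before such a quantity can be
  differentiated it must agree, near each point, with its expression in one fixed chart. For
  first-order terms this is the chain rule; for the Laplacian a direct check would involve second
  derivatives of transition maps. Instead, Green's identity in two charts is tested with the same
  bump function. This requires the volume to have the right density in every chart, hence the change
  of variables theorem. The other obstacle is |\<nabla>|\<nabla>u_i||^2 at the zeros of w_i.
  Elsewhere it is |\<nabla>w_i|^2 / (4 w_i); at a zero it is 0. This function may be discontinuous,
  and its integrability rests on a local bound |\<nabla>w_i|^2 \<le> b w_i. In the pointwise
  estimate it cancels: it is subtracted in the integrand and reappears when the square of
  \<nabla>(\<eta>_i sqrt w_i) is expanded. The Bochner term \<nabla>u_i \<cdot> \<nabla>\<Delta>u_i
  yields all products \<nabla>u_i \<cdot> \<nabla>u_j, including j = i. Those with j \<noteq> i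
  cancel against the claim; the diagonal ones match the diagonal part of the stability
  equations.\<close>

lemma Ck_on_cong_imp:
  assumes "open S" "\<And>x. x \<in> S \<Longrightarrow> f x = g x" "Ck_on S f k"
  shows "Ck_on S g k"
  using assms(2,3)
proof (induction k arbitrary: f g)
  case 0
  then show ?case using continuous_on_cong[of S S f g] by simp
next
  case (Suc k)
  have d: "g differentiable (at x)" if "x \<in> S" for x
  proof -
    have "f differentiable (at x)"
      using Suc.prems(2) that by simp
    then obtain f' where "(f has_derivative f') (at x)"
      unfolding differentiable_def by blast
    from has_derivative_transform_within_open[OF this assms(1) that Suc.prems(1)]
    show ?thesis unfolding differentiable_def by blast
  qed
  have "frechet_derivative f (at x) = frechet_derivative g (at x)" if "x \<in> S" for x
    using Suc.prems that assms(1)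
    by (intro frechet_derivative_transform_within_open[of _ _ S]) auto
  then have "Ck_on S (\<lambda>x. frechet_derivative g (at x) v) k" for v
    using Suc.IH[of "\<lambda>x. frechet_derivative f (at x) v" "\<lambda>x. frechet_derivative g (at x) v"] Suc.prems(2)
    by simp
  then show ?case using d by simp
qed

lemma Ck_on_SucD: "Ck_on S f (Suc k) \<Longrightarrow> Ck_on S f k"
proof (induction k arbitrary: f)
  case 0
  then show ?case
    by (simp add: continuous_at_imp_continuous_on differentiable_imp_continuous_within)
next
  case (Suc k)
  then show ?case by (metis Ck_on.simps(2))
qed

lemma Ck_on_mono: "Ck_on S f k \<Longrightarrow> j \<le> k \<Longrightarrow> Ck_on S f j"
proof (induction k)
  case (Suc k)
  then show ?case using Ck_on_SucD[of S f k] by (cases "j = Suc k") auto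
qed auto

lemma Ck_on_subset: "Ck_on S f k \<Longrightarrow> T \<subseteq> S \<Longrightarrow> Ck_on T f k"
  by (induction k arbitrary: f) (auto intro: continuous_on_subset)

text \<open>Being of class C^k is a local property. This lets a function given by different formulas
  on overlapping open sets, such as an extension by zero, be treated one formula at a time.\<close>

lemma Ck_on_open_cover:
  assumes "\<And>x. x \<in> S \<Longrightarrow> \<exists>T. open T \<and> x \<in> T \<and> Ck_on (S \<inter> T) f k" "open S"
  shows "Ck_on S f k"
  using assms(1)
proof (induction k arbitrary: f)
  case 0
  have "continuous (at x) f" if "x \<in> S" for x
    using 0[OF that] that \<open>open S\<close> by (metis Ck_on.simps(1) Int_iff continuous_on_eq_continuous_at open_Int)
  then show ?case by (simp add: continuous_at_imp_continuous_on)
next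
  case (Suc k)
  then show ?case by (simp; metis Int_iff)
qed

lemma Ck_on_continuous_on: "Ck_on S f k \<Longrightarrow> continuous_on S f"
  using Ck_on_mono[of S f k 0] by simp

lemma Ck_on_differentiable: "Ck_on S f k \<Longrightarrow> 1 \<le> k \<Longrightarrow> x \<in> S \<Longrightarrow> f differentiable (at x)"
  by (cases k) auto

lemma Ck_on_pder: "Ck_on S f (Suc k) \<Longrightarrow> Ck_on S (pder i f) k"
  by (simp add: pder_def[abs_def])

lemma Ck_on_const: "Ck_on S (\<lambda>x. c) k"
  by (induction k arbitrary: c) auto

lemma Ck_on_bounded_linear:
  assumes "bounded_linear L" "open S" "Ck_on S f k"
  shows "Ck_on S (\<lambda>x. L (f x)) k"
  using assms(3)
proof (induction k arbitrary: f)
  case 0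
  then show ?case
    using assms(1) by (simp add: linear_continuous_on continuous_on_compose2 bounded_linear.continuous_on)
next
  case (Suc k)
  have der: "((\<lambda>x. L (f x)) has_derivative (\<lambda>v. L (frechet_derivative f (at x) v))) (at x)" if "x \<in> S" for x
    using Suc.prems that bounded_linear.has_derivative[OF assms(1), of f]
    by (auto simp: frechet_derivative_works[symmetric])
  have fd: "frechet_derivative (\<lambda>x. L (f x)) (at x) = (\<lambda>v. L (frechet_derivative f (at x) v))" if "x \<in> S" for x
    by (rule frechet_derivative_at[OF der[OF that], symmetric])
  have "Ck_on S (\<lambda>x. frechet_derivative (\<lambda>x. L (f x)) (at x) v) k" for v
    by (rule Ck_on_cong_imp[OF assms(2), of "\<lambda>x. L (frechet_derivative f (at x) v)"])
      (use fd Suc in auto)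
  then show ?case using der by (auto simp: differentiable_def)
qed

lemma Ck_on_add:
  assumes "open S" "Ck_on S f k" "Ck_on S g k"
  shows "Ck_on S (\<lambda>x. f x + g x) k"
  using assms(2,3)
proof (induction k arbitrary: f g)
  case 0
  then show ?case by (simp add: continuous_on_add)
next
  case (Suc k)
  have der: "((\<lambda>x. f x + g x) has_derivative
      (\<lambda>v. frechet_derivative f (at x) v + frechet_derivative g (at x) v)) (at x)" if "x \<in> S" for x
    using Suc.prems that by (intro has_derivative_add) (auto simp: frechet_derivative_works[symmetric])
  have fd: "frechet_derivative (\<lambda>x. f x + g x) (at x) =
      (\<lambda>v. frechet_derivative f (at x) v + frechet_derivative g (at x) v)" if "x \<in> S" for x
    by (rule frechet_derivative_at[OF der[OF that], symmetric])
  have "Ck_on S (\<lambda>x. frechet_derivative (\<lambda>x. f x + g x) (at x) v) k" for v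
    by (rule Ck_on_cong_imp[OF assms(1), of "\<lambda>x. frechet_derivative f (at x) v + frechet_derivative g (at x) v"])
      (use fd Suc in auto)
  then show ?case using der by (auto simp: differentiable_def)
qed

lemma Ck_on_sum:
  assumes "open S" "\<And>i. i \<in> I \<Longrightarrow> Ck_on S (f i) k"
  shows "Ck_on S (\<lambda>x. \<Sum>i\<in>I. f i x) k"
  using assms(2) by (induction I rule: infinite_finite_induct)
    (simp_all add: Ck_on_const Ck_on_add[OF assms(1)])

lemma Ck_on_mult:
  fixes f g :: "'a::real_normed_vector \<Rightarrow> real"
  assumes "open S" "Ck_on S f k" "Ck_on S g k"
  shows "Ck_on S (\<lambda>x. f x * g x) k"
  using assms(2,3)
proof (induction k arbitrary: f g)
  case 0
  then show ?case by (simp add: continuous_on_mult)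
next
  case (Suc k)
  have der: "((\<lambda>x. f x * g x) has_derivative
      (\<lambda>v. f x * frechet_derivative g (at x) v + frechet_derivative f (at x) v * g x)) (at x)" if "x \<in> S" for x
    using Suc.prems that by (intro has_derivative_mult) (auto simp: frechet_derivative_works[symmetric])
  have fd: "frechet_derivative (\<lambda>x. f x * g x) (at x) =
      (\<lambda>v. f x * frechet_derivative g (at x) v + frechet_derivative f (at x) v * g x)" if "x \<in> S" for x
    by (rule frechet_derivative_at[OF der[OF that], symmetric])
  have fg: "Ck_on S f k" "Ck_on S g k"
    by (rule Ck_on_SucD[OF Suc.prems(1)], rule Ck_on_SucD[OF Suc.prems(2)])
  have fg': "Ck_on S (\<lambda>x. frechet_derivative f (at x) v) k" "Ck_on S (\<lambda>x. frechet_derivative g (at x) v) k" for v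
    using Suc.prems by auto
  have "Ck_on S (\<lambda>x. frechet_derivative (\<lambda>x. f x * g x) (at x) v) k" for v
    by (rule Ck_on_cong_imp[OF assms(1) _
          Ck_on_add[OF assms(1) Suc.IH[OF fg(1) fg'(2)] Suc.IH[OF fg'(1) fg(2)]]])
      (use fd in auto)
  then show ?case using der by (auto simp: differentiable_def)
qed

lemma Ck_on_cmult:
  fixes f :: "'a::real_normed_vector \<Rightarrow> real"
  assumes "open S" "Ck_on S f k"
  shows "Ck_on S (\<lambda>x. c * f x) k"
  by (intro Ck_on_mult assms Ck_on_const)

lemma Ck_on_minus:
  fixes f :: "'a::real_normed_vector \<Rightarrow> real"
  assumes "open S" "Ck_on S f k"
  shows "Ck_on S (\<lambda>x. - f x) k"
  using Ck_on_cmult[OF assms, of "-1"] by simp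

lemma Ck_on_diff:
  fixes f :: "'a::real_normed_vector \<Rightarrow> real"
  assumes "open S" "Ck_on S f k" "Ck_on S g k"
  shows "Ck_on S (\<lambda>x. f x - g x) k"
  using Ck_on_add[OF assms(1,2) Ck_on_minus[OF assms(1,3)]] by simp

lemma Ck_on_prod:
  fixes f :: "'i \<Rightarrow> 'a::real_normed_vector \<Rightarrow> real"
  assumes "open S" "\<And>i. i \<in> I \<Longrightarrow> Ck_on S (f i) k"
  shows "Ck_on S (\<lambda>x. \<Prod>i\<in>I. f i x) k"
  using assms(2) by (induction I rule: infinite_finite_induct)
    (simp_all add: Ck_on_const Ck_on_mult[OF assms(1)])

text \<open>The derivative of 1/f is a product of f' with factors 1/f, so the induction hypothesis
  for 1/f itself is what the product rule consumes. \<open>Ck_on_sqrt\<close> works in the same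
  way.\<close>

lemma Ck_on_inverse:
  fixes f :: "'a::real_normed_vector \<Rightarrow> real"
  assumes "open S" "Ck_on S f k" and nz: "\<And>x. x \<in> S \<Longrightarrow> f x \<noteq> 0"
  shows "Ck_on S (\<lambda>x. inverse (f x)) k"
  using assms(2)
proof (induction k)
  case 0
  then show ?case using nz by (simp add: continuous_on_inverse)
next
  case (Suc k)
  have der: "((\<lambda>x. inverse (f x)) has_derivative
      (\<lambda>v. - (inverse (f x) * frechet_derivative f (at x) v * inverse (f x)))) (at x)" if "x \<in> S" for x
    by (rule Deriv.has_derivative_inverse)
      (use Suc.prems that nz in \<open>auto simp: frechet_derivative_works[symmetric]\<close>)
  have fd: "frechet_derivative (\<lambda>x. inverse (f x)) (at x) =
      (\<lambda>v. - (inverse (f x) * frechet_derivative f (at x) v * inverse (f x)))" if "x \<in> S" for x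
    by (rule frechet_derivative_at[OF der[OF that], symmetric])
  have i: "Ck_on S (\<lambda>x. inverse (f x)) k"
    by (rule Suc.IH[OF Ck_on_SucD[OF Suc.prems]])
  have f': "Ck_on S (\<lambda>x. frechet_derivative f (at x) v) k" for v
    using Suc.prems by auto
  have "Ck_on S (\<lambda>x. frechet_derivative (\<lambda>x. inverse (f x)) (at x) v) k" for v
    by (rule Ck_on_cong_imp[OF assms(1) _
          Ck_on_minus[OF assms(1) Ck_on_mult[OF assms(1) Ck_on_mult[OF assms(1) i f'] i]]])
      (use fd in auto)
  then show ?case using der by (auto simp: differentiable_def)
qed

lemma Ck_on_divide:
  fixes f :: "'a::real_normed_vector \<Rightarrow> real"
  assumes "open S" "Ck_on S f k" "Ck_on S g k" "\<And>x. x \<in> S \<Longrightarrow> g x \<noteq> 0"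
  shows "Ck_on S (\<lambda>x. f x / g x) k"
  unfolding divide_inverse by (intro Ck_on_mult Ck_on_inverse assms)

lemma Ck_on_sqrt:
  fixes f :: "'a::real_normed_vector \<Rightarrow> real"
  assumes "open S" "Ck_on S f k" and pos: "\<And>x. x \<in> S \<Longrightarrow> f x > 0"
  shows "Ck_on S (\<lambda>x. sqrt (f x)) k"
  using assms(2)
proof (induction k)
  case 0
  then show ?case by (simp add: continuous_on_real_sqrt)
next
  case (Suc k)
  have der: "((\<lambda>x. sqrt (f x)) has_derivative
      (\<lambda>v. frechet_derivative f (at x) v * (inverse (sqrt (f x)) / 2))) (at x)" if "x \<in> S" for x
  proof -
    have "(f has_derivative frechet_derivative f (at x)) (at x)"
      using Suc.prems that by (auto simp: frechet_derivative_works[symmetric])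
    from has_derivative_real_sqrt[OF pos[OF that] this] show ?thesis
      by (simp add: field_simps)
  qed
  have fd: "frechet_derivative (\<lambda>x. sqrt (f x)) (at x) =
      (\<lambda>v. frechet_derivative f (at x) v * (inverse (sqrt (f x)) / 2))" if "x \<in> S" for x
    by (rule frechet_derivative_at[OF der[OF that], symmetric])
  have s: "Ck_on S (\<lambda>x. sqrt (f x)) k"
    by (rule Suc.IH[OF Ck_on_SucD[OF Suc.prems]])
  have f': "Ck_on S (\<lambda>x. frechet_derivative f (at x) v) k" for v
    using Suc.prems by auto
  have "sqrt (f x) \<noteq> 0" if "x \<in> S" for x
    using pos[OF that] by simp
  then have i: "Ck_on S (\<lambda>x. inverse (sqrt (f x)) / 2) k"
    by (intro Ck_on_divide[OF assms(1) Ck_on_inverse[OF assms(1) s]] Ck_on_const) auto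
  have "Ck_on S (\<lambda>x. frechet_derivative (\<lambda>x. sqrt (f x)) (at x) v) k" for v
    by (rule Ck_on_cong_imp[OF assms(1) _ Ck_on_mult[OF assms(1) f' i]]) (use fd in auto)
  then show ?case using der by (auto simp: differentiable_def)
qed

lemma C1_onI:
  assumes "open S" "\<And>x. x \<in> S \<Longrightarrow> (f has_derivative f' x) (at x)" "\<And>v. continuous_on S (\<lambda>x. f' x v)"
  shows "Ck_on S f 1"
proof -
  have "frechet_derivative f (at x) = f' x" if "x \<in> S" for x
    using assms(2)[OF that] frechet_derivative_at by metis
  then have "continuous_on S (\<lambda>x. frechet_derivative f (at x) v)" for v
    using assms(3)[of v] by (simp cong: continuous_on_cong)
  then show ?thesis using assms(2) by (auto simp: differentiable_def)
qed

section \<open>Partial derivatives\<close>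

lemma frechet_derivative_pder:
  assumes "f differentiable (at x)"
  shows "frechet_derivative f (at x) v = (\<Sum>i\<in>UNIV. v $ i * pder i f x)"
proof -
  interpret L: linear "frechet_derivative f (at x)"
    using assms linear_frechet_derivative by blast
  have "frechet_derivative f (at x) v = frechet_derivative f (at x) (\<Sum>i\<in>UNIV. v $ i *\<^sub>R axis i 1)"
    by (simp add: basis_expansion[of v] scalar_mult_eq_scaleR[symmetric])
  also have "\<dots> = (\<Sum>i\<in>UNIV. v $ i * pder i f x)"
    by (simp add: L.sum L.scaleR pder_def)
  finally show ?thesis .
qed

lemma pder_cong:
  assumes "open S" "x \<in> S" "f differentiable (at x)" "\<And>x. x \<in> S \<Longrightarrow> f x = g x"
  shows "pder i f x = pder i g x"
  unfolding pder_def by (subst frechet_derivative_transform_within_open[OF assms(3,1,2,4)]) auto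

lemma pder_eqI: "(f has_derivative f') (at x) \<Longrightarrow> pder i f x = f' (axis i 1)"
  unfolding pder_def using frechet_derivative_at by metis

lemma has_derivative_frechet: "f differentiable (at x) \<Longrightarrow> (f has_derivative frechet_derivative f (at x)) (at x)"
  by (simp add: frechet_derivative_works[symmetric])

lemma pder_const [simp]: "pder i (\<lambda>x. c) x = 0"
  by (simp add: pder_def)

lemma pder_add:
  "f differentiable (at x) \<Longrightarrow> g differentiable (at x) \<Longrightarrow> pder i (\<lambda>y. f y + g y) x = pder i f x + pder i g x"
  by (subst pder_eqI[OF has_derivative_add[OF has_derivative_frechet has_derivative_frechet]])
    (auto simp: pder_def)

lemma pder_minus:
  "f differentiable (at x) \<Longrightarrow> pder i (\<lambda>y. - f y) x = - pder i f x"
  by (subst pder_eqI[OF has_derivative_minus[OF has_derivative_frechet]]) (auto simp: pder_def)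

lemma pder_diff:
  "f differentiable (at x) \<Longrightarrow> g differentiable (at x) \<Longrightarrow> pder i (\<lambda>y. f y - g y) x = pder i f x - pder i g x"
  by (subst pder_eqI[OF has_derivative_diff[OF has_derivative_frechet has_derivative_frechet]])
    (auto simp: pder_def)

lemma pder_mult:
  "f differentiable (at x) \<Longrightarrow> g differentiable (at x) \<Longrightarrow>
    pder i (\<lambda>y. f y * g y) x = pder i f x * g x + f x * pder i g x"
  by (subst pder_eqI[OF has_derivative_mult[OF has_derivative_frechet has_derivative_frechet]])
    (auto simp: pder_def)

lemma pder_cmult: "f differentiable (at x) \<Longrightarrow> pder i (\<lambda>y. c * f y) x = c * pder i f x"
  by (simp add: pder_mult)

lemma pder_sum:
  "(\<And>j. j \<in> I \<Longrightarrow> f j differentiable (at x)) \<Longrightarrow>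
    pder i (\<lambda>y. \<Sum>j\<in>I. f j y) x = (\<Sum>j\<in>I. pder i (f j) x)"
  by (subst pder_eqI[OF has_derivative_sum[OF has_derivative_frechet]]) (auto simp: pder_def)

lemma pder_prod:
  "(\<And>j. j \<in> I \<Longrightarrow> f j differentiable (at x)) \<Longrightarrow>
    pder i (\<lambda>y. \<Prod>j\<in>I. f j y) x = (\<Sum>j\<in>I. pder i (f j) x * (\<Prod>l\<in>I-{j}. f l x))"
  by (subst pder_eqI[OF has_derivative_prod[OF has_derivative_frechet]]) (auto simp: pder_def)

lemma pder_sqrt:
  "f differentiable (at x) \<Longrightarrow> f x > 0 \<Longrightarrow> pder i (\<lambda>y. sqrt (f y)) x = pder i f x / (2 * sqrt (f x))"
  by (subst pder_eqI[OF has_derivative_real_sqrt[OF _ has_derivative_frechet]])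
    (auto simp: pder_def field_simps)

lemma pder_divide:
  "f differentiable (at x) \<Longrightarrow> g differentiable (at x) \<Longrightarrow> g x \<noteq> 0 \<Longrightarrow>
    pder i (\<lambda>y. f y / g y) x = (pder i f x * g x - f x * pder i g x) / (g x * g x)"
  by (subst pder_eqI[OF has_derivative_divide'[OF has_derivative_frechet has_derivative_frechet]])
    (auto simp: pder_def)

text \<open>Meant for nonnegative functions at their zeros, where the gradient has to
  vanish.\<close>

lemma pder_local_min:
  assumes "f differentiable (at x)" "open S" "x \<in> S" "\<And>y. y \<in> S \<Longrightarrow> f x \<le> f y"
  shows "pder i f x = 0"
proof -
  have "frechet_derivative f (at x) = (\<lambda>v. 0)"
    using differential_zero_maxmin[OF assms(3,2) has_derivative_frechet[OF assms(1)]] assms(4) by auto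
  then show ?thesis by (simp add: pder_def)
qed

lemma pder_comp:
  assumes "\<tau> differentiable (at x)" "f differentiable (at (\<tau> x))"
  shows "pder i (f \<circ> \<tau>) x = (\<Sum>k\<in>UNIV. matrix (frechet_derivative \<tau> (at x)) $ k $ i * pder k f (\<tau> x))"
  using assms by (simp add: pder_def[of i "f \<circ> \<tau>"] frechet_derivative_compose frechet_derivative_pder matrix_def)

section \<open>Equality of mixed partial derivatives\<close>

lemma has_real_derivative_axis:
  assumes "f differentiable (at (x + t *\<^sub>R axis i 1))"
  shows "((\<lambda>t. f (x + t *\<^sub>R axis i 1)) has_real_derivative pder i f (x + t *\<^sub>R axis i 1)) (at t within T)"
proof -
  interpret L: linear "frechet_derivative f (at (x + t *\<^sub>R axis i 1))"
    using assms linear_frechet_derivative by blast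
  have "((\<lambda>t. x + t *\<^sub>R axis i 1) has_derivative (\<lambda>s. s *\<^sub>R axis i 1)) (at t within T)"
    by (auto intro!: derivative_eq_intros)
  from diff_chain_within[OF this has_derivative_at_withinI[OF has_derivative_frechet[OF assms]]]
  have "((\<lambda>t. f (x + t *\<^sub>R axis i 1)) has_derivative
      (\<lambda>s. frechet_derivative f (at (x + t *\<^sub>R axis i 1)) (s *\<^sub>R axis i 1))) (at t within T)"
    by (simp add: o_def)
  then show ?thesis
    by (simp add: has_field_derivative_def L.scaleR pder_def mult.commute[of _ "frechet_derivative _ _ _"] mult_commute_abs)
qed

text \<open>The mean value theorem is applied twice: in direction \<open>i\<close> to the difference
  of two parallel slices, then in direction \<open>j\<close> to the resulting partial derivative.
  The second difference is symmetric in \<open>i\<close> and \<open>j\<close>, so both mixed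
  derivatives arise from the same number.\<close>

lemma second_difference_mvt:
  assumes S: "\<And>a b. a \<in> {0..t} \<Longrightarrow> b \<in> {0..t} \<Longrightarrow> x + a *\<^sub>R axis i 1 + b *\<^sub>R axis j 1 \<in> S"
    and f: "Ck_on S f 2" and t: "t > 0"
  shows "\<exists>a\<in>{0..t}. \<exists>b\<in>{0..t}.
    f (x + t *\<^sub>R axis i 1 + t *\<^sub>R axis j 1) - f (x + t *\<^sub>R axis i 1) - f (x + t *\<^sub>R axis j 1) + f x
    = t * t * pder j (pder i f) (x + a *\<^sub>R axis i 1 + b *\<^sub>R axis j 1)"
proof -
  let ?e = "axis i (1::real)" and ?d = "axis j (1::real)"
  have df: "f differentiable (at y)" "pder i f differentiable (at y)" if "y \<in> S" for y
    using f that Ck_on_differentiable[OF Ck_on_pder[of S f 1 i]] by (auto simp: numeral_2_eq_2)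
  define \<phi> where "\<phi> a = f ((x + t *\<^sub>R ?d) + a *\<^sub>R ?e) - f (x + a *\<^sub>R ?e)" for a
  have "(\<phi> has_real_derivative pder i f ((x + t *\<^sub>R ?d) + a *\<^sub>R ?e) - pder i f (x + a *\<^sub>R ?e)) (at a)"
    if "0 \<le> a" "a \<le> t" for a
    unfolding \<phi>_def using S[of a t] S[of a 0] that t
    by (intro DERIV_diff has_real_derivative_axis df) (auto simp: add_ac)
  from MVT2[OF t this] obtain a where a: "0 < a" "a < t"
    "\<phi> t - \<phi> 0 = t * (pder i f ((x + t *\<^sub>R ?d) + a *\<^sub>R ?e) - pder i f (x + a *\<^sub>R ?e))"
    by auto
  have "((\<lambda>b. pder i f ((x + a *\<^sub>R ?e) + b *\<^sub>R ?d)) has_real_derivative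
      pder j (pder i f) ((x + a *\<^sub>R ?e) + b *\<^sub>R ?d)) (at b)" if "0 \<le> b" "b \<le> t" for b
    using S[of a b] that a by (intro has_real_derivative_axis df) auto
  from MVT2[OF t this] obtain b where b: "0 < b" "b < t"
    "pder i f ((x + a *\<^sub>R ?e) + t *\<^sub>R ?d) - pder i f ((x + a *\<^sub>R ?e)) =
      t * pder j (pder i f) ((x + a *\<^sub>R ?e) + b *\<^sub>R ?d)"
    by auto
  have "\<phi> t - \<phi> 0 = t * t * pder j (pder i f) (x + a *\<^sub>R ?e + b *\<^sub>R ?d)"
    using a(3) b(3) by (simp add: add_ac)
  then show ?thesis
    using a b by (intro bexI[of _ a] bexI[of _ b]) (auto simp: \<phi>_def add_ac)
qed

theorem pder_commute:
  assumes "open S" "x \<in> S" "Ck_on S f 2"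
  shows "pder i (pder j f) x = pder j (pder i f) x"
proof (rule ccontr)
  assume ne: "pder i (pder j f) x \<noteq> pder j (pder i f) x"
  \<comment> \<open>Half the gap: numbers at distance less than \<open>e\<close> from the two mixed
    derivatives cannot coincide.\<close>
  define e where "e = \<bar>pder i (pder j f) x - pder j (pder i f) x\<bar> / 2"
  have "e > 0" using ne by (simp add: e_def)
  have c: "continuous (at x) (pder k (pder l f))" for k l
    using assms Ck_on_pder[of S "pder l f" 0 k] Ck_on_pder[of S f 1 l]
    by (simp add: numeral_2_eq_2 continuous_on_eq_continuous_at)
  obtain d1 where d1: "d1 > 0" "\<And>y. dist y x < d1 \<Longrightarrow> dist (pder i (pder j f) y) (pder i (pder j f) x) < e"
    using c[of i j] \<open>e > 0\<close> unfolding continuous_at_eps_delta by metis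
  obtain d2 where d2: "d2 > 0" "\<And>y. dist y x < d2 \<Longrightarrow> dist (pder j (pder i f) y) (pder j (pder i f) x) < e"
    using c[of j i] \<open>e > 0\<close> unfolding continuous_at_eps_delta by metis
  obtain d3 where d3: "d3 > 0" "\<And>y. dist y x < d3 \<Longrightarrow> y \<in> S"
    using assms by (metis open_dist)
  \<comment> \<open>All points of the square of side \<open>t\<close> lie within
    \<open>2 * t\<close> of \<open>x\<close>; dividing by 3 keeps them inside the three
    balls.\<close>
  define t where "t = min d1 (min d2 d3) / 3"
  have t: "t > 0" "2 * t < d1" "2 * t < d2" "2 * t < d3" using d1 d2 d3 by (auto simp: t_def min_def)
  have dist: "dist (x + a *\<^sub>R axis k 1 + b *\<^sub>R axis l 1) x \<le> 2 * t" if "a \<in> {0..t}" "b \<in> {0..t}" for a b and k l :: 'a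
  proof -
    have "norm (a *\<^sub>R axis k (1::real) + b *\<^sub>R axis l (1::real)) \<le> norm (a *\<^sub>R axis k (1::real)) + norm (b *\<^sub>R axis l (1::real))"
      by (rule norm_triangle_ineq)
    also have "\<dots> \<le> 2 * t" using that by simp
    finally show ?thesis by (simp add: dist_norm add.assoc)
  qed
  have inS: "x + a *\<^sub>R axis k 1 + b *\<^sub>R axis l 1 \<in> S" if "a \<in> {0..t}" "b \<in> {0..t}" for a b and k l :: 'a
    using dist[OF that, of k l] t d3(2) by simp
  obtain a b where ab: "a \<in> {0..t}" "b \<in> {0..t}"
    "f (x + t *\<^sub>R axis i 1 + t *\<^sub>R axis j 1) - f (x + t *\<^sub>R axis i 1) - f (x + t *\<^sub>R axis j 1) + f x
    = t * t * pder j (pder i f) (x + a *\<^sub>R axis i 1 + b *\<^sub>R axis j 1)"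
    using second_difference_mvt[of t x i j S f, OF inS assms(3) t(1)] by auto
  obtain a' b' where ab': "a' \<in> {0..t}" "b' \<in> {0..t}"
    "f (x + t *\<^sub>R axis j 1 + t *\<^sub>R axis i 1) - f (x + t *\<^sub>R axis j 1) - f (x + t *\<^sub>R axis i 1) + f x
    = t * t * pder i (pder j f) (x + a' *\<^sub>R axis j 1 + b' *\<^sub>R axis i 1)"
    using second_difference_mvt[of t x j i S f, OF inS assms(3) t(1)] by auto
  have "t * t * pder j (pder i f) (x + a *\<^sub>R axis i 1 + b *\<^sub>R axis j 1) =
    t * t * pder i (pder j f) (x + a' *\<^sub>R axis j 1 + b' *\<^sub>R axis i 1)"
    using ab(3) ab'(3) by (simp add: algebra_simps)
  then have "pder j (pder i f) (x + a *\<^sub>R axis i 1 + b *\<^sub>R axis j 1) =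
    pder i (pder j f) (x + a' *\<^sub>R axis j 1 + b' *\<^sub>R axis i 1)"
    using t by simp
  moreover have "\<bar>pder j (pder i f) (x + a *\<^sub>R axis i 1 + b *\<^sub>R axis j 1) - pder j (pder i f) x\<bar> < e"
    using d2(2) dist[OF ab(1,2), of i j] t by (simp add: dist_norm)
  moreover have "\<bar>pder i (pder j f) (x + a' *\<^sub>R axis j 1 + b' *\<^sub>R axis i 1) - pder i (pder j f) x\<bar> < e"
    using d1(2) dist[OF ab'(1,2), of j i] t by (simp add: dist_norm)
  ultimately show False unfolding e_def by (simp add: abs_if split: if_splits)
qed

section \<open>Change of variables for nonnegative integrals\<close>

text \<open>A bridge between the nonnegative integral, in which the volume is expressed, and the
  notions \<open>absolutely_integrable_on\<close> and \<open>integral\<close> of the library's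
  change of variables. Measurability forces a nonnegative function that is not integrable to have
  infinite integral, so the infinite case is covered as well.\<close>

lemma nn_integral_eq_set_integral:
  fixes f :: "'a::euclidean_space \<Rightarrow> real"
  assumes "(\<lambda>x. f x * indicator T x) \<in> borel_measurable borel" "\<And>x. x \<in> T \<Longrightarrow> 0 \<le> f x"
  shows "(\<integral>\<^sup>+x. ennreal (f x * indicator T x) \<partial>lborel) =
    (if f absolutely_integrable_on T then ennreal (integral T f) else \<infinity>)"
proof -
  have nn: "0 \<le> f x * indicator T x" for x using assms(2) by (simp add: indicator_def)
  have iff: "f absolutely_integrable_on T \<longleftrightarrow> integrable lborel (\<lambda>x. f x * indicator T x)"
    unfolding set_integrable_def using assms(1)
    by (simp add: integrable_completion mult.commute)
  show ?thesis
  proof (cases "f absolutely_integrable_on T")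
    case True
    have "integral T f = (LINT x:T|lebesgue. f x)"
      using set_lebesgue_integral_eq_integral(2)[OF True] by simp
    also have "\<dots> = integral\<^sup>L lborel (\<lambda>x. f x * indicator T x)"
      unfolding set_lebesgue_integral_def using assms(1) by (simp add: integral_completion mult.commute)
    finally show ?thesis
      using True iff nn_integral_eq_integral[of lborel "\<lambda>x. f x * indicator T x"] nn by simp
  next
    case False
    then have "\<not> integrable lborel (\<lambda>x. f x * indicator T x)" using iff by simp
    then have "\<not> (\<integral>\<^sup>+x. ennreal (f x * indicator T x) \<partial>lborel) < \<infinity>"
      using assms(1) nn by (auto simp: integrable_iff_bounded)
    then show ?thesis using False by (simp add: not_less top.extremum_unique)
  qed
qed

lemma nn_integral_change_of_variables_wellorder:
  fixes \<tau> :: "real ^ 'n::{finite,wellorder} \<Rightarrow> real ^ 'n::_"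
  assumes S: "S \<in> sets borel"
    and der: "\<And>x. x \<in> S \<Longrightarrow> (\<tau> has_derivative \<tau>' x) (at x within S)"
    and inj: "inj_on \<tau> S"
    and f: "(\<lambda>y. f y * indicator (\<tau> ` S) y) \<in> borel_measurable borel" "\<And>y. y \<in> \<tau> ` S \<Longrightarrow> 0 \<le> f y"
    and D: "(\<lambda>x. \<bar>det (matrix (\<tau>' x))\<bar> * f (\<tau> x) * indicator S x) \<in> borel_measurable borel"
  shows "(\<integral>\<^sup>+y. ennreal (f y * indicator (\<tau> ` S) y) \<partial>lborel) =
    (\<integral>\<^sup>+x. ennreal (\<bar>det (matrix (\<tau>' x))\<bar> * f (\<tau> x) * indicator S x) \<partial>lborel)"
proof -
  let ?D = "\<lambda>x. \<bar>det (matrix (\<tau>' x))\<bar> * f (\<tau> x)"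
  \<comment> \<open>Real values are packed into \<open>real^1\<close> because the theorem used
    concerns vector-valued integrands. Having the equivalence for every candidate value
    \<open>b\<close> gives both the equivalence of integrability and the equality of the
    integrals.\<close>
  have "(\<lambda>x. \<bar>det (matrix (\<tau>' x))\<bar> *\<^sub>R (vec (f (\<tau> x)) :: real^1)) absolutely_integrable_on S \<and>
         integral S (\<lambda>x. \<bar>det (matrix (\<tau>' x))\<bar> *\<^sub>R (vec (f (\<tau> x)) :: real^1)) = vec b
     \<longleftrightarrow> (\<lambda>y. vec (f y) :: real^1) absolutely_integrable_on (\<tau> ` S) \<and> integral (\<tau> ` S) (\<lambda>y. vec (f y) :: real^1) = vec b" for b
    using has_absolute_integral_change_of_variables[OF _ der inj, of "\<lambda>y. vec (f y)" "vec b"] S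
    by simp
  then have key: "?D absolutely_integrable_on S \<and> integral S ?D = b \<longleftrightarrow>
      f absolutely_integrable_on (\<tau> ` S) \<and> integral (\<tau> ` S) f = b" for b
    unfolding absolutely_integrable_on_1_iff integral_on_1_eq by (auto simp: o_def vec_eq_iff)
  have "?D absolutely_integrable_on S \<longleftrightarrow> f absolutely_integrable_on (\<tau> ` S)"
    using key by blast
  moreover have "integral S ?D = integral (\<tau> ` S) f" if "?D absolutely_integrable_on S"
    using key that by blast
  ultimately show ?thesis
    using f D by (subst (1 2) nn_integral_eq_set_integral) auto
qed

text \<open>The change of variables theorem of the library is stated for index types that are well ordered.
  A copy of the index type with an arbitrary well ordering removes this restriction.\<close>

typedef 'n ordered_copy = "UNIV :: 'n set" by simp

lemma bij_Rep_ordered_copy: "bij Rep_ordered_copy"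
  by (metis Abs_ordered_copy_inverse Rep_ordered_copy_inverse UNIV_I bij_iff)

lemma bij_Abs_ordered_copy: "bij Abs_ordered_copy"
  by (metis Abs_ordered_copy_inverse Rep_ordered_copy_inverse UNIV_I bij_iff)

instance ordered_copy :: (finite) finite
proof
  show "finite (UNIV :: 'a ordered_copy set)"
    using bij_betw_finite[OF bij_Rep_ordered_copy[where 'a='a]] by simp
qed

instantiation ordered_copy :: (finite) wellorder
begin

definition ordered_copy_index :: "'a ordered_copy \<Rightarrow> nat" where
  "ordered_copy_index = (SOME f. inj f)"

definition less_eq_ordered_copy :: "'a ordered_copy \<Rightarrow> 'a ordered_copy \<Rightarrow> bool" where
  "x \<le> y \<longleftrightarrow> ordered_copy_index x \<le> ordered_copy_index y"

definition less_ordered_copy :: "'a ordered_copy \<Rightarrow> 'a ordered_copy \<Rightarrow> bool" where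
  "x < y \<longleftrightarrow> ordered_copy_index x < ordered_copy_index y"

lemma inj_ordered_copy_index: "inj (ordered_copy_index :: 'a ordered_copy \<Rightarrow> nat)"
proof -
  have "\<exists>f :: 'a ordered_copy \<Rightarrow> nat. inj f"
    using finite_imp_inj_to_nat_seg[of "UNIV :: 'a ordered_copy set"] by auto
  then show ?thesis unfolding ordered_copy_index_def by (rule someI_ex)
qed

instance
proof
  fix P :: "'a ordered_copy \<Rightarrow> bool" and a
  assume step: "\<And>x. (\<And>y. y < x \<Longrightarrow> P y) \<Longrightarrow> P x"
  show "P a"
    by (induction a rule: measure_induct_rule[of ordered_copy_index])
      (use step in \<open>auto simp: less_ordered_copy_def\<close>)
qed (auto simp: less_eq_ordered_copy_def less_ordered_copy_def dest: injD[OF inj_ordered_copy_index])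

end

definition reindex :: "real ^ 'n \<Rightarrow> real ^ 'n ordered_copy" where
  "reindex x = (\<chi> i. x $ Rep_ordered_copy i)"

definition unreindex :: "real ^ 'n ordered_copy \<Rightarrow> real ^ 'n" where
  "unreindex x = (\<chi> i. x $ Abs_ordered_copy i)"

lemma reindex_inverse [simp]: "unreindex (reindex x) = x" "reindex (unreindex y) = y"
  by (auto simp: reindex_def unreindex_def vec_eq_iff Abs_ordered_copy_inverse Rep_ordered_copy_inverse)

lemma linear_reindex: "linear reindex" "linear unreindex"
  by (auto simp: reindex_def unreindex_def vec_eq_iff intro!: linearI)

lemma bounded_linear_reindex: "bounded_linear (reindex :: real ^ 'n::finite \<Rightarrow> _)"
    "bounded_linear (unreindex :: _ \<Rightarrow> real ^ 'n::finite)"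
  using linear_reindex linear_conv_bounded_linear by auto

lemma measurable_reindex: "reindex \<in> borel_measurable (borel :: (real ^ 'n::finite) measure)"
    "unreindex \<in> borel_measurable (borel :: (real ^ 'n::finite ordered_copy) measure)"
  using bounded_linear_reindex[where 'n='n] linear_continuous_on borel_measurable_continuous_onI by blast+

lemma prod_Basis_cart:
  fixes f :: "real ^ 'n::finite \<Rightarrow> real"
  shows "(\<Prod>b\<in>Basis. f b) = (\<Prod>i\<in>UNIV. f (axis i (1::real)))"
proof -
  have B: "Basis = range (\<lambda>i :: 'n. axis i (1::real))"
    by (auto simp: Basis_vec_def)
  have inj: "inj (\<lambda>i :: 'n. axis i (1::real))"
    by (simp add: inj_def axis_eq_axis)
  show ?thesis unfolding B by (subst prod.reindex[OF inj]) simp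
qed

text \<open>Lebesgue measure is determined by its values on boxes, and relabelling the coordinates
  only permutes the factors in the product of the side lengths.\<close>

lemma lborel_distr_reindex:
  "distr lborel borel reindex = (lborel :: (real ^ 'n::finite ordered_copy) measure)"
proof (rule lborel_eqI[symmetric])
  fix l u :: "real ^ 'n ordered_copy"
  assume le: "\<And>b. b \<in> Basis \<Longrightarrow> l \<bullet> b \<le> u \<bullet> b"
  have le': "unreindex l \<bullet> b \<le> unreindex u \<bullet> b" if "b \<in> Basis" for b :: "real ^ 'n"
  proof -
    have "l $ i \<le> u $ i" for i
      using le[of "axis i 1"] by (auto simp: Basis_vec_def cart_eq_inner_axis)
    then show ?thesis
      using that by (auto simp: Basis_vec_def cart_eq_inner_axis[symmetric] unreindex_def)
  qed
  have "reindex -` box l u = (box (unreindex l) (unreindex u) :: (real ^ 'n) set)"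
    by (auto simp: mem_box_cart reindex_def unreindex_def)
      (metis Abs_ordered_copy_inverse Rep_ordered_copy_inverse UNIV_I)+
  then have "emeasure (distr lborel borel reindex) (box l u) =
      emeasure lborel (box (unreindex l) (unreindex u :: real ^ 'n))"
    using measurable_reindex by (subst emeasure_distr) auto
  also have "\<dots> = ennreal (\<Prod>i\<in>UNIV. unreindex u $ i - unreindex l $ i)"
    using le' by (subst emeasure_lborel_box_eq)
      (auto simp: prod_Basis_cart cart_eq_inner_axis[symmetric] inner_diff_left)
  also have "(\<Prod>i\<in>UNIV. unreindex u $ i - unreindex l $ i) = (\<Prod>i\<in>UNIV. u $ i - l $ i)"
    by (rule prod.reindex_bij_witness[of _ Rep_ordered_copy Abs_ordered_copy])
      (auto simp: unreindex_def Abs_ordered_copy_inverse Rep_ordered_copy_inverse)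
  also have "\<dots> = (\<Prod>b\<in>Basis. (u - l) \<bullet> b)"
    by (simp add: prod_Basis_cart cart_eq_inner_axis[symmetric])
  finally show "emeasure (distr lborel borel reindex) (box l u) = ennreal (\<Prod>b\<in>Basis. (u - l) \<bullet> b)" .
qed simp

text \<open>Conjugation by the bijection matches the permutations of the two index types and
  preserves signs, so the Leibniz sums agree term by term.\<close>

lemma det_reindex:
  fixes M :: "real ^ 'n::finite ^ 'n"
  shows "det (\<chi> i j. M $ Rep_ordered_copy i $ Rep_ordered_copy j) = det M"
proof -
  let ?R = "Rep_ordered_copy :: 'n ordered_copy \<Rightarrow> 'n" and ?A = Abs_ordered_copy
  let ?m = "map_permutation UNIV ?R"
  have R: "bij_betw ?R UNIV UNIV" by (rule bij_Rep_ordered_copy)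
  have m: "?m p i = ?R (p (?A i))" for p i
  proof -
    have "inv_into UNIV ?R = ?A"
      using R by (metis Abs_ordered_copy_inverse Rep_ordered_copy_inverse UNIV_I bij_inv_eq_iff ext)
    moreover have "surj ?R" using R by (simp add: bij_betw_def)
    ultimately show ?thesis by (simp add: map_permutation_def restrict_id_def)
  qed
  have mA: "?m (map_permutation UNIV ?A q) = q" if "q permutes UNIV" for q
    by (rule map_permutation_compose_inv[OF bij_Abs_ordered_copy that]) (simp add: Abs_ordered_copy_inverse)
  have Am: "map_permutation UNIV ?A (?m p) = p" if "p permutes UNIV" for p
    by (rule map_permutation_compose_inv[OF R that]) (simp add: Rep_ordered_copy_inverse)
  have "det M = (\<Sum>q | q permutes UNIV. of_int (sign q) * (\<Prod>i\<in>UNIV. M $ i $ q i))"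
    by (simp add: det_def)
  also have "\<dots> = (\<Sum>p | p permutes UNIV. of_int (sign (?m p)) * (\<Prod>i\<in>UNIV. M $ i $ ?m p i))"
    by (rule sum.reindex_bij_witness[of _ ?m "map_permutation UNIV ?A"])
      (auto simp: mA Am map_permutation_permutes[OF R] map_permutation_permutes[OF bij_Abs_ordered_copy])
  also have "\<dots> = (\<Sum>p | p permutes UNIV. of_int (sign p) * (\<Prod>i\<in>UNIV. M $ ?R i $ ?R (p i)))"
  proof (rule sum.cong[OF refl])
    fix p :: "'n ordered_copy \<Rightarrow> _" assume "p \<in> {p. p permutes UNIV}"
    then have "sign (?m p) = sign p"
      using R by (intro sign_map_permutation) (auto simp: bij_betw_def)
    moreover have "(\<Prod>i\<in>UNIV. M $ i $ ?m p i) = (\<Prod>i\<in>UNIV. M $ ?R i $ ?R (p i))"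
      by (rule prod.reindex_bij_witness[of _ ?R ?A]) (auto simp: m Abs_ordered_copy_inverse Rep_ordered_copy_inverse)
    ultimately show "of_int (sign (?m p)) * (\<Prod>i\<in>UNIV. M $ i $ ?m p i) =
        of_int (sign p) * (\<Prod>i\<in>UNIV. M $ ?R i $ ?R (p i))" by simp
  qed
  also have "\<dots> = det (\<chi> i j. M $ ?R i $ ?R j)"
    by (simp add: det_def)
  finally show ?thesis ..
qed

theorem nn_integral_change_of_variables:
  fixes \<tau> :: "real ^ 'n::finite \<Rightarrow> real ^ 'n"
  assumes S: "S \<in> sets borel"
    and der: "\<And>x. x \<in> S \<Longrightarrow> (\<tau> has_derivative \<tau>' x) (at x within S)"
    and inj: "inj_on \<tau> S"
    and f: "(\<lambda>y. f y * indicator (\<tau> ` S) y) \<in> borel_measurable borel" "\<And>y. y \<in> \<tau> ` S \<Longrightarrow> 0 \<le> f y"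
    and D: "(\<lambda>x. \<bar>det (matrix (\<tau>' x))\<bar> * f (\<tau> x) * indicator S x) \<in> borel_measurable borel"
  shows "(\<integral>\<^sup>+y. ennreal (f y * indicator (\<tau> ` S) y) \<partial>lborel) =
    (\<integral>\<^sup>+x. ennreal (\<bar>det (matrix (\<tau>' x))\<bar> * f (\<tau> x) * indicator S x) \<partial>lborel)"
proof -
  let ?S = "unreindex -` S" and ?f = "f \<circ> unreindex"
  \<comment> \<open>Conjugating by the relabelling yields a map over the well ordered index type.
    Rows and columns of its Jacobian are relabelled alike, so \<open>det_reindex\<close> leaves the
    determinant unchanged.\<close>
  define \<sigma> :: "real ^ 'n ordered_copy \<Rightarrow> real ^ 'n ordered_copy" where "\<sigma> = reindex \<circ> \<tau> \<circ> unreindex"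
  define \<sigma>' where "\<sigma>' y = reindex \<circ> \<tau>' (unreindex y) \<circ> unreindex" for y :: "real ^ 'n ordered_copy"
  have ri: "(\<integral>\<^sup>+y. h (unreindex y) \<partial>lborel) = (\<integral>\<^sup>+x. h x \<partial>lborel)" if "h \<in> borel_measurable borel"
    for h :: "real ^ 'n \<Rightarrow> ennreal"
  proof -
    have "(\<integral>\<^sup>+y. h (unreindex y) \<partial>distr lborel borel reindex) = (\<integral>\<^sup>+x. h (unreindex (reindex x)) \<partial>lborel)"
      using measurable_reindex[where 'n='n] that by (intro nn_integral_distr) (auto intro!: measurable_compose[OF _ that])
    then show ?thesis by (simp add: lborel_distr_reindex)
  qed
  have img: "\<sigma> ` ?S = unreindex -` (\<tau> ` S)"
  proof (intro set_eqI iffI)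
    fix y assume "y \<in> unreindex -` (\<tau> ` S)"
    then obtain x where x: "x \<in> S" "unreindex y = \<tau> x" by auto
    then have "y = \<sigma> (reindex x)" by (simp add: \<sigma>_def) (metis reindex_inverse(2))
    then show "y \<in> \<sigma> ` ?S" using x by auto
  qed (auto simp: \<sigma>_def)
  have dd: "matrix (\<sigma>' y) = (\<chi> i j. matrix (\<tau>' (unreindex y)) $ Rep_ordered_copy i $ Rep_ordered_copy j)" for y
  proof -
    have "unreindex (axis j 1) = (axis (Rep_ordered_copy j) 1 :: real ^ 'n)" for j :: "'n ordered_copy"
      by (auto simp: unreindex_def axis_def vec_eq_iff Rep_ordered_copy_inverse Abs_ordered_copy_inverse)
    then show ?thesis by (simp add: matrix_def \<sigma>'_def reindex_def)
  qed
  have det: "det (matrix (\<sigma>' y)) = det (matrix (\<tau>' (unreindex y)))" for y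
    unfolding dd by (rule det_reindex)
  have "(\<integral>\<^sup>+y. ennreal (?f y * indicator (\<sigma> ` ?S) y) \<partial>lborel) =
    (\<integral>\<^sup>+x. ennreal (\<bar>det (matrix (\<sigma>' x))\<bar> * ?f (\<sigma> x) * indicator ?S x) \<partial>lborel)"
  proof (rule nn_integral_change_of_variables_wellorder)
    show "?S \<in> sets borel"
      using measurable_sets[OF measurable_reindex(2) S] by simp
    show "(\<sigma> has_derivative \<sigma>' y) (at y within ?S)" if "y \<in> ?S" for y
    proof -
      have "(\<tau> has_derivative \<tau>' (unreindex y)) (at (unreindex y) within unreindex ` ?S)"
        by (rule has_derivative_subset[OF der]) (use that in auto)
      from diff_chain_within[OF bounded_linear_imp_has_derivative[OF bounded_linear_reindex(2)] this]
      have "(\<tau> \<circ> unreindex has_derivative \<tau>' (unreindex y) \<circ> unreindex) (at y within ?S)" .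
      from diff_chain_within[OF this bounded_linear_imp_has_derivative[OF bounded_linear_reindex(1)]]
      show ?thesis by (simp add: \<sigma>_def \<sigma>'_def o_assoc)
    qed
    show "inj_on \<sigma> ?S"
      using inj by (auto simp: \<sigma>_def inj_on_def) (metis reindex_inverse)
    have "(\<lambda>y. f (unreindex y) * indicator (\<tau> ` S) (unreindex y)) \<in> borel_measurable borel"
      by (rule measurable_compose[OF measurable_reindex(2) f(1)])
    then show "(\<lambda>y. ?f y * indicator (\<sigma> ` ?S) y) \<in> borel_measurable borel"
      by (simp add: img indicator_vimage)
    show "0 \<le> ?f y" if "y \<in> \<sigma> ` ?S" for y using that f(2) by (auto simp: img)
    have "(\<lambda>x. \<bar>det (matrix (\<tau>' (unreindex x)))\<bar> * f (\<tau> (unreindex x)) * indicator S (unreindex x)) \<in> borel_measurable borel"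
      by (rule measurable_compose[OF measurable_reindex(2) D])
    then show "(\<lambda>x. \<bar>det (matrix (\<sigma>' x))\<bar> * ?f (\<sigma> x) * indicator ?S x) \<in> borel_measurable borel"
      by (simp add: det \<sigma>_def indicator_vimage)
  qed
  also have "(\<integral>\<^sup>+y. ennreal (?f y * indicator (\<sigma> ` ?S) y) \<partial>lborel) = (\<integral>\<^sup>+y. ennreal (f y * indicator (\<tau> ` S) y) \<partial>lborel)"
    using ri[of "\<lambda>y. ennreal (f y * indicator (\<tau> ` S) y)"] f(1) by (simp add: img indicator_vimage)
  also have "(\<integral>\<^sup>+x. ennreal (\<bar>det (matrix (\<sigma>' x))\<bar> * ?f (\<sigma> x) * indicator ?S x) \<partial>lborel) =
      (\<integral>\<^sup>+x. ennreal (\<bar>det (matrix (\<tau>' x))\<bar> * f (\<tau> x) * indicator S x) \<partial>lborel)"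
    using ri[of "\<lambda>x. ennreal (\<bar>det (matrix (\<tau>' x))\<bar> * f (\<tau> x) * indicator S x)"] D
    by (simp add: det \<sigma>_def indicator_vimage)
  finally show ?thesis .
qed

section \<open>Compact supports and vanishing integrals of derivatives\<close>

text \<open>\<open>S\<close> and \<open>- K\<close> are open and cover the space; on the second set
  the extension is identically zero.\<close>

lemma Ck_on_extend_zero:
  assumes "open S" "closed K" "K \<subseteq> S" "Ck_on S f k" "\<And>x. x \<in> S - K \<Longrightarrow> f x = 0"
  shows "Ck_on UNIV (\<lambda>x. if x \<in> S then f x else 0) k"
proof (rule Ck_on_open_cover)
  fix x
  show "\<exists>T. open T \<and> x \<in> T \<and> Ck_on (UNIV \<inter> T) (\<lambda>x. if x \<in> S then f x else 0) k"
  proof (cases "x \<in> S")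
    case True
    have "Ck_on S (\<lambda>x. if x \<in> S then f x else 0) k"
      by (rule Ck_on_cong_imp[OF assms(1) _ assms(4)]) simp
    then show ?thesis using True assms(1) by (intro exI[of _ S]) simp
  next
    case False
    have "Ck_on (- K) (\<lambda>x. if x \<in> S then f x else 0) k"
      by (rule Ck_on_cong_imp[OF _ _ Ck_on_const[of _ 0]]) (use assms in auto)
    then show ?thesis using False assms by (intro exI[of _ "- K"]) auto
  qed
qed simp

lemma integrable_compact_support:
  fixes f :: "'a::euclidean_space \<Rightarrow> real"
  assumes "continuous_on UNIV f" "compact K" "\<And>x. x \<notin> K \<Longrightarrow> f x = 0"
  shows "integrable lborel f"
proof -
  have "integrable lborel (\<lambda>x. indicator K x *\<^sub>R f x)"
    by (rule borel_integrable_compact) (use assms in \<open>auto intro: continuous_on_subset\<close>)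
  moreover have "(\<lambda>x. indicator K x *\<^sub>R f x) = f" using assms(3) by (fastforce simp: indicator_def)
  ultimately show ?thesis by simp
qed

text \<open>By translation invariance the difference quotients have integral zero.\<close>

theorem integral_pder_eq_0:
  fixes f :: "real ^ 'n::finite \<Rightarrow> real"
  assumes f: "Ck_on UNIV f 1" and K: "compact K" "\<And>x. x \<notin> K \<Longrightarrow> f x = 0"
  shows "integrable lborel (pder i f)" "(\<integral>x. pder i f x \<partial>lborel) = 0"
proof -
  have diff: "f differentiable (at x)" for x using f by simp
  have cont: "continuous_on UNIV (pder i f)" "continuous_on UNIV f"
    using Ck_on_pder[of UNIV f 0 i] Ck_on_continuous_on[of UNIV f 1] f by auto
  have zero: "pder i f x = 0" if "x \<notin> K" for x
    using pder_cong[of "- K" x f "\<lambda>_. 0" i] that diff K compact_imp_closed[OF K(1)] by auto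
  obtain R where R: "\<And>x. x \<in> K \<Longrightarrow> norm x \<le> R"
    using compact_imp_bounded[OF K(1)] by (auto simp: bounded_iff)
  have "compact (pder i f ` K)"
    by (rule compact_continuous_image[OF continuous_on_subset[OF cont(1)] K(1)]) simp
  then obtain B0 where B0: "\<And>x. x \<in> K \<Longrightarrow> \<bar>pder i f x\<bar> \<le> B0"
    using compact_imp_bounded[of "pder i f ` K"] by (auto simp: bounded_iff)
  define B where "B = max B0 0"
  have B: "\<bar>pder i f x\<bar> \<le> B" for x
    using B0[of x] zero[of x] by (cases "x \<in> K") (auto simp: B_def)
  let ?e = "axis i (1::real) :: real ^ 'n"
  have intf: "integrable lborel f"
    by (rule integrable_compact_support[OF cont(2) K])
  show "integrable lborel (pder i f)"
    by (rule integrable_compact_support[OF cont(1) K(1) zero])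
  define s where "s k x = (f (x + (1 / Suc k) *\<^sub>R ?e) - f x) * Suc k" for k x
  have trans: "integrable lborel (\<lambda>x. f (x + c))" "(\<integral>x. f (x + c) \<partial>lborel) = (\<integral>x. f x \<partial>lborel)" for c :: "real ^ 'n"
  proof -
    have "f \<in> borel_measurable borel" using cont(2) by (rule borel_measurable_continuous_onI)
    then show "integrable lborel (\<lambda>x. f (x + c))" "(\<integral>x. f (x + c) \<partial>lborel) = (\<integral>x. f x \<partial>lborel)"
      using intf lborel_distr_plus[of c] integrable_distr_eq[of "(+) c" lborel borel f]
        integral_distr[of "(+) c" lborel borel f] by (simp_all add: add.commute)
  qed
  have int0: "(\<integral>x. s k x \<partial>lborel) = 0" for k
    unfolding s_def using trans intf by simp
  have mvt: "\<exists>t\<in>{0<..<1}. s k x = pder i f (x + t *\<^sub>R ?e)" for k x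
  proof -
    let ?t = "1 / real (Suc k)"
    have "((\<lambda>t. f (x + t *\<^sub>R ?e)) has_real_derivative pder i f (x + t *\<^sub>R ?e)) (at t)" for t
      by (rule has_real_derivative_axis[OF diff])
    from MVT2[of 0 ?t, OF _ this] obtain t where t: "0 < t" "t < ?t"
      "f (x + ?t *\<^sub>R ?e) - f x = ?t * pder i f (x + t *\<^sub>R ?e)" by auto
    moreover have "?t \<le> 1" by simp
    then have "t < 1" using t(2) by linarith
    ultimately show ?thesis
      by (intro bexI[of _ t]) (auto simp: s_def field_simps simp del: of_nat_Suc)
  qed
  have "(\<lambda>k. \<integral>x. s k x \<partial>lborel) \<longlonglongrightarrow> (\<integral>x. pder i f x \<partial>lborel)"
  proof (rule integral_dominated_convergence)
    show "pder i f \<in> borel_measurable lborel"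
      using cont(1) borel_measurable_continuous_onI by auto
    show "s k \<in> borel_measurable lborel" for k
    proof -
      have "continuous_on UNIV (s k)"
        unfolding s_def by (intro continuous_intros continuous_on_compose2[OF cont(2)] cont(2)) auto
      then show ?thesis using borel_measurable_continuous_onI by auto
    qed
    \<comment> \<open>The dominating function: by \<open>mvt\<close> each quotient is a value of the
      partial derivative at a point at distance less than 1 from \<open>x\<close>. Hence it is
      bounded by \<open>B\<close> and vanishes outside the ball of radius
      \<open>R + 1\<close>.\<close>
    show "integrable lborel (\<lambda>x. B * indicator (cball 0 (R + 1)) x :: real)"
      by (intro integrable_mult_right integrable_real_indicator) (use emeasure_lborel_cball_finite in auto)
    show "AE x in lborel. norm (s k x) \<le> B * indicator (cball 0 (R + 1)) x" for k
    proof (rule AE_I2)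
      fix x
      obtain t where t: "t \<in> {0<..<1}" "s k x = pder i f (x + t *\<^sub>R ?e)" using mvt by blast
      show "norm (s k x) \<le> B * indicator (cball 0 (R + 1)) x"
      proof (cases "x + t *\<^sub>R ?e \<in> K")
        case True
        have "norm x \<le> norm (x + t *\<^sub>R ?e) + norm (t *\<^sub>R ?e)"
          using norm_triangle_ineq4[of "x + t *\<^sub>R ?e" "t *\<^sub>R ?e"] by simp
        then have "norm x \<le> R + 1" using R[OF True] t by simp
        then show ?thesis using B t by simp
      next
        case False
        then show ?thesis using zero t by (simp add: B_def)
      qed
    qed
    show "AE x in lborel. (\<lambda>k. s k x) \<longlonglongrightarrow> pder i f x"
    proof (rule AE_I2)
      fix x
      have "((\<lambda>t. f (x + t *\<^sub>R ?e)) has_real_derivative pder i f (x + 0 *\<^sub>R ?e)) (at 0)"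
        by (rule has_real_derivative_axis[OF diff])
      then have lim: "(\<lambda>h. (f (x + h *\<^sub>R ?e) - f x) / h) \<midarrow>0\<rightarrow> pder i f x"
        by (simp add: DERIV_def)
      have "filterlim (\<lambda>k. 1 / real (Suc k)) (at 0) sequentially"
        unfolding filterlim_at using LIMSEQ_inverse_real_of_nat by (simp add: inverse_eq_divide)
      from filterlim_compose[OF lim this]
      show "(\<lambda>k. s k x) \<longlonglongrightarrow> pder i f x"
        unfolding s_def by simp
    qed
  qed
  then show "(\<integral>x. pder i f x \<partial>lborel) = 0" using int0 by (simp add: LIMSEQ_const_iff)
qed

corollary integral_pder_on_eq_0:
  fixes f :: "real ^ 'n::finite \<Rightarrow> real"
  assumes "open S" "Ck_on S f 1" "compact K" "K \<subseteq> S" "\<And>x. x \<in> S - K \<Longrightarrow> f x = 0"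
  shows "integrable lborel (\<lambda>x. indicator S x * pder i f x)" "(\<integral>x. indicator S x * pder i f x \<partial>lborel) = 0"
proof -
  let ?F = "\<lambda>x. if x \<in> S then f x else 0"
  have F: "Ck_on UNIV ?F 1"
    by (rule Ck_on_extend_zero) (use assms compact_imp_closed in auto)
  have F0: "?F x = 0" if "x \<notin> K" for x using assms(5) that by auto
  have eq: "pder i ?F x = indicator S x * pder i f x" for x
  proof (cases "x \<in> S")
    case True
    then show ?thesis using pder_cong[OF assms(1) True, of ?F f i] F by simp
  next
    case False
    have "pder i ?F x = pder i (\<lambda>_. 0) x"
      by (rule pder_cong[of "- K"])
        (use False F assms(4,5) compact_imp_closed[OF assms(3)] in auto)
    then show ?thesis using False by simp
  qed
  show "integrable lborel (\<lambda>x. indicator S x * pder i f x)" "(\<integral>x. indicator S x * pder i f x \<partial>lborel) = 0"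
    using integral_pder_eq_0[OF F assms(3) F0, of i] unfolding eq by auto
qed

section \<open>Linear algebra\<close>

lemma sum_swap3: "(\<Sum>i\<in>A. \<Sum>j\<in>B. \<Sum>k\<in>C. f i j k) = (\<Sum>k\<in>C. \<Sum>i\<in>A. \<Sum>j\<in>B. f i j k)"
proof -
  have "(\<Sum>i\<in>A. \<Sum>j\<in>B. \<Sum>k\<in>C. f i j k) = (\<Sum>i\<in>A. \<Sum>k\<in>C. \<Sum>j\<in>B. f i j k)"
    by (intro sum.cong refl sum.swap)
  also have "\<dots> = (\<Sum>k\<in>C. \<Sum>i\<in>A. \<Sum>j\<in>B. f i j k)" by (rule sum.swap)
  finally show ?thesis .
qed

lemma sum_delta_mult: "(\<Sum>k\<in>(UNIV::'n::finite set). (if i = k then 1 else 0) * f k) = (f i :: real)"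
    "(\<Sum>k\<in>(UNIV::'n::finite set). f k * (if k = j then 1 else 0)) = (f j :: real)"
  by (simp_all add: if_distrib[of "\<lambda>x. x * _"] if_distrib[of "\<lambda>x. _ * x"] cong: if_cong)

lemma matrix_inv_works:
  assumes "invertible A"
  shows "A ** matrix_inv A = mat 1" "matrix_inv A ** A = mat 1"
  using assms unfolding invertible_def matrix_inv_def by (metis (mono_tags, lifting) someI_ex)+

lemma matrix_inv_unique:
  fixes A :: "real ^ 'n::finite ^ 'n"
  assumes "A ** B = mat 1"
  shows "matrix_inv A = B"
proof -
  have "B ** A = mat 1" using assms matrix_left_right_inverse by blast
  with assms have "invertible A" by (auto simp: invertible_def)
  then have "matrix_inv A = matrix_inv A ** (A ** B)" by (simp add: assms)
  also have "\<dots> = B" by (simp add: matrix_mul_assoc matrix_inv_works[OF \<open>invertible A\<close>])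
  finally show ?thesis .
qed

lemma pos_def_invertible:
  fixes A :: "real ^ 'n::finite ^ 'n"
  assumes "\<And>v. v \<noteq> 0 \<Longrightarrow> v \<bullet> (A *v v) > 0"
  shows "invertible A"
proof -
  have "v = 0" if "A *v v = 0" for v using assms[of v] that by force
  then show ?thesis
    using matrix_left_invertible_ker[of A] invertible_left_inverse by blast
qed

text \<open>All matrices on the segment from the identity to \<open>A\<close> are positive definite,
  hence invertible. Their determinant starts at 1 and cannot pass through 0.\<close>

lemma pos_def_det_pos:
  fixes A :: "real ^ 'n::finite ^ 'n"
  assumes pd: "\<And>v. v \<noteq> 0 \<Longrightarrow> v \<bullet> (A *v v) > 0"
  shows "det A > 0"
proof (rule ccontr)
  let ?P = "\<lambda>t::real. (1 - t) *\<^sub>R mat 1 + t *\<^sub>R A"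
  assume "\<not> det A > 0"
  moreover have "continuous_on {0..1} (\<lambda>t. det (?P t))"
    unfolding det_def by (intro continuous_intros)
  ultimately obtain t where t: "0 \<le> t" "t \<le> 1" "det (?P t) = 0"
    using IVT2'[of "\<lambda>t. det (?P t)" 1 0 0] by auto
  have "v \<bullet> (?P t *v v) > 0" if "v \<noteq> 0" for v
  proof -
    have "v \<bullet> (?P t *v v) = (1 - t) * (v \<bullet> v) + t * (v \<bullet> (A *v v))"
      by (simp add: matrix_vector_mult_add_rdistrib scaleR_matrix_vector_assoc[symmetric] inner_add_right)
    also have "\<dots> > 0"
      using t that pd[OF that] by (cases "t = 1") (auto intro!: add_pos_nonneg mult_pos_pos)
    finally show ?thesis .
  qed
  then have "invertible (?P t)" by (rule pos_def_invertible)
  then show False using t by (simp add: invertible_det_nz)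
qed

text \<open>The index set is a parameter so that an induction can remove one index at a
  time.\<close>

definition pos_semidef_on :: "'i set \<Rightarrow> ('i \<Rightarrow> 'i \<Rightarrow> real) \<Rightarrow> bool" where
  "pos_semidef_on I M \<longleftrightarrow> (\<forall>c. (\<Sum>i\<in>I. \<Sum>j\<in>I. M i j * c i * c j) \<ge> 0)"

text \<open>Eliminating one index by completing the square replaces \<open>M\<close> by a Schur complement.\<close>

lemma pos_semidef_sum_mult_nonneg:
  assumes "finite I" "pos_semidef_on I M" "pos_semidef_on I N" "\<And>i j. M i j = M j i"
  shows "(\<Sum>i\<in>I. \<Sum>j\<in>I. M i j * N i j) \<ge> 0"
  using assms
proof (induction I arbitrary: M rule: finite_induct)
  case (insert a I)
  \<comment> \<open>If the pivot \<open>M a a\<close> is 0, the quotient is 0 by convention; the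
    fact \<open>zero\<close> below then ensures that row and column \<open>a\<close> of
    \<open>M'\<close> vanish in this case too.\<close>
  define M' where "M' i j = M i j - M a i * M a j / M a a" for i j
  have expand: "(\<Sum>i\<in>insert a I. \<Sum>j\<in>insert a I. M i j * (c(a := t)) i * (c(a := t)) j) =
      t\<^sup>2 * M a a + 2 * t * (\<Sum>i\<in>I. M a i * c i) + (\<Sum>i\<in>I. \<Sum>j\<in>I. M i j * c i * c j)" for c t
  proof -
    have ne: "(c(a := t)) i = c i" if "i \<in> I" for i using insert that by auto
    have "(\<Sum>i\<in>insert a I. \<Sum>j\<in>insert a I. M i j * (c(a := t)) i * (c(a := t)) j) =
      M a a * t * t + (\<Sum>j\<in>I. M a j * t * c j) + (\<Sum>i\<in>I. M i a * c i * t + (\<Sum>j\<in>I. M i j * c i * c j))"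
      using insert.hyps ne by (simp cong: sum.cong)
    also have "\<dots> = t\<^sup>2 * M a a + 2 * t * (\<Sum>i\<in>I. M a i * c i) + (\<Sum>i\<in>I. \<Sum>j\<in>I. M i j * c i * c j)"
    proof -
      have "(\<Sum>i\<in>I. M i a * c i * t) = (\<Sum>j\<in>I. M a j * t * c j)"
        using insert.prems(3)[of a] by (intro sum.cong) (auto simp: mult_ac)
      moreover have "(\<Sum>j\<in>I. M a j * t * c j) = t * (\<Sum>i\<in>I. M a i * c i)"
        by (simp add: sum_distrib_left mult_ac)
      ultimately show ?thesis by (simp add: sum.distrib power2_eq_square mult_ac)
    qed
    finally show ?thesis .
  qed
  have q: "t\<^sup>2 * M a a + 2 * t * (\<Sum>i\<in>I. M a i * c i) + (\<Sum>i\<in>I. \<Sum>j\<in>I. M i j * c i * c j) \<ge> 0" for c t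
    using insert.prems(1) unfolding pos_semidef_on_def expand[symmetric] by blast
  have aa: "M a a \<ge> 0"
    using q[of 1 "\<lambda>_. 0"] by simp
  have zero: "M a b = 0" if "M a a = 0" "b \<in> I" for b
  proof (rule ccontr)
    assume ne: "M a b \<noteq> 0"
    let ?c = "\<lambda>i. if i = b then 1 else 0 :: real"
    have *: "(\<Sum>i\<in>I. M a i * ?c i) = M a b" "(\<Sum>i\<in>I. \<Sum>j\<in>I. M i j * ?c i * ?c j) = M b b"
      using that(2) insert.hyps(1) by (simp_all add: if_distrib[of "\<lambda>x. _ * x"] if_distrib[of "\<lambda>x. x * _"] cong: if_cong)
    \<comment> \<open>This value of the free coordinate turns \<open>2 * t * M a b + M b b\<close>
      into -1.\<close>
    show False
      using q[of "- (M b b + 1) / (2 * M a b)" ?c] that(1) ne unfolding * by (simp add: field_simps)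
  qed
  have zero': "M' a j = 0" "M' j a = 0" if "j \<in> insert a I" for j
    using zero[of j] that insert.prems(3)[of j a] by (auto simp: M'_def)
  have "pos_semidef_on I M'"
    unfolding pos_semidef_on_def
  proof
    fix c
    define L where "L = (\<Sum>i\<in>I. M a i * c i)"
    have "(\<Sum>i\<in>I. \<Sum>j\<in>I. M' i j * c i * c j) = (\<Sum>i\<in>I. \<Sum>j\<in>I. M i j * c i * c j) - L * L / M a a"
      unfolding L_def sum_product by (simp add: M'_def sum_subtractf sum_divide_distrib algebra_simps)
    \<comment> \<open>The form is evaluated at the value of the eliminated coordinate that minimises
      it.\<close>
    also have "\<dots> \<ge> 0"
      using q[of "- L / M a a" c] aa unfolding L_def[symmetric]
      by (cases "M a a = 0") (simp_all add: power2_eq_square field_simps)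
    finally show "(\<Sum>i\<in>I. \<Sum>j\<in>I. M' i j * c i * c j) \<ge> 0" .
  qed
  moreover have "pos_semidef_on I N"
    unfolding pos_semidef_on_def
  proof
    fix c :: "_ \<Rightarrow> real"
    let ?c = "c(a := 0)"
    have ne: "?c i = c i" if "i \<in> I" for i using insert that by auto
    have "0 \<le> (\<Sum>i\<in>insert a I. \<Sum>j\<in>insert a I. N i j * ?c i * ?c j)"
      using insert.prems(2) unfolding pos_semidef_on_def by blast
    also have "\<dots> = (\<Sum>i\<in>I. \<Sum>j\<in>I. N i j * c i * c j)"
      using insert.hyps ne by (simp cong: sum.cong)
    finally show "0 \<le> (\<Sum>i\<in>I. \<Sum>j\<in>I. N i j * c i * c j)" .
  qed
  moreover have "M' i j = M' j i" for i j by (simp add: M'_def insert.prems(3)[of i j])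
  ultimately have "0 \<le> (\<Sum>i\<in>I. \<Sum>j\<in>I. M' i j * N i j)" by (rule insert.IH)
  also have "\<dots> = (\<Sum>i\<in>insert a I. \<Sum>j\<in>insert a I. M' i j * N i j)"
    using insert.hyps zero' by simp
  also have "\<dots> + (\<Sum>i\<in>insert a I. \<Sum>j\<in>insert a I. N i j * M a i * M a j) / M a a =
      (\<Sum>i\<in>insert a I. \<Sum>j\<in>insert a I. M i j * N i j)"
    unfolding sum_divide_distrib sum.distrib[symmetric] by (simp add: M'_def algebra_simps)
  moreover have "0 \<le> (\<Sum>i\<in>insert a I. \<Sum>j\<in>insert a I. N i j * M a i * M a j) / M a a"
    using aa insert.prems(2) unfolding pos_semidef_on_def by simp
  ultimately show ?case by linarith
qed simp

section \<open>Riemannian geometry in a coordinate domain\<close>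

definition ginv :: "(real ^ 'n \<Rightarrow> real ^ 'n ^ 'n) \<Rightarrow> 'n::finite \<Rightarrow> 'n \<Rightarrow> real ^ 'n \<Rightarrow> real" where
  "ginv G i j x = matrix_inv (G x) $ i $ j"

text \<open>This is \<nabla>f1 \<cdot> \<nabla>f2: raising the index of both differentials cancels
  the metric against one of the two inverse metrics.\<close>

definition gdot :: "(real ^ 'n \<Rightarrow> real ^ 'n ^ 'n) \<Rightarrow> (real ^ 'n \<Rightarrow> real) \<Rightarrow> (real ^ 'n \<Rightarrow> real) \<Rightarrow> real ^ 'n::finite \<Rightarrow> real" where
  "gdot G f1 f2 x = (\<Sum>i\<in>UNIV. \<Sum>j\<in>UNIV. ginv G i j x * pder i f1 x * pder j f2 x)"

definition gdens :: "(real ^ 'n \<Rightarrow> real ^ 'n ^ 'n) \<Rightarrow> real ^ 'n::finite \<Rightarrow> real" where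
  "gdens G x = sqrt (det (G x))"

text \<open>A metric in a single coordinate domain, so that tensor calculus can be done without an
  atlas. Each chart of a Riemannian manifold gives an instance.\<close>

locale local_metric =
  fixes S :: "(real ^ 'n::finite) set" and G :: "real ^ 'n \<Rightarrow> real ^ 'n ^ 'n"
  assumes open_S: "open S"
    and smooth_G: "smooth_on S G"
    and sym_G: "\<And>x. x \<in> S \<Longrightarrow> transpose (G x) = G x"
    and pos_def_G: "\<And>x v. x \<in> S \<Longrightarrow> v \<noteq> 0 \<Longrightarrow> v \<bullet> (G x *v v) > 0"
begin

section \<open>Regularity and positivity of the coefficients\<close>

lemma G_sym: "x \<in> S \<Longrightarrow> G x $ i $ j = G x $ j $ i"
  using arg_cong[OF sym_G[of x], of "\<lambda>M. M $ i $ j"] by (simp add: transpose_def)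

lemma Ck_G: "Ck_on S (\<lambda>x. G x $ i $ j) k"
proof -
  have "bounded_linear (\<lambda>M :: real ^ 'n ^ 'n. M $ i $ j)"
    by (rule bounded_linear_compose[OF bounded_linear_vec_nth bounded_linear_vec_nth])
  then show ?thesis
    using smooth_G Ck_on_bounded_linear[OF _ open_S] unfolding smooth_on_def by blast
qed

lemma det_pos: "x \<in> S \<Longrightarrow> det (G x) > 0"
  by (rule pos_def_det_pos) (rule pos_def_G)

lemma invertible_G: "x \<in> S \<Longrightarrow> invertible (G x)"
  by (rule pos_def_invertible) (rule pos_def_G)

lemma ginv_G: "x \<in> S \<Longrightarrow> (\<Sum>k\<in>UNIV. ginv G i k x * G x $ k $ j) = (if i = j then 1 else 0)"
  using matrix_inv_works(2)[OF invertible_G, of x]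
  by (simp add: ginv_def matrix_matrix_mult_def mat_def vec_eq_iff)

lemma G_ginv: "x \<in> S \<Longrightarrow> (\<Sum>k\<in>UNIV. G x $ i $ k * ginv G k j x) = (if i = j then 1 else 0)"
  using matrix_inv_works(1)[OF invertible_G, of x]
  by (simp add: ginv_def matrix_matrix_mult_def mat_def vec_eq_iff)

lemma ginv_sym: "x \<in> S \<Longrightarrow> ginv G i j x = ginv G j i x"
proof -
  assume x: "x \<in> S"
  have "transpose (matrix_inv (G x) ** G x) = mat 1"
    using matrix_inv_works(2)[OF invertible_G[OF x]] by (simp add: transpose_mat)
  then have "G x ** transpose (matrix_inv (G x)) = mat 1"
    by (simp add: matrix_transpose_mul sym_G[OF x])
  then have "matrix_inv (G x) = transpose (matrix_inv (G x))" by (rule matrix_inv_unique)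
  from arg_cong[OF this, of "\<lambda>M. M $ i $ j"] show ?thesis
    by (simp add: ginv_def transpose_def)
qed

lemma Ck_det: "Ck_on S (\<lambda>x. det (G x)) k"
  unfolding det_def by (intro Ck_on_sum Ck_on_cmult Ck_on_prod Ck_G open_S)

lemma Ck_gdens: "Ck_on S (gdens G) k"
  unfolding gdens_def by (intro Ck_on_sqrt open_S Ck_det det_pos)

lemma gdens_pos: "x \<in> S \<Longrightarrow> gdens G x > 0"
  unfolding gdens_def using det_pos by simp

text \<open>Cramer's rule writes each entry of the inverse as a quotient of polynomials in the
  entries of \<open>G x\<close>, with positive denominator.\<close>

lemma Ck_ginv: "Ck_on S (ginv G i j) k"
proof -
  let ?C = "\<lambda>x. (\<chi> a b. if b = i then axis j 1 $ a else G x $ a $ b) :: real ^ 'n ^ 'n"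
  have c: "ginv G i j x = det (?C x) / det (G x)" if "x \<in> S" for x
  proof -
    have "G x *v (\<chi> k. ginv G k j x) = axis j 1"
      using G_ginv[OF that, of _ j] by (simp add: matrix_vector_mult_def vec_eq_iff axis_def)
    then have "(\<chi> k. ginv G k j x) = (\<chi> k. det (\<chi> a b. if b = k then axis j 1 $ a else G x $ a $ b) / det (G x))"
      using cramer[of "G x"] det_pos[OF that] by force
    then show ?thesis by (simp add: vec_eq_iff)
  qed
  have "Ck_on S (\<lambda>x. ?C x $ a $ b) k" for a b
    using Ck_G[of a b k] by (cases "b = i") (auto simp: Ck_on_const)
  then have "Ck_on S (\<lambda>x. det (?C x)) k"
    unfolding det_def by (intro Ck_on_sum Ck_on_cmult Ck_on_prod open_S)
  then have "Ck_on S (\<lambda>x. det (?C x) / det (G x)) k"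
    using det_pos by (intro Ck_on_divide open_S Ck_det) (auto dest: less_imp_neq[OF det_pos])
  from Ck_on_cong_imp[OF open_S c[symmetric] this] show ?thesis .
qed

lemma Ck_christoffel: "Ck_on S (christoffel G k i j) n"
proof -
  have "Ck_on S (\<lambda>x. 1 / 2 * (\<Sum>l\<in>UNIV. ginv G k l x *
     (pder i (\<lambda>y. G y $ j $ l) x + pder j (\<lambda>y. G y $ i $ l) x - pder l (\<lambda>y. G y $ i $ j) x))) n"
    by (intro Ck_on_cmult Ck_on_sum Ck_on_mult Ck_on_diff Ck_on_add Ck_on_pder[OF Ck_G] Ck_ginv open_S)
  then show ?thesis by (simp add: christoffel_def[abs_def] ginv_def[abs_def])
qed

lemmas differentiable_intros = Ck_on_differentiable[OF Ck_G, of 1] Ck_on_differentiable[OF Ck_ginv, of 1]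
  Ck_on_differentiable[OF Ck_gdens, of 1] Ck_on_differentiable[OF Ck_det, of 1]
  Ck_on_differentiable[OF Ck_christoffel, of 1]

lemma differentiable_at:
  assumes "x \<in> S"
  shows "(\<lambda>y. G y $ i $ j) differentiable (at x)" "ginv G i j differentiable (at x)"
    "gdens G differentiable (at x)" "(\<lambda>y. det (G y)) differentiable (at x)"
    "christoffel G k i j differentiable (at x)"
  using differentiable_intros assms by auto

lemma pder_G_sym: "x \<in> S \<Longrightarrow> pder k (\<lambda>y. G y $ i $ j) x = pder k (\<lambda>y. G y $ j $ i) x"
  by (rule pder_cong[OF open_S]) (auto intro: differentiable_intros G_sym)

lemma christoffel_sym: "x \<in> S \<Longrightarrow> christoffel G k i j x = christoffel G k j i x"
  unfolding christoffel_def using pder_G_sym[of x _ i j] by (simp add: algebra_simps)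

lemma ginv_pos_def:
  assumes "x \<in> S" "a \<noteq> 0"
  shows "(\<Sum>i\<in>UNIV. \<Sum>j\<in>UNIV. ginv G i j x * a $ i * a $ j) > 0"
proof -
  define b where "b = matrix_inv (G x) *v a"
  have a: "a = G x *v b"
    by (simp add: b_def matrix_vector_mul_assoc matrix_inv_works[OF invertible_G[OF assms(1)]])
  then have "b \<noteq> 0" using assms(2) by auto
  then have "0 < b \<bullet> a" using pos_def_G[OF assms(1)] a by simp
  also have "b \<bullet> a = (\<Sum>i\<in>UNIV. \<Sum>j\<in>UNIV. ginv G i j x * a $ i * a $ j)"
    by (simp add: b_def inner_vec_def matrix_vector_mult_def ginv_def sum_distrib_left mult_ac)
  finally show ?thesis .
qed

lemma pos_semidef_ginv: "x \<in> S \<Longrightarrow> pos_semidef_on UNIV (\<lambda>i j. ginv G i j x)"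
  unfolding pos_semidef_on_def
proof
  fix c :: "'n \<Rightarrow> real" assume x: "x \<in> S"
  show "0 \<le> (\<Sum>i\<in>UNIV. \<Sum>j\<in>UNIV. ginv G i j x * c i * c j)"
    using ginv_pos_def[OF x, of "\<chi> i. c i"] by (cases "(\<chi> i. c i) = 0") (auto simp: vec_eq_iff)
qed

section \<open>Derivatives of the inverse metric and of the volume density\<close>

text \<open>In coordinates, this says that the inverse metric is parallel. Differentiating the
  product of the inverse with \<open>G\<close> gives d(G^-1) = - G^-1 (dG) G^-1. In the sum of the
  two Christoffel terms everything cancels except the derivative of \<open>G\<close> in direction
  \<open>k\<close>.\<close>

lemma pder_ginv:
  assumes x: "x \<in> S"
  shows "pder k (ginv G i j) x =
    - (\<Sum>l\<in>UNIV. christoffel G i k l x * ginv G l j x + christoffel G j k l x * ginv G i l x)"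
proof -
  let ?h = "\<lambda>i j. ginv G i j x" and ?D = "\<lambda>k i j. pder k (\<lambda>y. G y $ i $ j) x"
  have prod: "(\<Sum>b\<in>UNIV. pder k (ginv G i b) x * G x $ b $ c) = - (\<Sum>b\<in>UNIV. ?h i b * ?D k b c)" for c
  proof -
    have "pder k (\<lambda>y. \<Sum>b\<in>UNIV. ginv G i b y * G y $ b $ c) x = pder k (\<lambda>y. if i = c then 1 else 0) x"
      by (rule pder_cong[OF open_S x])
        (use x in \<open>auto intro!: differentiable_sum differentiable_mult differentiable_intros simp: ginv_G\<close>)
    moreover have "pder k (\<lambda>y. \<Sum>b\<in>UNIV. ginv G i b y * G y $ b $ c) x =
        (\<Sum>b\<in>UNIV. pder k (ginv G i b) x * G x $ b $ c + ?h i b * ?D k b c)"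
      by (simp add: pder_sum pder_mult differentiable_mult differentiable_at[OF x])
    ultimately show ?thesis by (simp add: sum.distrib eq_neg_iff_add_eq_0)
  qed
  have "pder k (ginv G i j) x = (\<Sum>b\<in>UNIV. pder k (ginv G i b) x * (\<Sum>c\<in>UNIV. G x $ b $ c * ?h c j))"
    by (simp add: G_ginv[OF x] sum_delta_mult)
  also have "\<dots> = (\<Sum>c\<in>UNIV. (\<Sum>b\<in>UNIV. pder k (ginv G i b) x * G x $ b $ c) * ?h c j)"
    by (simp add: sum_distrib_left sum_distrib_right mult.assoc) (rule sum.swap)
  also have "\<dots> = (\<Sum>c\<in>UNIV. - (\<Sum>b\<in>UNIV. ?h i b * ?D k b c) * ?h c j)"
    by (simp only: prod)
  also have "\<dots> = - (\<Sum>l\<in>UNIV. \<Sum>m\<in>UNIV. ?h i m * ?h l j * ?D k m l)"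
    by (simp add: sum_distrib_left sum_negf mult_ac)
  finally have 1: "pder k (ginv G i j) x = - (\<Sum>l\<in>UNIV. \<Sum>m\<in>UNIV. ?h i m * ?h l j * ?D k m l)" .
  have "(\<Sum>l\<in>UNIV. christoffel G i k l x * ?h l j) =
      (\<Sum>l\<in>UNIV. \<Sum>m\<in>UNIV. ?h i m * ?h l j * (?D k l m + ?D l k m - ?D m k l) / 2)"
    by (simp add: christoffel_def ginv_def[symmetric] sum_distrib_left sum_divide_distrib[symmetric] mult_ac)
  moreover have "(\<Sum>l\<in>UNIV. christoffel G j k l x * ?h i l) =
      (\<Sum>l\<in>UNIV. \<Sum>m\<in>UNIV. ?h i m * ?h l j * (?D k m l + ?D m k l - ?D l k m) / 2)"
    by (subst sum.swap) (simp add: christoffel_def ginv_def[symmetric] sum_distrib_left sum_divide_distrib[symmetric]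
        mult_ac ginv_sym[OF x, of j])
  ultimately have "(\<Sum>l\<in>UNIV. christoffel G i k l x * ?h l j + christoffel G j k l x * ?h i l) =
      (\<Sum>l\<in>UNIV. \<Sum>m\<in>UNIV. ?h i m * ?h l j * (?D k l m + ?D l k m - ?D m k l) / 2 +
         ?h i m * ?h l j * (?D k m l + ?D m k l - ?D l k m) / 2)"
    by (simp add: sum.distrib)
  also have "\<dots> = (\<Sum>l\<in>UNIV. \<Sum>m\<in>UNIV. ?h i m * ?h l j * ?D k m l)"
    by (intro sum.cong refl) (simp add: pder_G_sym[OF x, of k] field_simps)
  finally show ?thesis using 1 by simp
qed

text \<open>Jacobi's formula. The determinant is differentiated row by row; each differentiated row
  is a linear combination of the rows of \<open>G x\<close>, so Cramer's lemma evaluates the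
  resulting determinants.\<close>

lemma pder_det:
  assumes x: "x \<in> S"
  shows "pder k (\<lambda>y. det (G y)) x = det (G x) * (\<Sum>i\<in>UNIV. \<Sum>j\<in>UNIV. ginv G i j x * pder k (\<lambda>y. G y $ i $ j) x)"
proof -
  let ?D = "\<lambda>i j. pder k (\<lambda>y. G y $ i $ j) x"
  have "pder k (\<lambda>y. det (G y)) x =
      (\<Sum>p | p permutes UNIV. of_int (sign p) * (\<Sum>i\<in>UNIV. ?D i (p i) * (\<Prod>l\<in>UNIV-{i}. G x $ l $ p l)))"
  proof -
    have "(\<lambda>y. \<Prod>i\<in>UNIV. G y $ i $ p i) differentiable (at x)" for p
      using x by (intro Ck_on_differentiable[OF Ck_on_prod[OF open_S Ck_G], of 1]) auto
    then show ?thesis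
      unfolding det_def by (simp add: pder_sum pder_cmult pder_prod differentiable_mult differentiable_at[OF x])
  qed
  also have "\<dots> = (\<Sum>i\<in>UNIV. \<Sum>p | p permutes UNIV. of_int (sign p) * (?D i (p i) * (\<Prod>l\<in>UNIV-{i}. G x $ l $ p l)))"
    by (simp add: sum_distrib_left) (rule sum.swap)
  also have "\<dots> = (\<Sum>i\<in>UNIV. det ((\<chi> a. if a = i then (\<chi> b. ?D i b) else row a (G x)) :: real ^ 'n ^ 'n))"
  proof (intro sum.cong refl)
    fix i
    have "(\<Prod>l\<in>UNIV. (if l = i then (\<chi> b. ?D i b) else row l (G x)) $ p l) =
        ?D i (p i) * (\<Prod>l\<in>UNIV-{i}. G x $ l $ p l)" for p
      by (subst prod.remove[of _ i]) (auto simp: row_def intro!: prod.cong)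
    then show "(\<Sum>p | p permutes UNIV. of_int (sign p) * (?D i (p i) * (\<Prod>l\<in>UNIV-{i}. G x $ l $ p l))) =
        det ((\<chi> a. if a = i then (\<chi> b. ?D i b) else row a (G x)) :: real ^ 'n ^ 'n)"
      by (simp add: det_def)
  qed
  also have "\<dots> = (\<Sum>i\<in>UNIV. (\<Sum>j\<in>UNIV. ?D i j * ginv G j i x) * det (G x))"
  proof (intro sum.cong refl)
    fix i
    \<comment> \<open>The coordinates of the differentiated row \<open>i\<close> with respect to the
      rows of \<open>G x\<close>. Of these, only the coordinate at \<open>i\<close> survives in the
      determinant.\<close>
    define c where "c = (\<chi> m. \<Sum>j\<in>UNIV. ?D i j * ginv G j m x)"
    have rows: "(\<Sum>m\<in>UNIV. c $ m *s row m (G x)) = (\<chi> b. ?D i b)"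
    proof -
      have "(\<Sum>m\<in>UNIV. (\<Sum>j\<in>UNIV. ?D i j * ginv G j m x) * G x $ m $ b) =
          (\<Sum>j\<in>UNIV. ?D i j * (\<Sum>m\<in>UNIV. ginv G j m x * G x $ m $ b))" for b
        by (simp add: sum_distrib_left sum_distrib_right mult.assoc) (rule sum.swap)
      then have "(\<Sum>m\<in>UNIV. (\<Sum>j\<in>UNIV. ?D i j * ginv G j m x) * G x $ m $ b) = ?D i b" for b
        by (simp add: ginv_G[OF x] sum_delta_mult)
      then show ?thesis by (simp add: vec_eq_iff c_def row_def)
    qed
    show "det ((\<chi> a. if a = i then (\<chi> b. ?D i b) else row a (G x)) :: real ^ 'n ^ 'n) =
        (\<Sum>j\<in>UNIV. ?D i j * ginv G j i x) * det (G x)"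
      using cramer_lemma_transpose[of i c "G x"] unfolding rows by (simp add: c_def)
  qed
  also have "\<dots> = det (G x) * (\<Sum>i\<in>UNIV. \<Sum>j\<in>UNIV. ginv G i j x * ?D i j)"
    by (simp add: sum_distrib_left sum_distrib_right mult_ac ginv_sym[OF x])
  finally show ?thesis .
qed

text \<open>In the contracted Christoffel symbol the part antisymmetric in the summation indices is
  annihilated by the symmetric inverse metric. What remains is half the logarithmic derivative of
  the determinant.\<close>

lemma pder_gdens:
  assumes x: "x \<in> S"
  shows "pder k (gdens G) x = gdens G x * (\<Sum>l\<in>UNIV. christoffel G l l k x)"
proof -
  let ?D = "\<lambda>k i j. pder k (\<lambda>y. G y $ i $ j) x"
  have "(\<Sum>l\<in>UNIV. christoffel G l l k x) =
      (\<Sum>l\<in>UNIV. \<Sum>m\<in>UNIV. ginv G l m x * (?D l k m - ?D m l k) / 2) + (\<Sum>l\<in>UNIV. \<Sum>m\<in>UNIV. ginv G l m x * ?D k l m) / 2"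
    unfolding christoffel_def ginv_def[symmetric] sum_divide_distrib sum.distrib[symmetric] sum_distrib_left
    by (intro sum.cong refl) (simp add: distrib_left right_diff_distrib diff_divide_distrib add_divide_distrib)
  moreover have "(\<Sum>l\<in>UNIV. \<Sum>m\<in>UNIV. ginv G l m x * (?D l k m - ?D m l k) / 2) = 0"
  proof -
    let ?s = "\<Sum>l\<in>UNIV. \<Sum>m\<in>UNIV. ginv G l m x * (?D l k m - ?D m l k) / 2"
    have "?s = (\<Sum>m\<in>UNIV. \<Sum>l\<in>UNIV. ginv G l m x * (?D l k m - ?D m l k) / 2)" by (rule sum.swap)
    also have "\<dots> = (\<Sum>m\<in>UNIV. \<Sum>l\<in>UNIV. - (ginv G m l x * (?D m k l - ?D l m k) / 2))"
    proof (intro sum.cong refl)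
      fix m l
      show "ginv G l m x * (?D l k m - ?D m l k) / 2 = - (ginv G m l x * (?D m k l - ?D l m k) / 2)"
        unfolding ginv_sym[OF x, of l m] pder_G_sym[OF x, of l k m] pder_G_sym[OF x, of m l k] by (simp add: right_diff_distrib diff_divide_distrib)
    qed
    also have "\<dots> = - ?s" by (simp add: sum_negf)
    finally show ?thesis by simp
  qed
  ultimately have trace: "(\<Sum>l\<in>UNIV. christoffel G l l k x) = (\<Sum>l\<in>UNIV. \<Sum>m\<in>UNIV. ginv G l m x * ?D k l m) / 2" by simp
  have "pder k (gdens G) x = pder k (\<lambda>y. det (G y)) x / (2 * sqrt (det (G x)))"
    unfolding gdens_def[abs_def] using x by (intro pder_sqrt differentiable_intros det_pos) auto
  also have "\<dots> = (det (G x) / sqrt (det (G x))) * (\<Sum>l\<in>UNIV. christoffel G l l k x)"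
    unfolding pder_det[OF x] trace by simp
  finally show ?thesis
    using det_pos[OF x] by (simp add: gdens_def real_div_sqrt)
qed

section \<open>The Laplacian as a trace, and derivatives of gradients\<close>

text \<open>When the divergence form is expanded, the derivative of the density cancels one of the
  two Christoffel terms of \<open>pder_ginv\<close>; the other one completes the second derivatives
  to the Hessian. The divergence form serves Green's identity, the trace form the Bochner
  formula.\<close>

lemma laplace_trace:
  assumes x: "x \<in> S" and f: "Ck_on S f 2"
  shows "laplace_coeff G f x = (\<Sum>i\<in>UNIV. \<Sum>j\<in>UNIV. ginv G i j x * hessian_coeff G f i j x)"
proof -
  let ?h = "\<lambda>i j. ginv G i j x" and ?C = "\<lambda>k i j. christoffel G k i j x"
  have df: "pder j f differentiable (at x)" for j
    using Ck_on_differentiable[OF Ck_on_pder[of S f 1 j] _ x] f by (simp add: numeral_2_eq_2)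
  have ds: "(\<lambda>y. \<Sum>j\<in>UNIV. ginv G i j y * pder j f y) differentiable (at x)" for i
    by (simp add: differentiable_sum differentiable_mult differentiable_at[OF x] df)
  have "laplace_coeff G f x = 1 / gdens G x * (\<Sum>i\<in>UNIV.
      pder i (\<lambda>y. gdens G y * (\<Sum>j\<in>UNIV. ginv G i j y * pder j f y)) x)"
    by (simp add: laplace_coeff_def gdens_def ginv_def)
  also have "\<dots> = 1 / gdens G x * (\<Sum>i\<in>UNIV. gdens G x * (\<Sum>l\<in>UNIV. ?C l l i) * (\<Sum>j\<in>UNIV. ?h i j * pder j f x) +
      gdens G x * (\<Sum>j\<in>UNIV. - (\<Sum>l\<in>UNIV. ?C i i l * ?h l j + ?C j i l * ?h i l) * pder j f x + ?h i j * pder i (pder j f) x))"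
    by (simp add: pder_mult pder_sum ds df differentiable_at[OF x] differentiable_mult pder_gdens[OF x] pder_ginv[OF x])
  also have "\<dots> = (\<Sum>i\<in>UNIV. (\<Sum>l\<in>UNIV. ?C l l i) * (\<Sum>j\<in>UNIV. ?h i j * pder j f x) +
      (\<Sum>j\<in>UNIV. - (\<Sum>l\<in>UNIV. ?C i i l * ?h l j + ?C j i l * ?h i l) * pder j f x + ?h i j * pder i (pder j f) x))"
    using gdens_pos[OF x] by (simp add: sum_distrib_left distrib_left mult.assoc[symmetric])
  also have "\<dots> = (\<Sum>i\<in>UNIV. \<Sum>j\<in>UNIV. \<Sum>l\<in>UNIV. ?C l l i * (?h i j * pder j f x))
      - (\<Sum>i\<in>UNIV. \<Sum>j\<in>UNIV. \<Sum>l\<in>UNIV. ?C i i l * ?h l j * pder j f x)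
      - (\<Sum>i\<in>UNIV. \<Sum>j\<in>UNIV. \<Sum>l\<in>UNIV. ?C j i l * ?h i l * pder j f x)
      + (\<Sum>i\<in>UNIV. \<Sum>j\<in>UNIV. ?h i j * pder i (pder j f) x)"
    by (simp add: sum.distrib sum_negf sum_subtractf sum_distrib_right sum_distrib_left distrib_right algebra_simps)
  also have "(\<Sum>i\<in>UNIV. \<Sum>j\<in>UNIV. \<Sum>l\<in>UNIV. ?C l l i * (?h i j * pder j f x)) =
      (\<Sum>i\<in>UNIV. \<Sum>j\<in>UNIV. \<Sum>l\<in>UNIV. ?C i i l * ?h l j * pder j f x)"
  proof -
    have "(\<Sum>i\<in>UNIV. \<Sum>j\<in>UNIV. \<Sum>l\<in>UNIV. ?C l l i * (?h i j * pder j f x)) =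
        (\<Sum>l\<in>UNIV. \<Sum>i\<in>UNIV. \<Sum>j\<in>UNIV. ?C l l i * (?h i j * pder j f x))" by (rule sum_swap3)
    also have "\<dots> = (\<Sum>i\<in>UNIV. \<Sum>j\<in>UNIV. \<Sum>l\<in>UNIV. ?C i i l * ?h l j * pder j f x)"
      by (rule sum.cong[OF refl], subst sum.swap, simp add: mult.assoc)
    finally show ?thesis .
  qed
  also have "(\<Sum>i\<in>UNIV. \<Sum>j\<in>UNIV. \<Sum>l\<in>UNIV. ?C j i l * ?h i l * pder j f x) =
      (\<Sum>i\<in>UNIV. \<Sum>j\<in>UNIV. \<Sum>k\<in>UNIV. ?h i j * (?C k i j * pder k f x))"
    by (rule sum.cong[OF refl], subst sum.swap, simp add: mult_ac)
  finally show ?thesis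
    by (simp add: hessian_coeff_def sum_subtractf sum_distrib_left right_diff_distrib)
qed

lemma Ck_hessian: "Ck_on S f (Suc (Suc k)) \<Longrightarrow> Ck_on S (hessian_coeff G f i j) k"
  unfolding hessian_coeff_def
  by (intro Ck_on_diff Ck_on_sum Ck_on_mult Ck_christoffel open_S Ck_on_pder[OF Ck_on_pder]
      Ck_on_SucD[OF Ck_on_pder])

lemma hessian_sym:
  assumes x: "x \<in> S" and f: "Ck_on S f 2"
  shows "hessian_coeff G f i j x = hessian_coeff G f j i x"
  unfolding hessian_coeff_def using pder_commute[OF open_S x f, of i j] christoffel_sym[OF x, of _ i j] by simp

lemma Ck_laplace: "Ck_on S f (Suc (Suc k)) \<Longrightarrow> Ck_on S (laplace_coeff G f) k"
proof -
  assume f: "Ck_on S f (Suc (Suc k))"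
  then have "Ck_on S f 2" by (rule Ck_on_mono) simp
  then have eq: "(\<Sum>i\<in>UNIV. \<Sum>j\<in>UNIV. ginv G i j x * hessian_coeff G f i j x) = laplace_coeff G f x" if "x \<in> S" for x
    using laplace_trace[OF that] by simp
  have "Ck_on S (\<lambda>x. \<Sum>i\<in>UNIV. \<Sum>j\<in>UNIV. ginv G i j x * hessian_coeff G f i j x) k"
    by (intro Ck_on_sum Ck_on_mult Ck_ginv Ck_hessian open_S f)
  from Ck_on_cong_imp[OF open_S eq this] show ?thesis .
qed

lemma Ck_gdot: "Ck_on S f1 (Suc k) \<Longrightarrow> Ck_on S f2 (Suc k) \<Longrightarrow> Ck_on S (gdot G f1 f2) k"
  unfolding gdot_def[abs_def] by (intro Ck_on_sum Ck_on_mult Ck_ginv open_S Ck_on_pder)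

definition gradv :: "(real ^ 'n \<Rightarrow> real) \<Rightarrow> 'n \<Rightarrow> real ^ 'n \<Rightarrow> real" where
  "gradv f i x = (\<Sum>j\<in>UNIV. ginv G i j x * pder j f x)"

text \<open>Since the metric is parallel, the covariant derivative of the gradient is the Hessian
  with one index raised; the last sum is the connection term.\<close>

lemma pder_gradv:
  assumes x: "x \<in> S" and f: "Ck_on S f 2"
  shows "pder k (gradv f j) x =
    (\<Sum>l\<in>UNIV. ginv G j l x * hessian_coeff G f k l x) - (\<Sum>l\<in>UNIV. christoffel G j k l x * gradv f l x)"
proof -
  let ?h = "\<lambda>i j. ginv G i j x" and ?C = "\<lambda>k i j. christoffel G k i j x"
  have df: "pder j f differentiable (at x)" for j
    using Ck_on_differentiable[OF Ck_on_pder[of S f 1 j] _ x] f by (simp add: numeral_2_eq_2)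
  have "pder k (gradv f j) x = (\<Sum>i\<in>UNIV. - (\<Sum>l\<in>UNIV. ?C j k l * ?h l i + ?C i k l * ?h j l) * pder i f x + ?h j i * pder k (pder i f) x)"
    unfolding gradv_def[abs_def]
    by (simp add: pder_mult pder_sum df differentiable_at[OF x] differentiable_mult pder_ginv[OF x])
  also have "\<dots> = (\<Sum>i\<in>UNIV. ?h j i * pder k (pder i f) x)
      - (\<Sum>i\<in>UNIV. \<Sum>l\<in>UNIV. ?C i k l * ?h j l * pder i f x)
      - (\<Sum>i\<in>UNIV. \<Sum>l\<in>UNIV. ?C j k l * ?h l i * pder i f x)"
    by (simp add: sum.distrib sum_negf sum_subtractf sum_distrib_right sum_distrib_left distrib_right algebra_simps)
  also have "(\<Sum>i\<in>UNIV. \<Sum>l\<in>UNIV. ?C i k l * ?h j l * pder i f x) = (\<Sum>l\<in>UNIV. ?h j l * (\<Sum>i\<in>UNIV. ?C i k l * pder i f x))"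
    by (subst sum.swap) (simp add: sum_distrib_left mult_ac)
  also have "(\<Sum>i\<in>UNIV. \<Sum>l\<in>UNIV. ?C j k l * ?h l i * pder i f x) = (\<Sum>l\<in>UNIV. ?C j k l * gradv f l x)"
    by (subst sum.swap) (simp add: gradv_def sum_distrib_left mult_ac)
  finally show ?thesis
    by (simp add: hessian_coeff_def sum_subtractf right_diff_distrib)
qed

text \<open>One half of the Hessian term comes directly from \<open>pder_gradv\<close>. The
  connection term of that formula completes the plain second derivatives of \<open>f\<close> to the
  other half.\<close>

lemma pder_gdot_self:
  assumes x: "x \<in> S" and f: "Ck_on S f 2"
  shows "pder k (gdot G f f) x = 2 * (\<Sum>j\<in>UNIV. hessian_coeff G f k j x * gradv f j x)"
proof -
  let ?h = "\<lambda>i j. ginv G i j x" and ?C = "\<lambda>k i j. christoffel G k i j x"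
  have df: "pder j f differentiable (at x)" for j
    using Ck_on_differentiable[OF Ck_on_pder[of S f 1 j] _ x] f by (simp add: numeral_2_eq_2)
  have dg: "gradv f i differentiable (at x)" for i
    unfolding gradv_def[abs_def] by (simp add: differentiable_sum differentiable_mult differentiable_at[OF x] df)
  have g: "gdot G f f = (\<lambda>y. \<Sum>i\<in>UNIV. gradv f i y * pder i f y)"
    by (auto simp: gdot_def gradv_def sum_distrib_right sum_distrib_left mult_ac)
  have "pder k (gdot G f f) x = (\<Sum>i\<in>UNIV. pder k (gradv f i) x * pder i f x + gradv f i x * pder k (pder i f) x)"
    unfolding g by (simp add: pder_sum pder_mult dg df differentiable_mult)
  also have "\<dots> = (\<Sum>i\<in>UNIV. \<Sum>l\<in>UNIV. ?h i l * hessian_coeff G f k l x * pder i f x)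
      + (\<Sum>i\<in>UNIV. gradv f i x * pder k (pder i f) x) - (\<Sum>i\<in>UNIV. \<Sum>l\<in>UNIV. ?C i k l * gradv f l x * pder i f x)"
    by (simp add: pder_gradv[OF x f] left_diff_distrib sum_distrib_right sum.distrib sum_subtractf)
  also have "(\<Sum>i\<in>UNIV. \<Sum>l\<in>UNIV. ?h i l * hessian_coeff G f k l x * pder i f x) = (\<Sum>l\<in>UNIV. hessian_coeff G f k l x * gradv f l x)"
    by (subst sum.swap) (simp add: gradv_def sum_distrib_left mult_ac ginv_sym[OF x])
  also have "(\<Sum>i\<in>UNIV. \<Sum>l\<in>UNIV. ?C i k l * gradv f l x * pder i f x) = (\<Sum>l\<in>UNIV. (\<Sum>i\<in>UNIV. ?C i k l * pder i f x) * gradv f l x)"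
    by (subst sum.swap) (simp add: sum_distrib_right sum_distrib_left mult_ac)
  also have "(\<Sum>l\<in>UNIV. hessian_coeff G f k l x * gradv f l x) + (\<Sum>i\<in>UNIV. gradv f i x * pder k (pder i f) x)
      - (\<Sum>l\<in>UNIV. (\<Sum>i\<in>UNIV. ?C i k l * pder i f x) * gradv f l x) = 2 * (\<Sum>j\<in>UNIV. hessian_coeff G f k j x * gradv f j x)"
    by (simp add: hessian_coeff_def left_diff_distrib sum_subtractf algebra_simps)
  finally show ?thesis .
qed

lemma differentiable_derivs:
  assumes x: "x \<in> S" and f: "Ck_on S f 3"
  shows "pder i f differentiable (at x)" "pder i (pder j f) differentiable (at x)"
    "hessian_coeff G f i j differentiable (at x)" "gradv f i differentiable (at x)"
proof -
  have f3: "Ck_on S f (Suc (Suc (Suc 0)))" using f by (simp add: numeral_3_eq_3)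
  show 1: "pder i f differentiable (at x)" for i
    using Ck_on_differentiable[OF Ck_on_pder[OF f3] _ x] by simp
  show "pder i (pder j f) differentiable (at x)"
    using Ck_on_differentiable[OF Ck_on_pder[OF Ck_on_pder[OF f3]] _ x] by simp
  show "hessian_coeff G f i j differentiable (at x)"
    using Ck_on_differentiable[OF Ck_hessian[OF f3] _ x] by simp
  show "gradv f i differentiable (at x)"
    unfolding gradv_def[abs_def] by (simp add: differentiable_sum differentiable_mult differentiable_at[OF x] 1)
qed

section \<open>Third covariant derivatives, curvature and the Bochner formula\<close>

lemma pder_hessian:
  assumes x: "x \<in> S" and f: "Ck_on S f 3"
  shows "pder l (hessian_coeff G f i j) x = pder l (pder i (pder j f)) x -
    (\<Sum>k\<in>UNIV. pder l (christoffel G k i j) x * pder k f x + christoffel G k i j x * pder l (pder k f) x)"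
  unfolding hessian_coeff_def
  by (simp add: pder_diff pder_sum pder_mult differentiable_sum differentiable_mult
      differentiable_derivs[OF x f] differentiable_at[OF x])

text \<open>The components of \<nabla>_l \<nabla>_i \<nabla>_j f, with the index of the last
  differentiation in front.\<close>

definition cov_hessian :: "(real ^ 'n \<Rightarrow> real) \<Rightarrow> 'n \<Rightarrow> 'n \<Rightarrow> 'n \<Rightarrow> real ^ 'n \<Rightarrow> real" where
  "cov_hessian f l i j x = pder l (hessian_coeff G f i j) x -
    (\<Sum>m\<in>UNIV. christoffel G m l i x * hessian_coeff G f m j x) -
    (\<Sum>m\<in>UNIV. christoffel G m l j x * hessian_coeff G f i m x)"

text \<open>\<open>riemann m k i j\<close> is \<open>R\<^sup>m\<^sub>k\<^sub>i\<^sub>j\<close> with the sign convention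
  \<open>(\<nabla>\<^sub>i\<nabla>\<^sub>j - \<nabla>\<^sub>j\<nabla>\<^sub>i) \<omega>\<^sub>k = - R\<^sup>m\<^sub>k\<^sub>i\<^sub>j \<omega>\<^sub>m\<close>.\<close>

definition riemann :: "'n \<Rightarrow> 'n \<Rightarrow> 'n \<Rightarrow> 'n \<Rightarrow> real ^ 'n \<Rightarrow> real" where
  "riemann m k i j x = pder i (christoffel G m j k) x - pder j (christoffel G m i k) x +
    (\<Sum>l\<in>UNIV. christoffel G m i l x * christoffel G l j k x - christoffel G m j l x * christoffel G l i k x)"

lemma ricci_riemann:
  assumes x: "x \<in> S"
  shows "ricci_coeff G i j x = (\<Sum>k\<in>UNIV. riemann k i k j x)"
proof -
  have "pder k (christoffel G m i j) x = pder k (christoffel G m j i) x" for k m i j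
    by (rule pder_cong[OF open_S x]) (auto intro: differentiable_at x christoffel_sym)
  then show ?thesis
    unfolding ricci_coeff_def riemann_def by (simp add: christoffel_sym[OF x])
qed

text \<open>Third partial derivatives commute and the terms containing second derivatives cancel in
  pairs. Only derivatives and products of Christoffel symbols, applied to the differential of
  \<open>f\<close>, are left.\<close>

lemma ricci_identity:
  assumes x: "x \<in> S" and f: "Ck_on S f 3"
  shows "cov_hessian f i j k x - cov_hessian f j i k x = - (\<Sum>m\<in>UNIV. riemann m k i j x * pder m f x)"
proof -
  let ?C = "\<lambda>k i j. christoffel G k i j x" and ?u = "\<lambda>i. pder i f x" and ?uu = "\<lambda>i j. pder i (pder j f) x"
  have "Ck_on S (pder k f) 2" using f Ck_on_pder[of S f 2 k] by (simp add: numeral_3_eq_3 numeral_2_eq_2)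
  then have 3: "pder i (pder j (pder k f)) x = pder j (pder i (pder k f)) x"
    by (rule pder_commute[OF open_S x])
  have H: "hessian_coeff G f a b x = ?uu a b - (\<Sum>l\<in>UNIV. ?C l a b * ?u l)" for a b
    by (simp add: hessian_coeff_def)
  have C: "(\<Sum>m\<in>UNIV. ?C m i j * hessian_coeff G f m k x) = (\<Sum>m\<in>UNIV. ?C m j i * hessian_coeff G f m k x)"
    by (simp add: christoffel_sym[OF x, of _ i j])
  have sw: "(\<Sum>m\<in>UNIV. ?C m a k * (\<Sum>l\<in>UNIV. ?C l b m * ?u l)) = (\<Sum>l\<in>UNIV. (\<Sum>m\<in>UNIV. ?C l b m * ?C m a k) * ?u l)" for a b
    unfolding sum_distrib_left sum_distrib_right by (subst sum.swap) (simp add: mult_ac)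
  have "cov_hessian f i j k x - cov_hessian f j i k x =
     - (\<Sum>m\<in>UNIV. pder i (christoffel G m j k) x * ?u m) + (\<Sum>m\<in>UNIV. pder j (christoffel G m i k) x * ?u m)
     + (\<Sum>m\<in>UNIV. ?C m i k * (\<Sum>l\<in>UNIV. ?C l j m * ?u l)) - (\<Sum>m\<in>UNIV. ?C m j k * (\<Sum>l\<in>UNIV. ?C l i m * ?u l))"
    unfolding cov_hessian_def pder_hessian[OF x f] C 3 H[of j] H[of i]
    by (simp add: sum.distrib sum_subtractf right_diff_distrib)
  also have "\<dots> = - (\<Sum>m\<in>UNIV. riemann m k i j x * ?u m)"
    unfolding sw riemann_def by (simp add: sum.distrib sum_subtractf left_diff_distrib distrib_right)
  finally show ?thesis .
qed

text \<open>Obtained by commuting the second derivatives of the inverse metric.\<close>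

lemma riemann_antisym:
  assumes x: "x \<in> S"
  shows "(\<Sum>l\<in>UNIV. riemann p l i j x * ginv G l m x) = - (\<Sum>l\<in>UNIV. riemann m l i j x * ginv G p l x)"
proof -
  let ?C = "\<lambda>k i j. christoffel G k i j x" and ?h = "\<lambda>i j. ginv G i j x"
  let ?D = "\<lambda>i m j l. pder i (christoffel G m j l) x"
  have dd: "pder i (pder j (ginv G p m)) x =
    - (\<Sum>l\<in>UNIV. ?D i p j l * ?h l m + ?D i m j l * ?h p l)
    + (\<Sum>l\<in>UNIV. \<Sum>a\<in>UNIV. ?C p j l * ?C l i a * ?h a m) + (\<Sum>l\<in>UNIV. \<Sum>a\<in>UNIV. ?C m j l * ?C l i a * ?h p a)
    + (\<Sum>l\<in>UNIV. \<Sum>a\<in>UNIV. ?C p j l * ?C m i a * ?h l a) + (\<Sum>l\<in>UNIV. \<Sum>a\<in>UNIV. ?C p i l * ?C m j a * ?h l a)" for i j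
  proof -
    have "pder i (pder j (ginv G p m)) x = pder i (\<lambda>y. - (\<Sum>l\<in>UNIV. christoffel G p j l y * ginv G l m y + christoffel G m j l y * ginv G p l y)) x"
      using x Ck_on_differentiable[OF Ck_on_pder[OF Ck_ginv], of 1] by (intro pder_cong[OF open_S x]) (auto simp: pder_ginv)
    also have "\<dots> = - (\<Sum>l\<in>UNIV. ?D i p j l * ?h l m + ?C p j l * pder i (ginv G l m) x + (?D i m j l * ?h p l + ?C m j l * pder i (ginv G p l) x))"
      by (simp add: pder_minus pder_sum pder_add pder_mult differentiable_sum differentiable_add differentiable_mult differentiable_at[OF x])
    also have "\<dots> = - (\<Sum>l\<in>UNIV. ?D i p j l * ?h l m + ?D i m j l * ?h p l)
       + (\<Sum>l\<in>UNIV. \<Sum>a\<in>UNIV. ?C p j l * ?C l i a * ?h a m) + (\<Sum>l\<in>UNIV. \<Sum>a\<in>UNIV. ?C m j l * ?C l i a * ?h p a)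
       + (\<Sum>l\<in>UNIV. \<Sum>a\<in>UNIV. ?C p j l * ?C m i a * ?h l a) + (\<Sum>l\<in>UNIV. \<Sum>a\<in>UNIV. ?C p i a * ?C m j l * ?h a l)"
      by (simp add: pder_ginv[OF x] sum.distrib sum_distrib_left sum_negf sum_subtractf distrib_left algebra_simps)
    also have "(\<Sum>l\<in>UNIV. \<Sum>a\<in>UNIV. ?C p i a * ?C m j l * ?h a l) = (\<Sum>l\<in>UNIV. \<Sum>a\<in>UNIV. ?C p i l * ?C m j a * ?h l a)"
      by (rule sum.swap)
    finally show ?thesis .
  qed
  have sw: "(\<Sum>l\<in>UNIV. (\<Sum>a\<in>UNIV. A a * B a l) * E l) = (\<Sum>l\<in>UNIV. \<Sum>a\<in>UNIV. A l * B l a * (E a :: real))" for A E :: "'n \<Rightarrow> real" and B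
    unfolding sum_distrib_right by (rule sum.swap)
  have "pder i (pder j (ginv G p m)) x = pder j (pder i (ginv G p m)) x"
    by (rule pder_commute[OF open_S x Ck_ginv])
  then have "(\<Sum>l\<in>UNIV. ?D i p j l * ?h l m) - (\<Sum>l\<in>UNIV. ?D j p i l * ?h l m)
     + (\<Sum>l\<in>UNIV. \<Sum>a\<in>UNIV. ?C p i l * ?C l j a * ?h a m) - (\<Sum>l\<in>UNIV. \<Sum>a\<in>UNIV. ?C p j l * ?C l i a * ?h a m)
     = - ((\<Sum>l\<in>UNIV. ?D i m j l * ?h p l) - (\<Sum>l\<in>UNIV. ?D j m i l * ?h p l)
     + (\<Sum>l\<in>UNIV. \<Sum>a\<in>UNIV. ?C m i l * ?C l j a * ?h p a) - (\<Sum>l\<in>UNIV. \<Sum>a\<in>UNIV. ?C m j l * ?C l i a * ?h p a))"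
    unfolding dd[of i j] dd[of j i] by (simp add: sum.distrib)
  then show ?thesis
    unfolding riemann_def by (simp add: sum.distrib sum_subtractf left_diff_distrib distrib_right sw)
qed

text \<open>The formula of \<open>pder_gdot_self\<close> is differentiated once more. The derivative
  falls either on the Hessian or on the gradient, and the Christoffel terms assemble into the
  covariant derivative of the Hessian.\<close>

lemma hessian_gdot_self:
  assumes x: "x \<in> S" and f: "Ck_on S f 3"
  shows "hessian_coeff G (gdot G f f) i k x = 2 * (\<Sum>j\<in>UNIV. gradv f j x * cov_hessian f i k j x)
    + 2 * (\<Sum>j\<in>UNIV. \<Sum>l\<in>UNIV. ginv G j l x * hessian_coeff G f k j x * hessian_coeff G f i l x)"
proof -
  let ?C = "\<lambda>k i j. christoffel G k i j x" and ?H = "\<lambda>i j. hessian_coeff G f i j x" and ?v = "\<lambda>j. gradv f j x"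
  have f2: "Ck_on S f 2" using f by (rule Ck_on_mono) simp
  have w: "Ck_on S (gdot G f f) 2" using Ck_gdot[of f 2 f] f by (simp add: numeral_3_eq_3 numeral_2_eq_2)
  have "pder i (pder k (gdot G f f)) x = pder i (\<lambda>y. 2 * (\<Sum>j\<in>UNIV. hessian_coeff G f k j y * gradv f j y)) x"
    using x w Ck_on_differentiable[OF Ck_on_pder, of S "gdot G f f" 1 x k]
    by (intro pder_cong[OF open_S x]) (auto simp: pder_gdot_self[OF _ f2] numeral_2_eq_2)
  also have "\<dots> = 2 * (\<Sum>j\<in>UNIV. pder i (hessian_coeff G f k j) x * ?v j + ?H k j * pder i (gradv f j) x)"
    by (simp add: pder_cmult pder_sum pder_mult differentiable_sum differentiable_mult differentiable_derivs[OF x f])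
  also have "\<dots> = 2 * ((\<Sum>j\<in>UNIV. pder i (hessian_coeff G f k j) x * ?v j) +
     (\<Sum>j\<in>UNIV. \<Sum>l\<in>UNIV. ginv G j l x * ?H k j * ?H i l) - (\<Sum>j\<in>UNIV. \<Sum>l\<in>UNIV. ?C j i l * ?H k j * ?v l))"
    by (simp add: pder_gradv[OF x f2] sum.distrib sum_subtractf right_diff_distrib sum_distrib_left mult_ac)
  also have "(\<Sum>j\<in>UNIV. \<Sum>l\<in>UNIV. ?C j i l * ?H k j * ?v l) = (\<Sum>l\<in>UNIV. ?v l * (\<Sum>j\<in>UNIV. ?C j i l * ?H k j))"
    by (subst sum.swap) (simp add: sum_distrib_left mult_ac)
  finally have 1: "pder i (pder k (gdot G f f)) x = 2 * ((\<Sum>j\<in>UNIV. pder i (hessian_coeff G f k j) x * ?v j) +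
     (\<Sum>j\<in>UNIV. \<Sum>l\<in>UNIV. ginv G j l x * ?H k j * ?H i l) - (\<Sum>l\<in>UNIV. ?v l * (\<Sum>j\<in>UNIV. ?C j i l * ?H k j)))" .
  have 2: "(\<Sum>l\<in>UNIV. ?C l i k * pder l (gdot G f f) x) = 2 * (\<Sum>j\<in>UNIV. ?v j * (\<Sum>l\<in>UNIV. ?C l i k * ?H l j))"
    unfolding pder_gdot_self[OF x f2] sum_distrib_left by (subst sum.swap) (simp add: mult_ac)
  show ?thesis
    unfolding hessian_coeff_def[of G "gdot G f f"] 1 2 cov_hessian_def
    by (simp add: right_diff_distrib sum_subtractf mult.commute[of "gradv f _ x"])
qed

text \<open>Taking the trace commutes with covariant differentiation because the inverse metric is
  parallel.\<close>

lemma pder_laplace: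
  assumes x: "x \<in> S" and f: "Ck_on S f 3"
  shows "pder j (laplace_coeff G f) x = (\<Sum>i\<in>UNIV. \<Sum>k\<in>UNIV. ginv G i k x * cov_hessian f j i k x)"
proof -
  let ?C = "\<lambda>k i j. christoffel G k i j x" and ?H = "\<lambda>i j. hessian_coeff G f i j x" and ?h = "\<lambda>i j. ginv G i j x"
  have f2: "Ck_on S f 2" using f by (rule Ck_on_mono) simp
  have "laplace_coeff G f differentiable (at x)"
    using Ck_on_differentiable[OF Ck_laplace[of f 1] _ x] f by (simp add: numeral_3_eq_3)
  then have "pder j (laplace_coeff G f) x = pder j (\<lambda>y. \<Sum>i\<in>UNIV. \<Sum>k\<in>UNIV. ginv G i k y * hessian_coeff G f i k y) x"
    by (intro pder_cong[OF open_S x]) (auto simp: laplace_trace f2)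
  also have "\<dots> = (\<Sum>i\<in>UNIV. \<Sum>k\<in>UNIV. pder j (ginv G i k) x * ?H i k + ?h i k * pder j (hessian_coeff G f i k) x)"
    by (simp add: pder_sum pder_mult differentiable_sum differentiable_mult differentiable_derivs[OF x f] differentiable_at[OF x])
  also have "\<dots> = (\<Sum>i\<in>UNIV. \<Sum>k\<in>UNIV. ?h i k * pder j (hessian_coeff G f i k) x)
     - (\<Sum>i\<in>UNIV. \<Sum>k\<in>UNIV. \<Sum>l\<in>UNIV. ?C i j l * ?h l k * ?H i k) - (\<Sum>i\<in>UNIV. \<Sum>k\<in>UNIV. \<Sum>l\<in>UNIV. ?C k j l * ?h i l * ?H i k)"
    by (simp add: pder_ginv[OF x] sum.distrib sum_subtractf sum_negf left_diff_distrib distrib_right sum_distrib_right)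
  also have "(\<Sum>i\<in>UNIV. \<Sum>k\<in>UNIV. \<Sum>l\<in>UNIV. ?C i j l * ?h l k * ?H i k) = (\<Sum>l\<in>UNIV. \<Sum>k\<in>UNIV. ?h l k * (\<Sum>i\<in>UNIV. ?C i j l * ?H i k))"
  proof -
    have "(\<Sum>i\<in>UNIV. \<Sum>k\<in>UNIV. \<Sum>l\<in>UNIV. ?C i j l * ?h l k * ?H i k) = (\<Sum>l\<in>UNIV. \<Sum>i\<in>UNIV. \<Sum>k\<in>UNIV. ?C i j l * ?h l k * ?H i k)"
      by (rule sum_swap3)
    also have "\<dots> = (\<Sum>l\<in>UNIV. \<Sum>k\<in>UNIV. ?h l k * (\<Sum>i\<in>UNIV. ?C i j l * ?H i k))"
      by (rule sum.cong[OF refl], subst sum.swap) (simp add: sum_distrib_left mult_ac)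
    finally show ?thesis .
  qed
  also have "(\<Sum>i\<in>UNIV. \<Sum>k\<in>UNIV. \<Sum>l\<in>UNIV. ?C k j l * ?h i l * ?H i k) = (\<Sum>i\<in>UNIV. \<Sum>l\<in>UNIV. ?h i l * (\<Sum>k\<in>UNIV. ?C k j l * ?H i k))"
    by (rule sum.cong[OF refl], subst sum.swap) (simp add: sum_distrib_left mult_ac)
  finally show ?thesis
    by (simp add: cov_hessian_def right_diff_distrib sum_subtractf)
qed

text \<open>The norm is defined by a square root, so squaring it requires a nonnegative radicand. It
  is nonnegative as the trace of a product of two positive semidefinite matrices: the inverse metric
  and the matrix \<open>N\<close>, the Hessian composed with itself through the inverse
  metric.\<close>

lemma hessian_norm_sq:
  assumes x: "x \<in> S" and f: "Ck_on S f 2"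
  shows "(hessian_norm_coeff G f x)\<^sup>2 = (\<Sum>i\<in>UNIV. \<Sum>k\<in>UNIV. ginv G i k x *
    (\<Sum>j\<in>UNIV. \<Sum>l\<in>UNIV. ginv G j l x * hessian_coeff G f k j x * hessian_coeff G f i l x))"
proof -
  let ?h = "\<lambda>i j. ginv G i j x" and ?H = "\<lambda>i j. hessian_coeff G f i j x"
  define N where "N i k = (\<Sum>j\<in>UNIV. \<Sum>l\<in>UNIV. ?h j l * ?H k j * ?H i l)" for i k
  have psd: "pos_semidef_on UNIV N"
    unfolding pos_semidef_on_def
  proof
    fix c :: "'n \<Rightarrow> real"
    have "(\<Sum>i\<in>UNIV. \<Sum>k\<in>UNIV. N i k * c i * c k) =
        (\<Sum>i\<in>UNIV. \<Sum>k\<in>UNIV. \<Sum>j\<in>UNIV. \<Sum>l\<in>UNIV. ?h j l * (?H k j * c k) * (?H i l * c i))"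
      by (simp add: N_def sum_distrib_right sum_distrib_left mult_ac)
    also have "\<dots> = (\<Sum>j\<in>UNIV. \<Sum>i\<in>UNIV. \<Sum>k\<in>UNIV. \<Sum>l\<in>UNIV. ?h j l * (?H k j * c k) * (?H i l * c i))"
      by (rule sum_swap3)
    also have "\<dots> = (\<Sum>j\<in>UNIV. \<Sum>l\<in>UNIV. \<Sum>i\<in>UNIV. \<Sum>k\<in>UNIV. ?h j l * (?H k j * c k) * (?H i l * c i))"
      by (rule sum.cong[OF refl], rule sum_swap3)
    also have "\<dots> = (\<Sum>j\<in>UNIV. \<Sum>l\<in>UNIV. ?h j l * (\<Sum>k\<in>UNIV. ?H k j * c k) * (\<Sum>i\<in>UNIV. ?H i l * c i))"
      by (simp add: sum_distrib_left sum_distrib_right mult.assoc)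
    also have "\<dots> \<ge> 0"
      using pos_semidef_ginv[OF x] unfolding pos_semidef_on_def by (rule allE)
    finally show "0 \<le> (\<Sum>i\<in>UNIV. \<Sum>k\<in>UNIV. N i k * c i * c k)" .
  qed
  have "0 \<le> (\<Sum>i\<in>UNIV. \<Sum>k\<in>UNIV. ?h i k * N i k)"
    by (rule pos_semidef_sum_mult_nonneg[OF _ pos_semidef_ginv[OF x] psd ginv_sym[OF x]]) simp
  moreover have "(\<Sum>i\<in>UNIV. \<Sum>j\<in>UNIV. \<Sum>k\<in>UNIV. \<Sum>l\<in>UNIV. ?h i k * ?h j l * ?H i j * ?H k l) = (\<Sum>i\<in>UNIV. \<Sum>k\<in>UNIV. ?h i k * N i k)"
  proof -
    have "(\<Sum>i\<in>UNIV. \<Sum>j\<in>UNIV. \<Sum>k\<in>UNIV. \<Sum>l\<in>UNIV. ?h i k * ?h j l * ?H i j * ?H k l) =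
       (\<Sum>i\<in>UNIV. \<Sum>k\<in>UNIV. \<Sum>j\<in>UNIV. \<Sum>l\<in>UNIV. ?h i k * ?h j l * ?H i j * ?H k l)"
      by (rule sum.cong[OF refl], rule sum.swap)
    also have "\<dots> = (\<Sum>i\<in>UNIV. \<Sum>k\<in>UNIV. \<Sum>l\<in>UNIV. \<Sum>j\<in>UNIV. ?h i k * ?h j l * ?H i j * ?H k l)"
      by (rule sum.cong[OF refl], rule sum.cong[OF refl], rule sum.swap)
    also have "\<dots> = (\<Sum>i\<in>UNIV. \<Sum>k\<in>UNIV. ?h i k * N i k)"
      unfolding N_def sum_distrib_left
      by (intro sum.cong[OF refl]) (simp add: ginv_sym[OF x] mult_ac)
    finally show ?thesis .
  qed
  ultimately show ?thesis
    unfolding hessian_norm_coeff_def ginv_def[symmetric] N_def by simp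
qed

text \<open>Tracing \<open>hessian_gdot_self\<close> produces the squared Hessian and a third-order
  term. Exchanging derivatives in the latter gives the gradient of the Laplacian and a contraction
  of the curvature, which is the Ricci term.\<close>

theorem bochner:
  assumes x: "x \<in> S" and f: "Ck_on S f 3"
  shows "1 / 2 * laplace_coeff G (gdot G f f) x = (hessian_norm_coeff G f x)\<^sup>2
    + (\<Sum>i\<in>UNIV. \<Sum>j\<in>UNIV. ricci_coeff G i j x * gradv f i x * gradv f j x) + gdot G f (laplace_coeff G f) x"
proof -
  let ?h = "\<lambda>i j. ginv G i j x" and ?v = "\<lambda>j. gradv f j x" and ?T = "\<lambda>l i j. cov_hessian f l i j x"
  have f2: "Ck_on S f 2" using f by (rule Ck_on_mono) simp
  have w: "Ck_on S (gdot G f f) 2" using Ck_gdot[of f 2 f] f by (simp add: numeral_3_eq_3 numeral_2_eq_2)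
  have symH: "hessian_coeff G f i j y = hessian_coeff G f j i y" if "y \<in> S" for i j y
    by (rule hessian_sym[OF that f2])
  have symdH: "pder l (hessian_coeff G f i j) x = pder l (hessian_coeff G f j i) x" for l i j
    by (rule pder_cong[OF open_S x differentiable_derivs(3)[OF x f] symH])
  have symT: "?T l i j = ?T l j i" for l i j
    unfolding cov_hessian_def symdH[of l i j] symH[OF x, of _ j] symH[OF x, of i] by simp
  have "1 / 2 * laplace_coeff G (gdot G f f) x = (\<Sum>i\<in>UNIV. \<Sum>k\<in>UNIV. ?h i k * (\<Sum>j\<in>UNIV. ?v j * ?T i k j)) + (hessian_norm_coeff G f x)\<^sup>2"
    unfolding laplace_trace[OF x w] hessian_gdot_self[OF x f] hessian_norm_sq[OF x f2]
    by (simp add: distrib_left sum.distrib sum_distrib_left mult_ac)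
  moreover have "(\<Sum>i\<in>UNIV. \<Sum>k\<in>UNIV. ?h i k * (\<Sum>j\<in>UNIV. ?v j * ?T i k j)) =
     (\<Sum>i\<in>UNIV. \<Sum>k\<in>UNIV. ?h i k * (\<Sum>j\<in>UNIV. ?v j * ?T j i k))
     - (\<Sum>i\<in>UNIV. \<Sum>k\<in>UNIV. ?h i k * (\<Sum>j\<in>UNIV. ?v j * (\<Sum>m\<in>UNIV. riemann m k i j x * pder m f x)))"
  proof -
    \<comment> \<open>Symmetry of the Hessian first puts \<open>j\<close> next to \<open>i\<close>,
      where \<open>ricci_identity\<close> can exchange them.\<close>
    have "?T i k j = ?T j i k - (\<Sum>m\<in>UNIV. riemann m k i j x * pder m f x)" for i j k
      using ricci_identity[OF x f, of i j k] symT[of i k j] by simp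
    then have "(\<Sum>j\<in>UNIV. ?v j * ?T i k j) =
        (\<Sum>j\<in>UNIV. ?v j * (?T j i k - (\<Sum>m\<in>UNIV. riemann m k i j x * pder m f x)))" for i k
      by (intro sum.cong[OF refl] arg_cong2[of _ _ _ _ "(*)"] refl)
    then have "(\<Sum>i\<in>UNIV. \<Sum>k\<in>UNIV. ?h i k * (\<Sum>j\<in>UNIV. ?v j * ?T i k j)) =
        (\<Sum>i\<in>UNIV. \<Sum>k\<in>UNIV. ?h i k * (\<Sum>j\<in>UNIV. ?v j * (?T j i k - (\<Sum>m\<in>UNIV. riemann m k i j x * pder m f x))))"
      by (simp only:)
    then show ?thesis by (simp add: right_diff_distrib sum_subtractf)
  qed
  moreover have "(\<Sum>i\<in>UNIV. \<Sum>k\<in>UNIV. ?h i k * (\<Sum>j\<in>UNIV. ?v j * ?T j i k)) = gdot G f (laplace_coeff G f) x"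
  proof -
    have "gdot G f (laplace_coeff G f) x = (\<Sum>j\<in>UNIV. ?v j * pder j (laplace_coeff G f) x)"
      unfolding gdot_def gradv_def sum_distrib_right by (subst sum.swap) (simp add: ginv_sym[OF x])
    also have "\<dots> = (\<Sum>j\<in>UNIV. \<Sum>i\<in>UNIV. \<Sum>k\<in>UNIV. ?h i k * (?v j * ?T j i k))"
      by (simp add: pder_laplace[OF x f] sum_distrib_left mult_ac)
    also have "\<dots> = (\<Sum>i\<in>UNIV. \<Sum>k\<in>UNIV. ?h i k * (\<Sum>j\<in>UNIV. ?v j * ?T j i k))"
      unfolding sum_distrib_left by (rule sum_swap3[symmetric])
    finally show ?thesis ..
  qed
  moreover have "- (\<Sum>i\<in>UNIV. \<Sum>k\<in>UNIV. ?h i k * (\<Sum>j\<in>UNIV. ?v j * (\<Sum>m\<in>UNIV. riemann m k i j x * pder m f x))) =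
      (\<Sum>k\<in>UNIV. \<Sum>j\<in>UNIV. ricci_coeff G k j x * ?v k * ?v j)"
  proof -
    have "(\<Sum>k\<in>UNIV. ?h i k * (\<Sum>j\<in>UNIV. ?v j * (\<Sum>m\<in>UNIV. riemann m k i j x * pder m f x))) =
      - (\<Sum>k\<in>UNIV. \<Sum>j\<in>UNIV. riemann i k i j x * ?v k * ?v j)" for i
    proof -
      have "(\<Sum>k\<in>UNIV. ?h i k * (\<Sum>j\<in>UNIV. ?v j * (\<Sum>m\<in>UNIV. riemann m k i j x * pder m f x))) =
         (\<Sum>k\<in>UNIV. \<Sum>j\<in>UNIV. \<Sum>m\<in>UNIV. ?v j * pder m f x * (riemann m k i j x * ?h i k))"
        by (simp add: sum_distrib_left mult_ac)
      also have "\<dots> = (\<Sum>j\<in>UNIV. \<Sum>m\<in>UNIV. \<Sum>k\<in>UNIV. ?v j * pder m f x * (riemann m k i j x * ?h i k))"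
        by (rule sum_swap3[symmetric])
      \<comment> \<open>Antisymmetry of the curvature brings \<open>i\<close> into the upper
        position at the cost of a sign; the later sum over \<open>i\<close> is then a Ricci
        contraction.\<close>
      also have "\<dots> = (\<Sum>j\<in>UNIV. \<Sum>m\<in>UNIV. ?v j * pder m f x * (- (\<Sum>l\<in>UNIV. riemann i l i j x * ?h l m)))"
        unfolding riemann_antisym[OF x] by (simp add: sum_distrib_left)
      also have "\<dots> = - (\<Sum>j\<in>UNIV. \<Sum>m\<in>UNIV. \<Sum>l\<in>UNIV. riemann i l i j x * (?h l m * pder m f x) * ?v j)"
        by (simp add: sum_distrib_left sum_negf mult_ac)
      also have "(\<Sum>j\<in>UNIV. \<Sum>m\<in>UNIV. \<Sum>l\<in>UNIV. riemann i l i j x * (?h l m * pder m f x) * ?v j) =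
          (\<Sum>l\<in>UNIV. \<Sum>j\<in>UNIV. \<Sum>m\<in>UNIV. riemann i l i j x * (?h l m * pder m f x) * ?v j)"
        by (rule sum_swap3)
      finally show ?thesis by (simp add: gradv_def[of f _ x] sum_distrib_left sum_distrib_right mult_ac)
    qed
    then have "- (\<Sum>i\<in>UNIV. \<Sum>k\<in>UNIV. ?h i k * (\<Sum>j\<in>UNIV. ?v j * (\<Sum>m\<in>UNIV. riemann m k i j x * pder m f x))) =
      (\<Sum>i\<in>UNIV. \<Sum>k\<in>UNIV. \<Sum>j\<in>UNIV. riemann i k i j x * ?v k * ?v j)" by (simp add: sum_negf)
    also have "\<dots> = (\<Sum>k\<in>UNIV. \<Sum>j\<in>UNIV. \<Sum>i\<in>UNIV. riemann i k i j x * ?v k * ?v j)"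
      by (rule sum_swap3[symmetric])
    also have "\<dots> = (\<Sum>k\<in>UNIV. \<Sum>j\<in>UNIV. ricci_coeff G k j x * ?v k * ?v j)"
      by (simp add: ricci_riemann[OF x] sum_distrib_right)
    finally show ?thesis .
  qed
  ultimately show ?thesis by linarith
qed

end

section \<open>Coordinate changes and functions on the manifold\<close>

lemma Ck_fun_mult:
  assumes "smooth_manifold A" "Ck_fun A k f1" "Ck_fun A k f2"
  shows "Ck_fun A k (\<lambda>p. f1 p * f2 p)"
  unfolding Ck_fun_def o_def
  by (intro ballI Ck_on_mult smooth_manifold.open_img[OF assms(1)])
    (use assms in \<open>simp_all add: Ck_fun_def o_def\<close>)

lemma Ck_fun_diff:
  assumes "smooth_manifold A" "Ck_fun A k f1" "Ck_fun A k f2"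
  shows "Ck_fun A k (\<lambda>p. f1 p - f2 p)"
  unfolding Ck_fun_def o_def
  by (intro ballI Ck_on_diff smooth_manifold.open_img[OF assms(1)])
    (use assms in \<open>simp_all add: Ck_fun_def o_def\<close>)

lemma Ck_fun_divide:
  assumes "smooth_manifold A" "Ck_fun A k f1" "Ck_fun A k f2" "\<And>p. f2 p \<noteq> 0"
  shows "Ck_fun A k (\<lambda>p. f1 p / f2 p)"
  unfolding Ck_fun_def o_def
  by (intro ballI Ck_on_divide smooth_manifold.open_img[OF assms(1)])
    (use assms in \<open>simp_all add: Ck_fun_def o_def\<close>)

lemma Ck_fun_const: "Ck_fun A k (\<lambda>p. c)"
  by (simp add: Ck_fun_def o_def Ck_on_const)

lemma Ck_fun_mono: "Ck_fun A k f \<Longrightarrow> j \<le> k \<Longrightarrow> Ck_fun A j f"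
  unfolding Ck_fun_def using Ck_on_mono by blast

definition mdot :: "('a, 'n::finite) chart set \<Rightarrow> ('a, 'n) metric \<Rightarrow> ('a \<Rightarrow> real) \<Rightarrow> ('a \<Rightarrow> real) \<Rightarrow> 'a \<Rightarrow> real" where
  "mdot A g f1 f2 p = (let c = chart_at A p in gdot (g c) (f1 \<circ> inv_chart c) (f2 \<circ> inv_chart c) (map_chart c p))"

section \<open>Charts and transition maps\<close>

context smooth_manifold
begin

lemma inv_map_chart: "c \<in> A \<Longrightarrow> p \<in> dom_chart c \<Longrightarrow> inv_chart c (map_chart c p) = p"
  using chart_homeomorphism unfolding homeomorphism_def by blast

lemma map_inv_chart: "c \<in> A \<Longrightarrow> x \<in> img_chart c \<Longrightarrow> map_chart c (inv_chart c x) = x"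
  using chart_homeomorphism unfolding homeomorphism_def by blast

lemma inv_chart_in: "c \<in> A \<Longrightarrow> x \<in> img_chart c \<Longrightarrow> inv_chart c x \<in> dom_chart c"
  by (meson inv_into_into)

lemma continuous_map_chart: "c \<in> A \<Longrightarrow> continuous_on (dom_chart c) (map_chart c)"
  using chart_homeomorphism unfolding homeomorphism_def by blast

lemma continuous_inv_chart: "c \<in> A \<Longrightarrow> continuous_on (img_chart c) (inv_chart c)"
  using chart_homeomorphism unfolding homeomorphism_def by blast

lemma chart_at: "chart_at A p \<in> A" "p \<in> dom_chart (chart_at A p)"
proof -
  have "\<exists>c. c \<in> A \<and> p \<in> dom_chart c"
    using charts_cover by (metis UNIV_I UN_iff)
  from someI_ex[OF this] show "chart_at A p \<in> A" "p \<in> dom_chart (chart_at A p)"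
    unfolding chart_at_def by auto
qed

lemma image_map_chart: "c \<in> A \<Longrightarrow> W \<subseteq> dom_chart c \<Longrightarrow> map_chart c ` W = {x \<in> img_chart c. inv_chart c x \<in> W}"
  using inv_map_chart map_inv_chart by (auto simp: image_iff)

lemma open_image_chart: "c \<in> A \<Longrightarrow> open W \<Longrightarrow> open (map_chart c ` (dom_chart c \<inter> W))"
proof -
  assume c: "c \<in> A" and W: "open W"
  have "map_chart c ` (dom_chart c \<inter> W) = img_chart c \<inter> inv_chart c -` W"
    using image_map_chart[OF c, of "dom_chart c \<inter> W"] inv_chart_in[OF c] by auto
  then show ?thesis
    using continuous_on_open_vimage[OF open_img[OF c]] continuous_inv_chart[OF c] W by (metis Int_commute)
qed

lemma open_inv_image_chart: "c \<in> A \<Longrightarrow> open T \<Longrightarrow> T \<subseteq> img_chart c \<Longrightarrow> open (inv_chart c ` T)"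
proof -
  assume c: "c \<in> A" and T: "open T" "T \<subseteq> img_chart c"
  have "inv_chart c ` T = map_chart c -` T \<inter> dom_chart c"
  proof (intro set_eqI iffI)
    fix p assume "p \<in> map_chart c -` T \<inter> dom_chart c"
    then show "p \<in> inv_chart c ` T" using inv_map_chart[OF c, of p] by (intro image_eqI[of _ _ "map_chart c p"]) auto
  qed (use T map_inv_chart[OF c] inv_chart_in[OF c] in auto)
  then show ?thesis
    using continuous_on_open_vimage[OF open_dom[OF c]] continuous_map_chart[OF c] T(1) by metis
qed

lemma continuous_onI_charts:
  assumes "\<And>c. c \<in> A \<Longrightarrow> continuous_on (img_chart c) (f \<circ> inv_chart c)"
  shows "continuous_on UNIV f"
proof -
  have "continuous (at p) f" for p
  proof -
    let ?c = "chart_at A p"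
    have "continuous_on (dom_chart ?c) ((f \<circ> inv_chart ?c) \<circ> map_chart ?c)"
      by (rule continuous_on_compose[OF continuous_map_chart[OF chart_at(1)] assms[OF chart_at(1)]])
    then have "continuous_on (dom_chart ?c) f"
      by (rule continuous_on_eq) (simp add: inv_map_chart[OF chart_at(1)])
    then show ?thesis
      using continuous_on_eq_continuous_at[OF open_dom[OF chart_at(1)]] chart_at(2) by blast
  qed
  then show ?thesis by (simp add: continuous_at_imp_continuous_on)
qed

lemma Ck_fun_continuous: "Ck_fun A k f \<Longrightarrow> continuous_on UNIV f"
  by (rule continuous_onI_charts) (metis Ck_fun_def Ck_on_continuous_on)

lemma transition_eq:
  assumes "c \<in> A" "d \<in> A" "p \<in> dom_chart c \<inter> dom_chart d"
  shows "(map_chart d \<circ> inv_chart c) (map_chart c p) = map_chart d p"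
  using assms inv_map_chart by simp

lemma transition_differentiable:
  assumes "c \<in> A" "d \<in> A" "p \<in> dom_chart c \<inter> dom_chart d"
  shows "(map_chart d \<circ> inv_chart c) differentiable (at (map_chart c p))"
  by (rule Ck_on_differentiable[of "map_chart c ` (dom_chart c \<inter> dom_chart d)" _ 1])
    (use smooth_transition[OF assms(1,2)] assms(3) in \<open>unfold smooth_on_def, blast+\<close>)

lemma rep_eq_comp:
  assumes "c \<in> A" "d \<in> A" "x \<in> map_chart c ` (dom_chart c \<inter> dom_chart d)"
  shows "(f \<circ> inv_chart c) x = ((f \<circ> inv_chart d) \<circ> (map_chart d \<circ> inv_chart c)) x"
  using assms inv_map_chart by auto

lemma pder_transition:
  assumes c: "c \<in> A" and d: "d \<in> A" and p: "p \<in> dom_chart c \<inter> dom_chart d"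
    and f: "(f \<circ> inv_chart d) differentiable (at (map_chart d p))"
  shows "pder i (f \<circ> inv_chart c) (map_chart c p) = (\<Sum>k\<in>UNIV.
    matrix (frechet_derivative (map_chart d \<circ> inv_chart c) (at (map_chart c p))) $ k $ i *
    pder k (f \<circ> inv_chart d) (map_chart d p))"
proof -
  let ?\<tau> = "map_chart d \<circ> inv_chart c" and ?O = "map_chart c ` (dom_chart c \<inter> dom_chart d)"
  have O: "open ?O" "map_chart c p \<in> ?O"
    using open_image_chart[OF c open_dom[OF d]] p by auto
  have d\<tau>: "?\<tau> differentiable (at (map_chart c p))" by (rule transition_differentiable[OF c d p])
  have f': "(f \<circ> inv_chart d) differentiable (at (?\<tau> (map_chart c p)))"
    using f transition_eq[OF c d p] by simp
  have "pder i (f \<circ> inv_chart c) (map_chart c p) = pder i ((f \<circ> inv_chart d) \<circ> ?\<tau>) (map_chart c p)"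
    by (rule pder_cong[OF O differentiable_chain_at[OF d\<tau> f'], symmetric])
      (rule rep_eq_comp[OF c d, symmetric])
  then show ?thesis
    unfolding pder_comp[OF d\<tau> f'] transition_eq[OF c d p] .
qed

end

section \<open>Transformation of the metric and of products of gradients\<close>

context riemannian_manifold
begin

lemma local_metric_chart: "c \<in> A \<Longrightarrow> local_metric (img_chart c) (g c)"
  by unfold_locales (auto simp: open_img metric_smooth intro: metric_symmetric metric_pos_def)

lemma metric_change:
  assumes c: "c \<in> A" and d: "d \<in> A" and p: "p \<in> dom_chart c \<inter> dom_chart d"
  defines "J \<equiv> matrix (frechet_derivative (map_chart d \<circ> inv_chart c) (at (map_chart c p)))"
  shows "gdens (g c) (map_chart c p) = \<bar>det J\<bar> * gdens (g d) (map_chart d p)"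
    "ginv (g d) k l (map_chart d p) = (\<Sum>i\<in>UNIV. \<Sum>j\<in>UNIV. J $ k $ i * ginv (g c) i j (map_chart c p) * J $ l $ j)"
proof -
  have eq: "g c (map_chart c p) = transpose J ** g d (map_chart d p) ** J"
    using metric_transform[OF c d p] by (simp add: J_def Let_def)
  interpret C: local_metric "img_chart c" "g c" by (rule local_metric_chart[OF c])
  have pc: "map_chart c p \<in> img_chart c" using p by auto
  show "gdens (g c) (map_chart c p) = \<bar>det J\<bar> * gdens (g d) (map_chart d p)"
  proof -
    have "det (g c (map_chart c p)) = (det J)\<^sup>2 * det (g d (map_chart d p))"
      unfolding eq by (simp add: det_mul power2_eq_square)
    then show ?thesis unfolding gdens_def by (simp add: real_sqrt_mult)
  qed
  let ?h = "matrix_inv (g c (map_chart c p))"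
  \<comment> \<open>A right inverse of a square matrix is also a left inverse. This moves the
    transpose of \<open>J\<close> to the other end of the product, so no inverse of \<open>J\<close>
    has to be formed.\<close>
  have "transpose J ** (g d (map_chart d p) ** J ** ?h) = mat 1"
    using matrix_inv_works(1)[OF C.invertible_G[OF pc]] unfolding eq by (simp add: matrix_mul_assoc)
  then have "(g d (map_chart d p) ** J ** ?h) ** transpose J = mat 1"
    using matrix_left_right_inverse by blast
  then have "matrix_inv (g d (map_chart d p)) = J ** ?h ** transpose J"
    by (intro matrix_inv_unique) (simp add: matrix_mul_assoc)
  then show "ginv (g d) k l (map_chart d p) = (\<Sum>i\<in>UNIV. \<Sum>j\<in>UNIV. J $ k $ i * ginv (g c) i j (map_chart c p) * J $ l $ j)"
    unfolding ginv_def by (simp add: matrix_matrix_mult_def transpose_def sum_distrib_right) (rule sum.swap)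
qed

lemma Ck_fun_differentiable:
  "Ck_fun A k f \<Longrightarrow> 1 \<le> k \<Longrightarrow> c \<in> A \<Longrightarrow> p \<in> dom_chart c \<Longrightarrow> (f \<circ> inv_chart c) differentiable (at (map_chart c p))"
  unfolding Ck_fun_def by (rule Ck_on_differentiable[of "img_chart c" _ k]) auto

lemma gdot_change:
  assumes c: "c \<in> A" and d: "d \<in> A" and p: "p \<in> dom_chart c \<inter> dom_chart d"
    and f: "Ck_fun A 1 f1" "Ck_fun A 1 f2"
  shows "gdot (g c) (f1 \<circ> inv_chart c) (f2 \<circ> inv_chart c) (map_chart c p) =
    gdot (g d) (f1 \<circ> inv_chart d) (f2 \<circ> inv_chart d) (map_chart d p)"
proof -
  define J where "J = matrix (frechet_derivative (map_chart d \<circ> inv_chart c) (at (map_chart c p)))"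
  let ?a = "\<lambda>k. pder k (f1 \<circ> inv_chart d) (map_chart d p)" and ?b = "\<lambda>k. pder k (f2 \<circ> inv_chart d) (map_chart d p)"
  let ?h = "\<lambda>i j. ginv (g c) i j (map_chart c p)"
  have pd: "pder i (f1 \<circ> inv_chart c) (map_chart c p) = (\<Sum>k\<in>UNIV. J $ k $ i * ?a k)"
    "pder i (f2 \<circ> inv_chart c) (map_chart c p) = (\<Sum>k\<in>UNIV. J $ k $ i * ?b k)" for i
    unfolding J_def using p by (auto intro!: pder_transition[OF c d p] Ck_fun_differentiable[OF f(1) _ d] Ck_fun_differentiable[OF f(2) _ d])
  have "gdot (g c) (f1 \<circ> inv_chart c) (f2 \<circ> inv_chart c) (map_chart c p) =
      (\<Sum>i\<in>UNIV. \<Sum>j\<in>UNIV. \<Sum>k\<in>UNIV. \<Sum>l\<in>UNIV. J $ k $ i * ?h i j * J $ l $ j * ?a k * ?b l)"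
    unfolding gdot_def pd by (simp add: sum_distrib_left sum_distrib_right mult_ac)
  also have "\<dots> = (\<Sum>k\<in>UNIV. \<Sum>i\<in>UNIV. \<Sum>j\<in>UNIV. \<Sum>l\<in>UNIV. J $ k $ i * ?h i j * J $ l $ j * ?a k * ?b l)"
    by (rule sum_swap3)
  also have "\<dots> = (\<Sum>k\<in>UNIV. \<Sum>l\<in>UNIV. \<Sum>i\<in>UNIV. \<Sum>j\<in>UNIV. J $ k $ i * ?h i j * J $ l $ j * ?a k * ?b l)"
    by (rule sum.cong[OF refl], rule sum_swap3)
  also have "\<dots> = gdot (g d) (f1 \<circ> inv_chart d) (f2 \<circ> inv_chart d) (map_chart d p)"
    unfolding gdot_def metric_change(2)[OF c d p] J_def[symmetric]
    by (simp add: sum_distrib_left sum_distrib_right mult_ac)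
  finally show ?thesis .
qed

lemma mdot_eq:
  assumes "Ck_fun A 1 f1" "Ck_fun A 1 f2" "c \<in> A" "p \<in> dom_chart c"
  shows "mdot A g f1 f2 p = gdot (g c) (f1 \<circ> inv_chart c) (f2 \<circ> inv_chart c) (map_chart c p)"
  unfolding mdot_def Let_def by (rule gdot_change) (use assms chart_at in auto)

lemma mdot_rep:
  assumes "Ck_fun A 1 f1" "Ck_fun A 1 f2" "c \<in> A" "x \<in> img_chart c"
  shows "(mdot A g f1 f2 \<circ> inv_chart c) x = gdot (g c) (f1 \<circ> inv_chart c) (f2 \<circ> inv_chart c) x"
  using mdot_eq[OF assms(1-3) inv_chart_in[OF assms(3,4)]] map_inv_chart[OF assms(3,4)] by simp

lemma Ck_fun_mdot:
  assumes "Ck_fun A (Suc k) f1" "Ck_fun A (Suc k) f2"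
  shows "Ck_fun A k (mdot A g f1 f2)"
  unfolding Ck_fun_def
proof
  fix c assume c: "c \<in> A"
  interpret C: local_metric "img_chart c" "g c" by (rule local_metric_chart[OF c])
  have "Ck_on (img_chart c) (gdot (g c) (f1 \<circ> inv_chart c) (f2 \<circ> inv_chart c)) k"
    using assms c by (intro C.Ck_gdot) (auto simp: Ck_fun_def)
  then show "Ck_on (img_chart c) (mdot A g f1 f2 \<circ> inv_chart c) k"
    by (rule Ck_on_cong_imp[OF open_img[OF c]
          mdot_rep[OF Ck_fun_mono[OF assms(1)] Ck_fun_mono[OF assms(2)] c, symmetric], rotated -1]) simp_all
qed

lemma ginner_grad:
  assumes "Ck_fun A 1 f1" "Ck_fun A 1 f2"
  shows "ginner A g p (grad A g f1 p) (grad A g f2 p) = mdot A g f1 f2 p"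
proof -
  let ?c = "chart_at A p"
  interpret C: local_metric "img_chart ?c" "g ?c" by (rule local_metric_chart[OF chart_at(1)])
  let ?x = "map_chart ?c p"
  have x: "?x \<in> img_chart ?c" using chart_at(2) by auto
  let ?b = "\<chi> j. pder j (f2 \<circ> inv_chart ?c) ?x"
  have d: "(f1 \<circ> inv_chart ?c) differentiable (at ?x)" "(f2 \<circ> inv_chart ?c) differentiable (at ?x)"
    using Ck_fun_differentiable[OF assms(1) _ chart_at] Ck_fun_differentiable[OF assms(2) _ chart_at] by auto
  have "g ?c ?x *v (matrix_inv (g ?c ?x) *v ?b) = ?b"
    by (simp add: matrix_vector_mul_assoc matrix_inv_works[OF C.invertible_G[OF x]])
  then have "ginner A g p (grad A g f1 p) (grad A g f2 p) =
      (matrix_inv (g ?c ?x) *v (\<chi> j. pder j (f1 \<circ> inv_chart ?c) ?x)) \<bullet> ?b"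
    using d by (simp add: ginner_def grad_def grad_coeff_def Let_def)
  also have "\<dots> = (\<Sum>i\<in>UNIV. \<Sum>j\<in>UNIV. ginv (g ?c) i j ?x * pder j (f1 \<circ> inv_chart ?c) ?x * pder i (f2 \<circ> inv_chart ?c) ?x)"
    by (simp add: inner_vec_def matrix_vector_mult_def ginv_def sum_distrib_right)
  also have "\<dots> = mdot A g f1 f2 p"
    unfolding mdot_def Let_def gdot_def by (subst sum.swap) (simp add: C.ginv_sym[OF x])
  finally show ?thesis .
qed

end

section \<open>The Riemannian volume\<close>

text \<open>A constant value off the image turns the inverse chart into a Borel map on the whole
  coordinate space, as needed to push measures forward.\<close>

definition chart_extend :: "('a, 'n::finite) chart \<Rightarrow> real ^ 'n \<Rightarrow> 'a" where
  "chart_extend c x = (if x \<in> img_chart c then inv_chart c x else undefined)"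

definition chart_volume :: "('a, 'n::finite) metric \<Rightarrow> ('a, 'n) chart \<Rightarrow> 'a set \<Rightarrow> ennreal" where
  "chart_volume g c B = (\<integral>\<^sup>+x. ennreal (sqrt (det (g c x))) * indicator (map_chart c ` B) x \<partial>lborel)"

definition chart_measure :: "('a::topological_space, 'n::finite) metric \<Rightarrow> ('a, 'n) chart \<Rightarrow> 'a measure" where
  "chart_measure g c = distr (density lborel (\<lambda>x. ennreal (indicator (img_chart c) x * gdens (g c) x))) borel (chart_extend c)"

text \<open>The property inside the definite description \<open>riemannian_volume\<close>, named in
  order to prove existence and uniqueness.\<close>

definition is_volume :: "('a::topological_space, 'n::finite) chart set \<Rightarrow> ('a, 'n) metric \<Rightarrow> 'a measure \<Rightarrow> bool" where
  "is_volume A g V \<longleftrightarrow> sets V = sets borel \<and>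
     (\<forall>c\<in>A. \<forall>B\<in>sets borel. B \<subseteq> dom_chart c \<longrightarrow> emeasure V B = chart_volume g c B)"

context smooth_manifold
begin

text \<open>Lindelof's theorem. Countability permits cutting the manifold into a sequence of
  disjoint pieces, each inside one chart domain, and summing measures over them.\<close>

lemma countable_chart_cover:
  obtains C :: "nat \<Rightarrow> ('a, 'n) chart" where "\<And>n. C n \<in> A" "(\<Union>n. dom_chart (C n)) = UNIV"
proof -
  obtain F where F: "F \<subseteq> dom_chart ` A" "countable F" "\<Union>F = \<Union>(dom_chart ` A)"
    by (rule Lindelof[of "dom_chart ` A"]) (use open_dom in blast)+
  obtain A' where A': "A' \<subseteq> A" "countable A'" "F = dom_chart ` A'"
    using F(1,2) by (metis countable_subset_image)
  have U: "(\<Union>c\<in>A'. dom_chart c) = UNIV" using F(3) A'(3) charts_cover by simp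
  then have "A' \<noteq> {}" by auto
  show ?thesis
  proof
    show "from_nat_into A' n \<in> A" for n using from_nat_into[OF \<open>A' \<noteq> {}\<close>] A'(1) by blast
    show "(\<Union>n. dom_chart (from_nat_into A' n)) = UNIV"
      using U range_from_nat_into[OF \<open>A' \<noteq> {}\<close> A'(2)] by (metis image_image)
  qed
qed

lemma measurable_chart_extend: "c \<in> A \<Longrightarrow> chart_extend c \<in> borel_measurable borel"
  unfolding chart_extend_def[abs_def]
  by (intro borel_measurable_continuous_on_if borel_open open_img continuous_inv_chart continuous_on_const)

lemma chart_extend_in: "c \<in> A \<Longrightarrow> B \<subseteq> dom_chart c \<Longrightarrow> x \<in> img_chart c \<Longrightarrow> chart_extend c x \<in> B \<longleftrightarrow> x \<in> map_chart c ` B"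
  using image_map_chart[of c B] by (simp add: chart_extend_def)

lemma borel_image_chart: "c \<in> A \<Longrightarrow> B \<in> sets borel \<Longrightarrow> B \<subseteq> dom_chart c \<Longrightarrow> map_chart c ` B \<in> sets borel"
proof -
  assume c: "c \<in> A" and B: "B \<in> sets borel" "B \<subseteq> dom_chart c"
  have "map_chart c ` B = chart_extend c -` B \<inter> img_chart c"
    using chart_extend_in[OF c B(2)] B(2) by auto
  then show ?thesis
    using measurable_sets[OF measurable_chart_extend[OF c] B(1)] borel_open[OF open_img[OF c]] by simp
qed

end

section \<open>Existence and uniqueness of the volume\<close>

context riemannian_manifold
begin

lemma measurable_gdens: "c \<in> A \<Longrightarrow> (\<lambda>x. indicator (img_chart c) x * gdens (g c) x) \<in> borel_measurable borel"
  using borel_measurable_continuous_on_indicator[OF borel_open[OF open_img]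
      Ck_on_continuous_on[OF local_metric.Ck_gdens[OF local_metric_chart]]] by simp

lemma gdens_nonneg: "c \<in> A \<Longrightarrow> x \<in> img_chart c \<Longrightarrow> gdens (g c) x \<ge> 0"
  using local_metric.gdens_pos[OF local_metric_chart] by (simp add: less_imp_le)

lemma chart_volume_gdens:
  assumes "c \<in> A" "B \<subseteq> dom_chart c"
  shows "chart_volume g c B = (\<integral>\<^sup>+x. ennreal (gdens (g c) x * indicator (map_chart c ` B) x) \<partial>lborel)"
  unfolding chart_volume_def gdens_def[symmetric]
  by (intro nn_integral_cong) (auto simp: indicator_def)

lemma emeasure_chart_measure_nn_integral:
  assumes c: "c \<in> A" and B: "B \<in> sets borel"
  shows "emeasure (chart_measure g c) B =
      (\<integral>\<^sup>+x. ennreal (indicator (img_chart c) x * gdens (g c) x) * indicator (chart_extend c -` B) x \<partial>lborel)"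
  unfolding chart_measure_def using measurable_chart_extend[OF c] B measurable_gdens[OF c]
    measurable_sets[OF measurable_chart_extend[OF c] B]
  by (subst emeasure_distr) (auto simp: emeasure_density)

lemma emeasure_chart_measure:
  assumes c: "c \<in> A" and B: "B \<in> sets borel"
  shows "emeasure (chart_measure g c) B = chart_volume g c (B \<inter> dom_chart c)"
proof -
  have "emeasure (chart_measure g c) B =
      (\<integral>\<^sup>+x. ennreal (indicator (img_chart c) x * gdens (g c) x) * indicator (chart_extend c -` B) x \<partial>lborel)"
    by (rule emeasure_chart_measure_nn_integral[OF assms])
  also have "\<dots> = chart_volume g c (B \<inter> dom_chart c)"
    unfolding chart_volume_def gdens_def
  proof (intro nn_integral_cong)
    fix x
    have "x \<in> map_chart c ` (B \<inter> dom_chart c) \<longleftrightarrow> x \<in> img_chart c \<and> chart_extend c x \<in> B"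
      using image_map_chart[OF c, of "B \<inter> dom_chart c"] inv_chart_in[OF c, of x] by (auto simp: chart_extend_def)
    then show "ennreal (indicator (img_chart c) x * sqrt (det (g c x))) * indicator (chart_extend c -` B) x =
        ennreal (sqrt (det (g c x))) * indicator (map_chart c ` (B \<inter> dom_chart c)) x"
      by (simp add: indicator_def)
  qed
  finally show ?thesis .
qed

lemma sets_chart_measure [simp]: "sets (chart_measure g c) = sets borel"
  by (simp add: chart_measure_def)

text \<open>The factor by which the density transforms under \<open>metric_change\<close> is exactly
  the Jacobian factor of the change of variables.\<close>

lemma chart_volume_change:
  assumes c: "c \<in> A" and d: "d \<in> A" and B: "B \<in> sets borel" "B \<subseteq> dom_chart c \<inter> dom_chart d"
  shows "chart_volume g c B = chart_volume g d B"
proof -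
  let ?\<tau> = "map_chart d \<circ> inv_chart c" and ?S = "map_chart c ` B"
  have S: "?S \<in> sets borel" using borel_image_chart[OF c B(1)] B(2) by auto
  have img: "?\<tau> ` ?S = map_chart d ` B"
    using transition_eq[OF c d] B(2) unfolding image_image by (intro image_cong) auto
  have dens: "\<bar>det (matrix (frechet_derivative ?\<tau> (at x)))\<bar> * gdens (g d) (?\<tau> x) = gdens (g c) x" if "x \<in> ?S" for x
  proof -
    obtain p where p: "p \<in> B" "x = map_chart c p" using \<open>x \<in> ?S\<close> by blast
    then have "p \<in> dom_chart c \<inter> dom_chart d" using B(2) by blast
    from metric_change(1)[OF c d this] transition_eq[OF c d this] show ?thesis using p(2) by simp
  qed
  have ind: "(\<lambda>x. indicator (img_chart e) x * gdens (g e) x * indicator (map_chart e ` B) x) =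
      (\<lambda>x. gdens (g e) x * indicator (map_chart e ` B) x)" if "B \<subseteq> dom_chart e" for e
    by (intro ext) (use image_mono[OF that, of "map_chart e"] in \<open>auto simp: indicator_def\<close>)
  have meas: "(\<lambda>x. gdens (g e) x * indicator (map_chart e ` B) x) \<in> borel_measurable borel" if "e \<in> A" "B \<subseteq> dom_chart e" for e
    unfolding ind[OF that(2), symmetric]
    by (rule borel_measurable_times[OF measurable_gdens[OF that(1)]])
      (use borel_image_chart[OF that(1) B(1) that(2)] in simp)
  have deq: "\<bar>det (matrix (frechet_derivative ?\<tau> (at x)))\<bar> * gdens (g d) (?\<tau> x) * indicator ?S x =
      gdens (g c) x * indicator ?S x" for x
    using dens[of x] by (cases "x \<in> ?S") auto
  have "(\<integral>\<^sup>+y. ennreal (gdens (g d) y * indicator (?\<tau> ` ?S) y) \<partial>lborel) =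
    (\<integral>\<^sup>+x. ennreal (\<bar>det (matrix (frechet_derivative ?\<tau> (at x)))\<bar> * gdens (g d) (?\<tau> x) * indicator ?S x) \<partial>lborel)"
  proof (rule nn_integral_change_of_variables[OF S])
    show "(?\<tau> has_derivative frechet_derivative ?\<tau> (at x)) (at x within ?S)" if "x \<in> ?S" for x
    proof -
      obtain p where p: "p \<in> B" "x = map_chart c p" using \<open>x \<in> ?S\<close> by blast
      then have "p \<in> dom_chart c \<inter> dom_chart d" using B(2) by blast
      from has_derivative_frechet[OF transition_differentiable[OF c d this]] show ?thesis
        unfolding p(2) by (rule has_derivative_at_withinI)
    qed
    show "inj_on ?\<tau> ?S"
    proof (rule inj_onI)
      fix x y assume xy: "x \<in> ?S" "y \<in> ?S" "?\<tau> x = ?\<tau> y"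
      then obtain p q where pq: "p \<in> B" "q \<in> B" "x = map_chart c p" "y = map_chart c q" by blast
      then have *: "p \<in> dom_chart c \<inter> dom_chart d" "q \<in> dom_chart c \<inter> dom_chart d" using B(2) by blast+
      have "map_chart d p = map_chart d q"
        using xy(3) unfolding pq transition_eq[OF c d *(1)] transition_eq[OF c d *(2)] .
      then have "inv_chart d (map_chart d p) = inv_chart d (map_chart d q)" by simp
      then show "x = y" using * by (simp add: inv_map_chart[OF d] pq)
    qed
    show "(\<lambda>y. gdens (g d) y * indicator (?\<tau> ` ?S) y) \<in> borel_measurable borel"
      unfolding img using meas[OF d] B(2) by auto
    show "0 \<le> gdens (g d) y" if "y \<in> ?\<tau> ` ?S" for y
      using that gdens_nonneg[OF d] B(2) unfolding img by blast
    show "(\<lambda>x. \<bar>det (matrix (frechet_derivative ?\<tau> (at x)))\<bar> * gdens (g d) (?\<tau> x) * indicator ?S x) \<in> borel_measurable borel"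
      unfolding deq using meas[OF c] B(2) by auto
  qed
  moreover have "B \<subseteq> dom_chart c" "B \<subseteq> dom_chart d" using B(2) by blast+
  ultimately show ?thesis
    unfolding img deq chart_volume_gdens[OF c \<open>B \<subseteq> dom_chart c\<close>] chart_volume_gdens[OF d \<open>B \<subseteq> dom_chart d\<close>]
    by (simp only:)
qed

text \<open>The chart measures are restricted to disjoint pieces of a countable cover and added up.
  Compatibility of the charts shows that the sum has the prescribed value in every chart, not only
  in those of the cover.\<close>

lemma is_volume_exists: "\<exists>V. is_volume A g V"
proof -
  obtain C :: "nat \<Rightarrow> ('a, 'n) chart" where C: "\<And>n. C n \<in> A" "(\<Union>n. dom_chart (C n)) = UNIV"
    by (rule countable_chart_cover) auto
  define D where "D = disjointed (\<lambda>n. dom_chart (C n))"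
  have D: "disjoint_family D" "(\<Union>n. D n) = UNIV" "D n \<subseteq> dom_chart (C n)" for n
    using UN_disjointed_eq[of "\<lambda>n. dom_chart (C n)"] C(2)
    unfolding D_def by (simp_all add: disjoint_family_disjointed disjointed_subset[of "\<lambda>n. dom_chart (C n)"])
  have Db: "D n \<in> sets borel" for n
    unfolding D_def disjointed_def using open_dom[OF C(1)] by auto
  \<comment> \<open>The countable sum of measures is encoded as the image of a single measure on
    pairs \<open>(n, x)\<close>: the first component selects the chart, and the density confines its
    contribution to \<open>D n\<close>.\<close>
  define M where "M = density (count_space UNIV \<Otimes>\<^sub>M lborel) (\<lambda>(n, x).
    ennreal (indicator (img_chart (C n)) x * gdens (g (C n)) x) * indicator (D n) (chart_extend (C n) x))"
  define V where "V = distr M borel (\<lambda>(n, x). chart_extend (C n) x)"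
  have mT: "(\<lambda>(n, x). chart_extend (C n) x) \<in> measurable (count_space UNIV \<Otimes>\<^sub>M lborel) borel"
    by (rule measurable_pair_measure_countable1) (use measurable_chart_extend[OF C(1)] in auto)
  have mF: "(\<lambda>(n, x). ennreal (indicator (img_chart (C n)) x * gdens (g (C n)) x) * indicator (D n) (chart_extend (C n) x))
      \<in> borel_measurable (count_space UNIV \<Otimes>\<^sub>M lborel)"
  proof (rule measurable_pair_measure_countable1)
    fix n
    have "(\<lambda>x. indicator (D n) (chart_extend (C n) x) :: ennreal) \<in> borel_measurable borel"
      by (rule measurable_compose[OF measurable_chart_extend[OF C(1)]]) (use Db in auto)
    then show "(\<lambda>x. case (n, x) of (n, x) \<Rightarrow> ennreal (indicator (img_chart (C n)) x * gdens (g (C n)) x) * indicator (D n) (chart_extend (C n) x))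
      \<in> borel_measurable lborel"
      using measurable_gdens[OF C(1)] by simp
  qed simp
  have V: "emeasure V B = (\<Sum>n. emeasure (chart_measure g (C n)) (D n \<inter> B))" if B: "B \<in> sets borel" for B
  proof -
    have "emeasure V B = (\<integral>\<^sup>+z. (case z of (n, x) \<Rightarrow> ennreal (indicator (img_chart (C n)) x * gdens (g (C n)) x) *
        indicator (D n) (chart_extend (C n) x)) * indicator ((\<lambda>(n, x). chart_extend (C n) x) -` B) z \<partial>(count_space UNIV \<Otimes>\<^sub>M lborel))"
      unfolding V_def M_def using mT mF B measurable_sets[OF mT B]
      by (subst emeasure_distr) (auto simp: emeasure_density space_pair_measure)
    also have "\<dots> = (\<integral>\<^sup>+n. \<integral>\<^sup>+x. ennreal (indicator (img_chart (C n)) x * gdens (g (C n)) x) *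
        indicator (D n \<inter> B) (chart_extend (C n) x) \<partial>lborel \<partial>count_space UNIV)"
    proof -
      have "(\<lambda>z. (case z of (n, x) \<Rightarrow> ennreal (indicator (img_chart (C n)) x * gdens (g (C n)) x) *
        indicator (D n) (chart_extend (C n) x)) * indicator ((\<lambda>(n, x). chart_extend (C n) x) -` B) z)
        \<in> borel_measurable (count_space UNIV \<Otimes>\<^sub>M lborel)"
        using measurable_sets[OF mT B] by (intro borel_measurable_times_ennreal mF borel_measurable_indicator)
          (auto simp: space_pair_measure)
      from lborel.nn_integral_fst[OF this, symmetric] show ?thesis
        by (auto simp: indicator_def intro!: nn_integral_cong)
    qed
    also have "\<dots> = (\<integral>\<^sup>+n. emeasure (chart_measure g (C n)) (D n \<inter> B) \<partial>count_space UNIV)"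
    proof (rule nn_integral_cong)
      fix n
      have DB: "D n \<inter> B \<in> sets borel" using Db B by auto
      show "(\<integral>\<^sup>+x. ennreal (indicator (img_chart (C n)) x * gdens (g (C n)) x) * indicator (D n \<inter> B) (chart_extend (C n) x) \<partial>lborel)
        = emeasure (chart_measure g (C n)) (D n \<inter> B)"
        unfolding emeasure_chart_measure_nn_integral[OF C(1) DB]
        by (intro nn_integral_cong) (simp add: indicator_def)
    qed
    finally show ?thesis by (simp add: nn_integral_count_space_nat)
  qed
  have "emeasure V B = chart_volume g c B" if c: "c \<in> A" and B: "B \<in> sets borel" "B \<subseteq> dom_chart c" for c B
  proof -
    \<comment> \<open>On \<open>D n \<inter> B\<close> both charts are available, so
      \<open>C n\<close> can be exchanged for \<open>c\<close>; countable additivity of the one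
      measure \<open>chart_measure g c\<close> then reassembles \<open>B\<close>.\<close>
    have eq: "emeasure (chart_measure g (C n)) (D n \<inter> B) = emeasure (chart_measure g c) (D n \<inter> B)" for n
    proof -
      have DB: "D n \<inter> B \<in> sets borel" using Db B by auto
      have sub: "D n \<inter> B \<subseteq> dom_chart (C n) \<inter> dom_chart c"
        using D(3)[of n] B(2) by blast
      then have eq: "D n \<inter> B \<inter> dom_chart (C n) = D n \<inter> B" "D n \<inter> B \<inter> dom_chart c = D n \<inter> B"
        by blast+
      show ?thesis
        unfolding emeasure_chart_measure[OF C(1) DB] emeasure_chart_measure[OF c DB] eq
        by (rule chart_volume_change[OF C(1) c DB sub])
    qed
    have "emeasure V B = (\<Sum>n. emeasure (chart_measure g c) (D n \<inter> B))"
      unfolding V[OF B(1)] eq ..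
    also have "\<dots> = emeasure (chart_measure g c) (\<Union>n. D n \<inter> B)"
      using Db B disjoint_family_subset[OF D(1), of "\<lambda>n. D n \<inter> B"] by (intro suminf_emeasure) auto
    also have "(\<Union>n. D n \<inter> B) = B" using D(2) by auto
    finally show ?thesis using B by (simp add: emeasure_chart_measure[OF c] Int_absorb2)
  qed
  moreover have "sets V = sets borel" by (simp add: V_def)
  ultimately show ?thesis unfolding is_volume_def by blast
qed

text \<open>The values are prescribed on countably many disjoint Borel pieces inside chart domains,
  and countable additivity determines the rest.\<close>

lemma is_volume_unique:
  assumes "is_volume A g V" "is_volume A g W"
  shows "V = W"
proof (rule measure_eqI)
  show "sets V = sets W" using assms by (simp add: is_volume_def)
  fix B assume "B \<in> sets V"
  then have B: "B \<in> sets borel" using assms by (simp add: is_volume_def)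
  obtain C :: "nat \<Rightarrow> ('a, 'n) chart" where C: "\<And>n. C n \<in> A" "(\<Union>n. dom_chart (C n)) = UNIV"
    by (rule countable_chart_cover) auto
  define D where "D = disjointed (\<lambda>n. dom_chart (C n))"
  have D: "disjoint_family D" "(\<Union>n. D n) = UNIV" "D n \<subseteq> dom_chart (C n)" for n
    using UN_disjointed_eq[of "\<lambda>n. dom_chart (C n)"] C(2)
    unfolding D_def by (simp_all add: disjoint_family_disjointed disjointed_subset[of "\<lambda>n. dom_chart (C n)"])
  have Db: "D n \<inter> B \<in> sets borel" for n
    unfolding D_def disjointed_def using open_dom[OF C(1)] B by auto
  have un: "(\<Union>n. D n \<inter> B) = B" using D(2) by auto
  have "emeasure X B = (\<Sum>n. chart_volume g (C n) (D n \<inter> B))" if "is_volume A g X" for X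
  proof -
    have sX: "sets X = sets borel" using that by (simp add: is_volume_def)
    have "(\<Sum>n. emeasure X (D n \<inter> B)) = emeasure X (\<Union>n. D n \<inter> B)"
      using Db sX disjoint_family_subset[OF D(1), of "\<lambda>n. D n \<inter> B"] by (intro suminf_emeasure) auto
    moreover have "emeasure X (D n \<inter> B) = chart_volume g (C n) (D n \<inter> B)" for n
      using that C(1)[of n] Db[of n] D(3)[of n] unfolding is_volume_def by blast
    ultimately show ?thesis unfolding un by simp
  qed
  from this[OF assms(1)] this[OF assms(2)] show "emeasure V B = emeasure W B" by simp
qed

abbreviation "vol \<equiv> riemannian_volume A g"

lemma is_volume_riemannian_volume: "is_volume A g vol"
proof -
  have "vol = (THE V. is_volume A g V)"
    unfolding riemannian_volume_def is_volume_def chart_volume_def by (rule refl)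
  then show ?thesis
    using is_volume_exists is_volume_unique theI[of "is_volume A g"] by metis
qed

lemma sets_vol [simp, measurable_cong]: "sets vol = sets borel"
  using is_volume_riemannian_volume by (simp add: is_volume_def)

section \<open>Integration with respect to the volume\<close>

lemma chart_measure_eq_density:
  assumes c: "c \<in> A"
  shows "chart_measure g c = density vol (\<lambda>p. ennreal (indicator (dom_chart c) p))"
proof (rule measure_eqI)
  fix B assume "B \<in> sets (chart_measure g c)"
  then have B: "B \<in> sets borel" by simp
  have d: "dom_chart c \<in> sets borel" using open_dom[OF c] by auto
  have "emeasure (density vol (\<lambda>p. ennreal (indicator (dom_chart c) p))) B = emeasure vol (B \<inter> dom_chart c)"
  proof -
    have "emeasure (density vol (\<lambda>p. ennreal (indicator (dom_chart c) p))) B =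
        (\<integral>\<^sup>+p. ennreal (indicator (dom_chart c) p) * indicator B p \<partial>vol)"
      using B d by (intro emeasure_density) auto
    also have "\<dots> = (\<integral>\<^sup>+p. indicator (B \<inter> dom_chart c) p \<partial>vol)"
      by (intro nn_integral_cong) (auto simp: indicator_def)
    finally show ?thesis using B d by simp
  qed
  then show "emeasure (chart_measure g c) B = emeasure (density vol (\<lambda>p. ennreal (indicator (dom_chart c) p))) B"
    using is_volume_riemannian_volume c B d unfolding is_volume_def
    by (simp add: emeasure_chart_measure[OF c B])
qed simp

lemma integral_chart:
  fixes f :: "'a \<Rightarrow> real"
  assumes c: "c \<in> A" and f: "f \<in> borel_measurable borel" and supp: "\<And>p. p \<notin> dom_chart c \<Longrightarrow> f p = 0"
  shows "integrable vol f \<longleftrightarrow> integrable lborel (\<lambda>x. indicator (img_chart c) x * (gdens (g c) x * f (inv_chart c x)))"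
    "(\<integral>p. f p \<partial>vol) = (\<integral>x. indicator (img_chart c) x * (gdens (g c) x * f (inv_chart c x)) \<partial>lborel)"
proof -
  have d: "dom_chart c \<in> sets borel" using open_dom[OF c] by auto
  have nn: "0 \<le> indicator (img_chart c) x * gdens (g c) x" for x
    using gdens_nonneg[OF c, of x] by (auto simp: indicator_def)
  have f1: "(\<lambda>p. indicator (dom_chart c) p * f p) = f"
    by (intro ext) (use supp in \<open>fastforce simp: indicator_def\<close>)
  have f2: "indicator (img_chart c) x * (gdens (g c) x * f (inv_chart c x)) =
      (indicator (img_chart c) x * gdens (g c) x) *\<^sub>R f (chart_extend c x)" for x
    by (auto simp: indicator_def chart_extend_def)
  have fe: "(\<lambda>x. f (chart_extend c x)) \<in> borel_measurable borel"
    by (rule measurable_compose[OF measurable_chart_extend[OF c] f])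
  have "integrable (chart_measure g c) f \<longleftrightarrow> integrable vol f"
    unfolding chart_measure_eq_density[OF c] using f d
    by (subst integrable_density) (auto simp: f1)
  moreover have "integrable (chart_measure g c) f \<longleftrightarrow> integrable lborel (\<lambda>x. indicator (img_chart c) x * (gdens (g c) x * f (inv_chart c x)))"
    unfolding f2 chart_measure_def using f measurable_chart_extend[OF c] measurable_gdens[OF c] nn fe
    by (subst integrable_distr_eq) (auto simp: integrable_density)
  ultimately show "integrable vol f \<longleftrightarrow> integrable lborel (\<lambda>x. indicator (img_chart c) x * (gdens (g c) x * f (inv_chart c x)))"
    by simp
  have "(\<integral>p. f p \<partial>chart_measure g c) = (\<integral>p. f p \<partial>vol)"
    unfolding chart_measure_eq_density[OF c] using f d
    by (subst integral_density) (auto simp: f1)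
  moreover have "(\<integral>p. f p \<partial>chart_measure g c) = (\<integral>x. indicator (img_chart c) x * (gdens (g c) x * f (inv_chart c x)) \<partial>lborel)"
    unfolding f2 chart_measure_def using f measurable_chart_extend[OF c] measurable_gdens[OF c] nn fe
    by (subst integral_distr) (auto simp: integral_density)
  ultimately show "(\<integral>p. f p \<partial>vol) = (\<integral>x. indicator (img_chart c) x * (gdens (g c) x * f (inv_chart c x)) \<partial>lborel)"
    by simp
qed

text \<open>A small coordinate ball has finite Lebesgue measure, and the density is bounded on its
  compact closure.\<close>

lemma vol_locally_finite: "\<exists>W. open W \<and> p \<in> W \<and> emeasure vol W < \<infinity>"
proof -
  let ?c = "chart_at A p"
  have c: "?c \<in> A" by (rule chart_at)
  have x: "map_chart ?c p \<in> img_chart ?c" using chart_at(2) by auto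
  obtain r where r: "r > 0" "cball (map_chart ?c p) r \<subseteq> img_chart ?c"
    using open_img[OF c] x open_contains_cball by blast
  let ?b = "ball (map_chart ?c p) r"
  have b: "?b \<subseteq> img_chart ?c" using r(2) by auto
  let ?W = "inv_chart ?c ` ?b"
  have W: "open ?W" "?W \<subseteq> dom_chart ?c" using open_inv_image_chart[OF c _ b] inv_chart_in[OF c] b by auto
  have img: "map_chart ?c ` ?W = ?b"
  proof -
    have "map_chart ?c ` ?W = (\<lambda>x. x) ` ?b"
      unfolding image_image by (rule image_cong[OF refl], rule map_inv_chart[OF c], rule subsetD[OF b])
    then show ?thesis by simp
  qed
  have "compact (gdens (g ?c) ` cball (map_chart ?c p) r)"
    by (intro compact_continuous_image continuous_on_subset[OF Ck_on_continuous_on[OF local_metric.Ck_gdens[OF local_metric_chart[OF c]]] r(2)])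
      simp
  then obtain B where B: "\<forall>z\<in>gdens (g ?c) ` cball (map_chart ?c p) r. norm z \<le> B"
    using compact_imp_bounded[of "gdens (g ?c) ` cball (map_chart ?c p) r"] unfolding bounded_iff by blast
  have "emeasure vol ?W = chart_volume g ?c ?W"
    using is_volume_riemannian_volume c W unfolding is_volume_def by auto
  also have "\<dots> \<le> (\<integral>\<^sup>+x. ennreal B * indicator ?b x \<partial>lborel)"
    unfolding chart_volume_def img gdens_def[symmetric]
    by (intro nn_integral_mono) (use B in \<open>auto simp: indicator_def abs_le_iff intro!: ennreal_leI\<close>)
  also have "\<dots> = ennreal B * emeasure lborel ?b" by (simp add: nn_integral_cmult_indicator)
  also have "\<dots> < \<infinity>" using emeasure_bounded_finite[of ?b] by (simp add: ennreal_mult_less_top)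
  finally show ?thesis
    using W chart_at(2) r(1) inv_map_chart[OF c chart_at(2)] by (intro exI[of _ ?W]) (auto intro!: image_eqI[of p _ "map_chart ?c p"])
qed

text \<open>Formulated with local boundedness instead of continuity, for the sake of
  |\<nabla>|\<nabla>u_i||^2, which may be discontinuous at the zeros of \<nabla>u_i. A finite
  subcover of \<open>K\<close> reduces the claim to a bounded function on a set of finite
  volume.\<close>

lemma integrable_vol:
  fixes f :: "'a \<Rightarrow> real"
  assumes f: "f \<in> borel_measurable borel" and K: "compact K" "\<And>p. p \<notin> K \<Longrightarrow> f p = 0"
    and loc: "\<And>p. \<exists>W b. open W \<and> p \<in> W \<and> (\<forall>q\<in>W. \<bar>f q\<bar> \<le> b)"
  shows "integrable vol f"
proof -
  have "\<exists>W b. open W \<and> p \<in> W \<and> emeasure vol W < \<infinity> \<and> (\<forall>q\<in>W. \<bar>f q\<bar> \<le> b)" for p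
  proof -
    obtain W1 where W1: "open W1" "p \<in> W1" "emeasure vol W1 < \<infinity>" using vol_locally_finite by blast
    obtain W2 b where W2: "open W2" "p \<in> W2" "\<forall>q\<in>W2. \<bar>f q\<bar> \<le> b" using loc by blast
    have "emeasure vol (W1 \<inter> W2) \<le> emeasure vol W1" using W1(1) by (intro emeasure_mono) auto
    then show ?thesis using W1 W2 by (intro exI[of _ "W1 \<inter> W2"] exI[of _ b]) auto
  qed
  then obtain W b where W: "\<And>p. open (W p)" "\<And>p. p \<in> W p" "\<And>p. emeasure vol (W p) < \<infinity>"
    "\<And>p q. q \<in> W p \<Longrightarrow> \<bar>f q\<bar> \<le> b p" by metis
  obtain F where F: "finite F" "K \<subseteq> (\<Union>p\<in>F. W p)"
    using compactE_image[OF K(1), of UNIV W] W(1,2) by (metis UNIV_I UN_I subsetI)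
  let ?U = "\<Union>p\<in>F. W p"
  have "emeasure vol ?U \<le> (\<Sum>p\<in>F. emeasure vol (W p))"
    using F(1) W(1) by (intro emeasure_subadditive_finite) auto
  also have "\<dots> < \<infinity>" using W(3) F(1) by simp
  finally have fin: "emeasure vol ?U < \<infinity>" .
  have bd: "\<bar>f q\<bar> \<le> (\<Sum>p\<in>F. \<bar>b p\<bar>)" if "q \<in> ?U" for q
  proof -
    obtain p where p: "p \<in> F" "q \<in> W p" using \<open>q \<in> ?U\<close> by blast
    then have "\<bar>f q\<bar> \<le> \<bar>b p\<bar>" using W(4) by fastforce
    also have "\<dots> \<le> (\<Sum>p\<in>F. \<bar>b p\<bar>)" using F(1) p(1) by (intro member_le_sum) auto
    finally show ?thesis .
  qed
  have Ub: "?U \<in> sets borel" using W(1) by (intro borel_open open_UN) auto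
  have null: "f q = 0" if "q \<notin> ?U" for q using F(2) K(2) that by blast
  show ?thesis
    by (rule integrableI_bounded_set[OF _ _ fin])
      (use Ub f bd null in \<open>auto intro!: AE_I2\<close>)
qed

lemma integrable_vol_continuous:
  fixes f :: "'a \<Rightarrow> real"
  assumes f: "continuous_on UNIV f" and K: "compact K" "\<And>p. p \<notin> K \<Longrightarrow> f p = 0"
  shows "integrable vol f"
proof (rule integrable_vol[OF _ K])
  show "f \<in> borel_measurable borel" by (rule borel_measurable_continuous_onI[OF f])
  fix p
  let ?W = "f -` {f p - 1<..<f p + 1}"
  have "open ?W" using f by (intro open_vimage) auto
  then show "\<exists>W b. open W \<and> p \<in> W \<and> (\<forall>q\<in>W. \<bar>f q\<bar> \<le> b)"
    by (intro exI[of _ ?W] exI[of _ "\<bar>f p\<bar> + 1"]) auto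
qed

end

section \<open>Cutoff functions\<close>

lemma Ck_on_compose1:
  fixes f :: "real ^ 'n::finite \<Rightarrow> real"
  assumes S: "open S" and \<tau>: "Ck_on S \<tau> 1" and f: "Ck_on T f 1" and sub: "\<tau> ` S \<subseteq> T"
  shows "Ck_on S (f \<circ> \<tau>) 1"
proof (rule C1_onI[OF S])
  have df: "f differentiable (at (\<tau> x))" if "x \<in> S" for x using f sub that by auto
  have d\<tau>: "\<tau> differentiable (at x)" if "x \<in> S" for x using \<tau> that by auto
  show "(f \<circ> \<tau> has_derivative frechet_derivative f (at (\<tau> x)) \<circ> frechet_derivative \<tau> (at x)) (at x)" if "x \<in> S" for x
    by (rule diff_chain_at[OF has_derivative_frechet[OF d\<tau>[OF that]] has_derivative_frechet[OF df[OF that]]])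
  show "continuous_on S (\<lambda>x. (frechet_derivative f (at (\<tau> x)) \<circ> frechet_derivative \<tau> (at x)) v)" for v
  proof -
    have c1: "continuous_on S (\<lambda>x. frechet_derivative \<tau> (at x) v)" using \<tau> by simp
    have "continuous_on T (pder i f)" for i using Ck_on_pder[of T f 0 i] f by simp
    then have c2: "continuous_on S (\<lambda>x. pder i f (\<tau> x))" for i
      using continuous_on_compose2[OF _ Ck_on_continuous_on[OF \<tau>] sub] by blast
    have "continuous_on S (\<lambda>x. \<Sum>i\<in>UNIV. frechet_derivative \<tau> (at x) v $ i * pder i f (\<tau> x))"
      by (intro continuous_on_sum continuous_on_mult continuous_on_component c1 c2)
    then show ?thesis
      by (rule continuous_on_eq) (simp add: frechet_derivative_pder[OF df])
  qed
qed

text \<open>The square of the positive part is of class C^1. Test functions are only required to be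
  C^1, so explicit cutoffs can be built from it.\<close>

lemma DERIV_max_square: "((\<lambda>t. (max 0 t)\<^sup>2) has_real_derivative 2 * max 0 t) (at (t :: real))"
proof -
  consider "t < 0" | "t > 0" | "t = 0" by linarith
  then show ?thesis
  proof cases
    case 1
    have "((\<lambda>t. 0) has_real_derivative 2 * max 0 t) (at t)" using 1 by simp
    then show ?thesis
      by (rule has_field_derivative_transform_within_open[of _ _ _ "{..<0}"]) (use 1 in auto)
  next
    case 2
    have "((\<lambda>t. t\<^sup>2) has_real_derivative 2 * max 0 t) (at t)"
      using 2 by (auto intro!: derivative_eq_intros)
    then show ?thesis
      by (rule has_field_derivative_transform_within_open[of _ _ _ "{0<..}"]) (use 2 in auto)
  next
    case 3
    have "((\<lambda>h. (max 0 h)\<^sup>2 / h) \<longlongrightarrow> 0) (at (0::real))"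
    proof (rule Lim_null_comparison)
      show "\<forall>\<^sub>F h in at 0. norm ((max 0 h)\<^sup>2 / h) \<le> \<bar>h\<bar>"
        by (intro always_eventually allI) (auto simp: max_def power2_eq_square)
      show "((\<lambda>h. \<bar>h\<bar>) \<longlongrightarrow> 0) (at (0::real))" by (auto intro!: tendsto_eq_intros)
    qed
    then show ?thesis unfolding 3 DERIV_def by simp
  qed
qed

lemma Ck_on_max_square:
  fixes f :: "'a::real_normed_vector \<Rightarrow> real"
  assumes S: "open S" and f: "Ck_on S f 1"
  shows "Ck_on S (\<lambda>x. (max 0 (f x))\<^sup>2) 1"
proof (rule C1_onI[OF S])
  show "((\<lambda>x. (max 0 (f x))\<^sup>2) has_derivative (\<lambda>v. frechet_derivative f (at x) v * (2 * max 0 (f x)))) (at x)"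
    if "x \<in> S" for x
  proof -
    have "(f has_derivative frechet_derivative f (at x)) (at x)"
      using f that by (intro has_derivative_frechet) auto
    from DERIV_compose_FDERIV[OF DERIV_max_square this] show ?thesis by simp
  qed
  show "continuous_on S (\<lambda>x. frechet_derivative f (at x) v * (2 * max 0 (f x)))" for v
    using f by (intro continuous_on_mult continuous_on_max continuous_on_const Ck_on_continuous_on[OF f]) auto
qed

lemma C1_bump:
  fixes x0 :: "real ^ 'n::finite"
  assumes r: "r > 0"
  obtains q :: "real ^ 'n \<Rightarrow> real" where "Ck_on UNIV q 1" "\<And>x. 0 \<le> q x" "\<And>x. q x \<le> 1"
    "\<And>x. x \<notin> cball x0 r \<Longrightarrow> q x = 0" "\<And>x. x \<in> ball x0 (r / 2) \<Longrightarrow> q x = 1"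
proof -
  \<comment> \<open>On the half ball the positive part is at least 3/4 r^2, so the factor 2 / r^4
    makes \<open>b\<close> at least 9/8 there. The definition of \<open>q\<close> then truncates at
    height 1 while keeping the function C^1, because 1 - \<open>b\<close> enters through the square
    of its positive part.\<close>
  define b where "b x = 2 / r ^ 4 * (max 0 (r\<^sup>2 - (x - x0) \<bullet> (x - x0)))\<^sup>2" for x
  define q where "q x = 1 - (max 0 (1 - b x))\<^sup>2" for x
  have "Ck_on UNIV (\<lambda>x. r\<^sup>2 - (x - x0) \<bullet> (x - x0)) 1"
    by (rule C1_onI[where f' = "\<lambda>x v. - (2 * ((x - x0) \<bullet> v))"])
      (auto intro!: derivative_eq_intros continuous_intros simp: inner_commute)
  then have b: "Ck_on UNIV b 1"
    unfolding b_def by (intro Ck_on_cmult Ck_on_max_square) auto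
  have q: "Ck_on UNIV q 1"
    unfolding q_def by (intro Ck_on_diff Ck_on_max_square Ck_on_const b) auto
  have b0: "0 \<le> b x" for x unfolding b_def by simp
  have "(max 0 (1 - b x))\<^sup>2 \<le> 1" for x
    using b0[of x] by (intro power_le_one) auto
  moreover have "b x = 0" if "x \<notin> cball x0 r" for x
  proof -
    have "r < norm (x - x0)" using that by (simp add: dist_norm norm_minus_commute)
    then have "r\<^sup>2 < (norm (x - x0))\<^sup>2" using r by (intro power_strict_mono) auto
    then show ?thesis unfolding b_def by (simp add: power2_norm_eq_inner)
  qed
  moreover have "1 \<le> b x" if "x \<in> ball x0 (r / 2)" for x
  proof -
    have "norm (x - x0) \<le> r / 2" using that by (simp add: dist_norm norm_minus_commute)
    then have "(norm (x - x0))\<^sup>2 \<le> (r / 2)\<^sup>2" by (intro power_mono) auto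
    then have "3 / 4 * r\<^sup>2 \<le> r\<^sup>2 - (x - x0) \<bullet> (x - x0)"
      by (simp add: power2_norm_eq_inner power_divide)
    then have "(3 / 4 * r\<^sup>2)\<^sup>2 \<le> (max 0 (r\<^sup>2 - (x - x0) \<bullet> (x - x0)))\<^sup>2"
      by (intro power_mono max.coboundedI2) auto
    then have "2 / r ^ 4 * (3 / 4 * r\<^sup>2)\<^sup>2 \<le> b x"
      unfolding b_def using r by (intro mult_left_mono) auto
    moreover have "2 / r ^ 4 * (3 / 4 * r\<^sup>2)\<^sup>2 = 9 / 8"
      using r by (simp add: power_mult_distrib power_mult[symmetric] power_divide)
    ultimately show ?thesis by simp
  qed
  ultimately show ?thesis
    using that[of q] q unfolding q_def by simp
qed

context smooth_manifold
begin

lemma Ck_transition1: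
  assumes "c \<in> A" "d \<in> A"
  shows "Ck_on (map_chart d ` (dom_chart d \<inter> dom_chart c)) (map_chart c \<circ> inv_chart d) 1"
  using smooth_transition[OF assms(2,1)] unfolding smooth_on_def by blast

lemma compact_inv_image_chart: "c \<in> A \<Longrightarrow> compact K \<Longrightarrow> K \<subseteq> img_chart c \<Longrightarrow> compact (inv_chart c ` K)"
  by (rule compact_continuous_image[OF continuous_on_subset[OF continuous_inv_chart]])

text \<open>Seen from another chart \<open>d\<close>, the images of the overlap with
  \<open>c\<close> and of the complement of \<open>K\<close> are open and cover. Compact sets are
  closed since the manifold is Hausdorff, which makes the second image open.\<close>

lemma Ck_fun_extend_zero:
  assumes c: "c \<in> A" and q: "Ck_on (img_chart c) q 1" and K: "compact K" "K \<subseteq> dom_chart c"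
    and zero: "\<And>p. p \<in> dom_chart c - K \<Longrightarrow> q (map_chart c p) = 0"
  shows "Ck_fun A 1 (\<lambda>p. if p \<in> dom_chart c then q (map_chart c p) else 0)" (is "Ck_fun A 1 ?f")
  unfolding Ck_fun_def
proof
  fix d assume d: "d \<in> A"
  let ?O = "map_chart d ` (dom_chart d \<inter> dom_chart c)" and ?N = "map_chart d ` (dom_chart d \<inter> - K)"
  have oO: "open ?O" by (rule open_image_chart[OF d open_dom[OF c]])
  have oN: "open ?N" using compact_imp_closed[OF K(1)] by (intro open_image_chart[OF d]) auto
  have 1: "Ck_on ?O (?f \<circ> inv_chart d) 1"
  proof (rule Ck_on_cong_imp[OF oO])
    show "Ck_on ?O (q \<circ> (map_chart c \<circ> inv_chart d)) 1"
    proof (rule Ck_on_compose1[OF oO Ck_transition1[OF c d] q])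
      show "(map_chart c \<circ> inv_chart d) ` ?O \<subseteq> img_chart c"
        using transition_eq[OF d c] by auto
    qed
    show "(q \<circ> (map_chart c \<circ> inv_chart d)) x = (?f \<circ> inv_chart d) x" if "x \<in> ?O" for x
      using that inv_map_chart[OF d] by auto
  qed
  have 2: "Ck_on ?N (?f \<circ> inv_chart d) 1"
  proof (rule Ck_on_cong_imp[OF oN])
    show "Ck_on ?N (\<lambda>x. 0 :: real) 1" by (rule Ck_on_const)
    show "0 = (?f \<circ> inv_chart d) x" if "x \<in> ?N" for x
      using that inv_map_chart[OF d] zero by auto
  qed
  show "Ck_on (img_chart d) (?f \<circ> inv_chart d) 1"
  proof (rule Ck_on_open_cover[OF _ open_img[OF d]])
    fix x assume "x \<in> img_chart d"
    then obtain p where p: "p \<in> dom_chart d" "x = map_chart d p" by blast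
    show "\<exists>T. open T \<and> x \<in> T \<and> Ck_on (img_chart d \<inter> T) (?f \<circ> inv_chart d) 1"
    proof (cases "p \<in> dom_chart c")
      case True
      then show ?thesis using p oO Ck_on_subset[OF 1] by (intro exI[of _ ?O]) blast
    next
      case False
      then show ?thesis using p K(2) oN Ck_on_subset[OF 2] by (intro exI[of _ ?N]) blast
    qed
  qed
qed

lemma bump_exists:
  assumes W: "open W" "p \<in> W"
  obtains \<psi> V K c where "c \<in> A" "Ck_fun A 1 \<psi>" "\<And>q. 0 \<le> \<psi> q" "open V" "p \<in> V" "\<And>q. q \<in> V \<Longrightarrow> \<psi> q = 1"
    "compact K" "K \<subseteq> dom_chart c" "K \<subseteq> W" "\<And>q. q \<notin> K \<Longrightarrow> \<psi> q = 0"
proof -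
  let ?c = "chart_at A p"
  have c: "?c \<in> A" by (rule chart_at)
  let ?x = "map_chart ?c p" and ?T = "map_chart ?c ` (dom_chart ?c \<inter> W)"
  have "open ?T" "?x \<in> ?T" using open_image_chart[OF c W(1)] chart_at(2) W(2) by auto
  then obtain r where r: "r > 0" "cball ?x r \<subseteq> ?T" using open_contains_cball by blast
  obtain q :: "real ^ 'n \<Rightarrow> real" where q: "Ck_on UNIV q 1" "\<And>x. 0 \<le> q x" "\<And>x. q x \<le> 1"
    "\<And>x. x \<notin> cball ?x r \<Longrightarrow> q x = 0" "\<And>x. x \<in> ball ?x (r / 2) \<Longrightarrow> q x = 1"
    using C1_bump[OF r(1)] by blast
  let ?K = "inv_chart ?c ` cball ?x r" and ?V = "inv_chart ?c ` ball ?x (r / 2)"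
  have sub: "cball ?x r \<subseteq> img_chart ?c" using r(2) by blast
  have sub': "ball ?x (r / 2) \<subseteq> cball ?x r" using r(1) by auto
  have K: "compact ?K" "?K \<subseteq> dom_chart ?c" "?K \<subseteq> W"
    using compact_inv_image_chart[OF c _ sub] inv_chart_in[OF c] sub r(2) inv_map_chart[OF c] by (auto simp: subset_iff)
  have zero: "q (map_chart ?c s) = 0" if "s \<in> dom_chart ?c - ?K" for s
    using that inv_map_chart[OF c, of s] by (intro q(4)) (metis DiffD1 DiffD2 image_eqI)
  let ?\<psi> = "\<lambda>s. if s \<in> dom_chart ?c then q (map_chart ?c s) else 0"
  show ?thesis
  proof (rule that[of ?c ?\<psi> ?V ?K])
    show "Ck_fun A 1 ?\<psi>"
      by (rule Ck_fun_extend_zero[OF c Ck_on_subset[OF q(1)] K(1,2) zero]) auto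
    show "open ?V" by (rule open_inv_image_chart[OF c]) (use sub sub' in auto)
    show "p \<in> ?V" using r(1) inv_map_chart[OF c chart_at(2)] by (intro image_eqI[of p _ ?x]) auto
    show "?\<psi> s = 1" if "s \<in> ?V" for s
    proof -
      obtain y where y: "y \<in> ball ?x (r / 2)" "s = inv_chart ?c y" using \<open>s \<in> ?V\<close> by blast
      then have "y \<in> img_chart ?c" using sub sub' by blast
      then show ?thesis using q(5)[OF y(1)] inv_chart_in[OF c] map_inv_chart[OF c] y(2) by simp
    qed
    show "?\<psi> s = 0" if "s \<notin> ?K" for s using zero[of s] that by simp
  qed (use c K q(2) in auto)
qed

end

section \<open>Green's identity\<close>

lemma (in local_metric) green_local:
  assumes a: "Ck_on S a 1" and b: "Ck_on S b 2" and K: "compact K" "K \<subseteq> S" "\<And>x. x \<in> S - K \<Longrightarrow> a x = 0"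
  shows "integrable lborel (\<lambda>x. indicator S x * (gdens G x * (a x * laplace_coeff G b x + gdot G a b x)))"
    "(\<integral>x. indicator S x * (gdens G x * (a x * laplace_coeff G b x + gdot G a b x)) \<partial>lborel) = 0"
proof -
  \<comment> \<open>The gradient of \<open>b\<close> multiplied by the density. The Laplacian is by
    definition the divergence of \<open>Y\<close> divided by the density, so the divergence of
    \<open>a\<close> times \<open>Y\<close> is the whole integrand.\<close>
  define Y where "Y i y = gdens G y * (\<Sum>j\<in>UNIV. ginv G i j y * pder j b y)" for i y
  have b1: "Ck_on S (pder j b) 1" for j using Ck_on_pder[of S b 1 j] b by (simp add: numeral_2_eq_2)
  have Y: "Ck_on S (Y i) 1" for i
    unfolding Y_def by (intro Ck_on_mult Ck_on_sum Ck_gdens Ck_ginv b1 open_S)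
  have aY: "Ck_on S (\<lambda>y. a y * Y i y) 1" for i by (rule Ck_on_mult[OF open_S a Y])
  have eq: "indicator S x * (gdens G x * (a x * laplace_coeff G b x + gdot G a b x)) =
      (\<Sum>i\<in>UNIV. indicator S x * pder i (\<lambda>y. a y * Y i y) x)" for x
  proof (cases "x \<in> S")
    case True
    have d: "a differentiable (at x)" "Y i differentiable (at x)" for i
      using Ck_on_differentiable[OF a _ True] Ck_on_differentiable[OF Y _ True] by auto
    have "(\<Sum>i\<in>UNIV. pder i (\<lambda>y. a y * Y i y) x) =
        (\<Sum>i\<in>UNIV. pder i a x * Y i x) + a x * (\<Sum>i\<in>UNIV. pder i (Y i) x)"
      by (simp add: pder_mult d sum.distrib sum_distrib_left)
    moreover have "(\<Sum>i\<in>UNIV. pder i (Y i) x) = gdens G x * laplace_coeff G b x"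
      unfolding laplace_coeff_def using gdens_pos[OF True]
      by (simp add: Y_def[abs_def] gdens_def[abs_def] ginv_def[abs_def])
    moreover have "(\<Sum>i\<in>UNIV. pder i a x * Y i x) = gdens G x * gdot G a b x"
      by (simp add: Y_def gdot_def sum_distrib_left mult_ac)
    ultimately show ?thesis using True by (simp add: algebra_simps)
  qed simp
  have 0: "integrable lborel (\<lambda>x. indicator S x * pder i (\<lambda>y. a y * Y i y) x)"
    "(\<integral>x. indicator S x * pder i (\<lambda>y. a y * Y i y) x \<partial>lborel) = 0" for i
    using integral_pder_on_eq_0[OF open_S aY K(1,2), of i i] K(3) by auto
  show "integrable lborel (\<lambda>x. indicator S x * (gdens G x * (a x * laplace_coeff G b x + gdot G a b x)))"
    "(\<integral>x. indicator S x * (gdens G x * (a x * laplace_coeff G b x + gdot G a b x)) \<partial>lborel) = 0"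
    unfolding eq
    by (intro Bochner_Integration.integrable_sum 0(1),
        subst Bochner_Integration.integral_sum, rule 0(1), simp only: 0(2) sum.neutral_const)
qed

text \<open>The Laplacian in a prescribed chart, to be used until its independence of the chart is
  established.\<close>

definition chart_laplace :: "('a, 'n::finite) metric \<Rightarrow> ('a, 'n) chart \<Rightarrow> ('a \<Rightarrow> real) \<Rightarrow> 'a \<Rightarrow> real" where
  "chart_laplace g c f p = laplace_coeff (g c) (f \<circ> inv_chart c) (map_chart c p)"

context riemannian_manifold
begin

lemma mdot_zero_outside:
  assumes a: "Ck_fun A 1 a" and b: "Ck_fun A 1 b" and K: "closed K" "\<And>p. p \<notin> K \<Longrightarrow> a p = 0" and p: "p \<notin> K"
  shows "mdot A g a b p = 0"
proof -
  let ?c = "chart_at A p"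
  have c: "?c \<in> A" by (rule chart_at)
  let ?O = "map_chart ?c ` (dom_chart ?c \<inter> - K)"
  have O: "open ?O" "map_chart ?c p \<in> ?O" using open_image_chart[OF c] K(1) chart_at(2) p by auto
  have "pder i (a \<circ> inv_chart ?c) (map_chart ?c p) = pder i (\<lambda>_. 0) (map_chart ?c p)" for i
    by (rule pder_cong[OF O Ck_fun_differentiable[OF a _ c chart_at(2)]])
      (use inv_map_chart[OF c] K(2) in auto)
  then show ?thesis by (simp add: mdot_eq[OF a b c chart_at(2)] gdot_def)
qed

lemma continuous_on_chart_laplace:
  assumes "Ck_fun A 2 b" "c \<in> A"
  shows "continuous_on (dom_chart c) (chart_laplace g c b)"
proof -
  have "Ck_on (img_chart c) (b \<circ> inv_chart c) (Suc (Suc 0))"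
    using assms unfolding Ck_fun_def by (simp only: numeral_2_eq_2)
  from Ck_on_continuous_on[OF local_metric.Ck_laplace[OF local_metric_chart[OF assms(2)] this]]
  show ?thesis
    unfolding chart_laplace_def[abs_def] using continuous_on_compose2[OF _ continuous_map_chart[OF assms(2)]] by blast
qed

lemma green_chart:
  assumes c: "c \<in> A" and a: "Ck_fun A 1 a" and b: "Ck_fun A 2 b"
    and K: "compact K" "K \<subseteq> dom_chart c" "\<And>p. p \<notin> K \<Longrightarrow> a p = 0"
  shows "integrable vol (\<lambda>p. a p * chart_laplace g c b p + mdot A g a b p)"
    "(\<integral>p. a p * chart_laplace g c b p + mdot A g a b p \<partial>vol) = 0"
proof -
  let ?F = "\<lambda>p. a p * chart_laplace g c b p + mdot A g a b p"
  interpret C: local_metric "img_chart c" "g c" by (rule local_metric_chart[OF c])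
  have b1: "Ck_fun A 1 b" by (rule Ck_fun_mono[OF b]) simp
  have F0: "?F p = 0" if "p \<notin> K" for p
    using mdot_zero_outside[OF a b1 compact_imp_closed[OF K(1)] K(3) that] K(3)[OF that] by simp
  have cm: "continuous_on UNIV (mdot A g a b)"
    using Ck_fun_mdot[of 0 a b] a b1 by (intro Ck_fun_continuous[of 0]) simp
  \<comment> \<open>Off the domain of \<open>c\<close> the value of \<open>chart_laplace\<close>
    carries no information. As \<open>?F\<close> vanishes there, it can be cut off explicitly, and
    measurability follows from continuity on an open set.\<close>
  have F: "?F = (\<lambda>p. if p \<in> dom_chart c then ?F p else 0)"
  proof
    fix p show "?F p = (if p \<in> dom_chart c then ?F p else 0)"
      using F0[of p] K(2) by (cases "p \<in> dom_chart c") auto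
  qed
  have Fm: "?F \<in> borel_measurable borel"
    by (subst F, rule borel_measurable_continuous_on_if)
      (use open_dom[OF c] in \<open>auto intro!: continuous_on_add continuous_on_mult continuous_on_chart_laplace[OF b c]
        continuous_on_subset[OF cm] continuous_on_subset[OF Ck_fun_continuous[OF a]]\<close>)
  have supp: "?F p = 0" if "p \<notin> dom_chart c" for p using F0 K(2) that by blast
  have eq: "indicator (img_chart c) x * (gdens (g c) x * ?F (inv_chart c x)) =
     indicator (img_chart c) x * (gdens (g c) x * ((a \<circ> inv_chart c) x * laplace_coeff (g c) (b \<circ> inv_chart c) x +
       gdot (g c) (a \<circ> inv_chart c) (b \<circ> inv_chart c) x))" for x
  proof (cases "x \<in> img_chart c")
    case True
    then show ?thesis using mdot_rep[OF a b1 c True] map_inv_chart[OF c True] by (simp add: chart_laplace_def)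
  qed simp
  have Kc: "compact (map_chart c ` K)"
    by (rule compact_continuous_image[OF continuous_on_subset[OF continuous_map_chart[OF c] K(2)] K(1)])
  have zero: "(a \<circ> inv_chart c) x = 0" if "x \<in> img_chart c - map_chart c ` K" for x
    using that map_inv_chart[OF c] K(3) by (metis DiffE comp_apply image_eqI)
  have ab: "Ck_on (img_chart c) (a \<circ> inv_chart c) 1" "Ck_on (img_chart c) (b \<circ> inv_chart c) 2"
    using a b c unfolding Ck_fun_def by blast+
  note green = C.green_local[OF ab Kc image_mono[OF K(2)] zero]
  have "integrable lborel (\<lambda>x. indicator (img_chart c) x * (gdens (g c) x * ?F (inv_chart c x)))"
    unfolding eq by (rule green(1))
  moreover have "integrable vol ?F \<longleftrightarrow> integrable lborel (\<lambda>x. indicator (img_chart c) x * (gdens (g c) x * ?F (inv_chart c x)))"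
    by (rule integral_chart(1)[OF c Fm], rule supp)
  ultimately show "integrable vol ?F" by simp
  have "(\<integral>x. indicator (img_chart c) x * (gdens (g c) x * ?F (inv_chart c x)) \<partial>lborel) = 0"
    unfolding eq by (rule green(2))
  with integral_chart(2)[OF c Fm supp] show "(\<integral>p. ?F p \<partial>vol) = 0" by (rule trans)
qed

section \<open>Chart independence of the Laplacian\<close>

text \<open>The density is positive, and a nonempty open set of the coordinate space is not
  negligible.\<close>

lemma vol_open_pos:
  assumes W: "open W" "p \<in> W"
  shows "emeasure vol W > 0"
proof (rule ccontr)
  assume "\<not> 0 < emeasure vol W"
  then have W0: "emeasure vol W = 0" by simp
  let ?c = "chart_at A p"
  have c: "?c \<in> A" by (rule chart_at)
  let ?W = "dom_chart ?c \<inter> W"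
  let ?T = "map_chart ?c ` ?W"
  have T: "open ?T" "map_chart ?c p \<in> ?T" using open_image_chart[OF c W(1)] chart_at(2) W(2) by auto
  have Wb: "?W \<in> sets borel" using open_dom[OF c] W(1) by auto
  have "emeasure vol ?W \<le> emeasure vol W" using W(1) by (intro emeasure_mono) auto
  then have "chart_volume g ?c ?W = 0"
    using W0 is_volume_riemannian_volume c Wb unfolding is_volume_def by auto
  then have "(\<integral>\<^sup>+x. ennreal (gdens (g ?c) x * indicator ?T x) \<partial>lborel) = 0"
    by (simp add: chart_volume_gdens[OF c])
  moreover have "(\<lambda>x. gdens (g ?c) x * indicator ?T x) \<in> borel_measurable borel"
  proof -
    have "(\<lambda>x. gdens (g ?c) x * indicator ?T x) = (\<lambda>x. indicator (img_chart ?c) x * gdens (g ?c) x * indicator ?T x)"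
      by (intro ext) (auto simp: indicator_def)
    then show ?thesis
      using borel_measurable_times[OF measurable_gdens[OF c], of "indicator ?T"] T(1) by auto
  qed
  ultimately have "AE x in lborel. ennreal (gdens (g ?c) x * indicator ?T x) = 0"
    by (subst (asm) nn_integral_0_iff_AE) auto
  then have "AE x in lborel. x \<notin> ?T"
  proof eventually_elim
    fix x assume "ennreal (gdens (g ?c) x * indicator ?T x) = 0"
    then show "x \<notin> ?T"
      using local_metric.gdens_pos[OF local_metric_chart[OF c], of x] by (auto simp: indicator_def split: if_splits)
  qed
  then have "?T \<in> null_sets lborel"
    using T(1) by (simp add: AE_iff_null_sets)
  then have "?T \<in> null_sets lebesgue" by (rule null_sets_completionI)
  then have "negligible ?T" by (simp add: negligible_iff_null_sets)
  then show False using open_not_negligible[OF T(1)] T(2) by auto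
qed

text \<open>The weak form of the Laplacian is invariant, hence so is the Laplacian itself.\<close>

lemma chart_laplace_change_le:
  assumes c: "c \<in> A" and d: "d \<in> A" and f: "Ck_fun A 2 f" and p: "p \<in> dom_chart c" "p \<in> dom_chart d"
  shows "chart_laplace g c f p \<le> chart_laplace g d f p"
proof (rule ccontr)
  assume less: "\<not> chart_laplace g c f p \<le> chart_laplace g d f p"
  let ?O = "dom_chart c \<inter> dom_chart d" and ?\<delta> = "\<lambda>q. chart_laplace g c f q - chart_laplace g d f q"
  have "continuous_on ?O ?\<delta>"
    by (intro continuous_on_diff continuous_on_subset[OF continuous_on_chart_laplace[OF f c]]
        continuous_on_subset[OF continuous_on_chart_laplace[OF f d]]) auto
  moreover have oO: "open ?O" by (rule open_Int[OF open_dom[OF c] open_dom[OF d]])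
  ultimately have "\<forall>B. open B \<longrightarrow> open (?\<delta> -` B \<inter> ?O)" by (simp only: continuous_on_open_vimage[OF oO])
  then have oW: "open (?\<delta> -` {0<..} \<inter> ?O)" by (rule allE[of _ "{0<..}"]) simp
  let ?W = "?\<delta> -` {0<..} \<inter> ?O"
  have "p \<in> ?W" using less p by auto
  from bump_exists[OF oW this] obtain \<psi> V K e where \<psi>: "Ck_fun A 1 \<psi>" "\<And>q. 0 \<le> \<psi> q" "open V" "p \<in> V"
    "\<And>q. q \<in> V \<Longrightarrow> \<psi> q = 1" "compact K" "K \<subseteq> ?W" "\<And>q. q \<notin> K \<Longrightarrow> \<psi> q = 0"
    by (metis (no_types, lifting))
  have Kc: "K \<subseteq> dom_chart c" "K \<subseteq> dom_chart d" using \<psi>(7) by auto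
  note gc = green_chart[OF c \<psi>(1) f \<psi>(6) Kc(1) \<psi>(8)] and gd = green_chart[OF d \<psi>(1) f \<psi>(6) Kc(2) \<psi>(8)]
  \<comment> \<open>The gradient product is already known to be independent of the chart, so it
    drops out and only the difference of the two Laplacians is tested.\<close>
  have eq: "(\<psi> q * chart_laplace g c f q + mdot A g \<psi> f q) - (\<psi> q * chart_laplace g d f q + mdot A g \<psi> f q) = \<psi> q * ?\<delta> q" for q
    by (simp add: algebra_simps)
  have "integrable vol (\<lambda>q. \<psi> q * ?\<delta> q)" "(\<integral>q. \<psi> q * ?\<delta> q \<partial>vol) = 0"
    using Bochner_Integration.integrable_diff[OF gc(1) gd(1)] Bochner_Integration.integral_diff[OF gc(1) gd(1)] gc(2) gd(2)
    unfolding eq by auto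
  moreover have nn: "0 \<le> \<psi> q * ?\<delta> q" for q
  proof (cases "q \<in> K")
    case True
    then have "0 < ?\<delta> q" using \<psi>(7) by auto
    then show ?thesis using \<psi>(2)[of q] by simp
  qed (simp add: \<psi>(8))
  ultimately have "AE q in vol. \<psi> q * ?\<delta> q = 0"
    using integral_nonneg_eq_0_iff_AE by blast
  then have "AE q in vol. q \<notin> V \<inter> ?W"
    by eventually_elim (auto simp: \<psi>(5))
  then have "V \<inter> ?W \<in> null_sets vol"
    using \<psi>(3) oW by (subst AE_iff_null_sets) auto
  then have "emeasure vol (V \<inter> ?W) = 0" by auto
  moreover have "emeasure vol (V \<inter> ?W) > 0"
    by (rule vol_open_pos[of _ p]) (use \<psi>(3,4) oW \<open>p \<in> ?W\<close> in auto)
  ultimately show False by simp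
qed

text \<open>From here on the chart can be kept fixed while the point varies, so the Laplacian can be
  treated as a function that is continuous or differentiable.\<close>

lemma laplace_beltrami_chart:
  assumes "Ck_fun A 2 f" "c \<in> A" "p \<in> dom_chart c"
  shows "laplace_beltrami A g f p = chart_laplace g c f p"
  using chart_laplace_change_le[OF chart_at(1) assms(2,1) chart_at(2) assms(3)]
    chart_laplace_change_le[OF assms(2) chart_at(1) assms(1,3) chart_at(2)]
  by (simp add: laplace_beltrami_def Let_def chart_laplace_def)

lemma laplace_beltrami_rep:
  assumes "Ck_fun A 2 f" "c \<in> A" "x \<in> img_chart c"
  shows "(laplace_beltrami A g f \<circ> inv_chart c) x = laplace_coeff (g c) (f \<circ> inv_chart c) x"
  using laplace_beltrami_chart[OF assms(1,2) inv_chart_in[OF assms(2,3)]] map_inv_chart[OF assms(2,3)]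
  by (simp add: chart_laplace_def)

lemma Ck_fun_laplace:
  assumes f: "Ck_fun A (Suc (Suc k)) f"
  shows "Ck_fun A k (laplace_beltrami A g f)"
  unfolding Ck_fun_def
proof
  fix c assume c: "c \<in> A"
  interpret C: local_metric "img_chart c" "g c" by (rule local_metric_chart[OF c])
  have f2: "Ck_fun A 2 f" by (rule Ck_fun_mono[OF f]) simp
  have "Ck_on (img_chart c) (laplace_coeff (g c) (f \<circ> inv_chart c)) k"
    by (rule C.Ck_laplace) (use f c in \<open>simp only: Ck_fun_def\<close>)
  then show "Ck_on (img_chart c) (laplace_beltrami A g f \<circ> inv_chart c) k"
    by (rule Ck_on_cong_imp[OF open_img[OF c] laplace_beltrami_rep[OF f2 c, symmetric], rotated -1])
qed

section \<open>Green's identity for arbitrary compact supports\<close>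

lemma mdot_add:
  assumes "Ck_fun A 1 a1" "Ck_fun A 1 a2"
  shows "mdot A g (\<lambda>p. a1 p + a2 p) b p = mdot A g a1 b p + mdot A g a2 b p"
proof -
  let ?c = "chart_at A p"
  have "(\<lambda>p. a1 p + a2 p) \<circ> inv_chart ?c = (\<lambda>x. (a1 \<circ> inv_chart ?c) x + (a2 \<circ> inv_chart ?c) x)" by auto
  then have "pder i ((\<lambda>p. a1 p + a2 p) \<circ> inv_chart ?c) (map_chart ?c p) =
      pder i (a1 \<circ> inv_chart ?c) (map_chart ?c p) + pder i (a2 \<circ> inv_chart ?c) (map_chart ?c p)" for i
    by (simp only: pder_add[OF Ck_fun_differentiable[OF assms(1) order_refl chart_at] Ck_fun_differentiable[OF assms(2) order_refl chart_at]])
  then show ?thesis by (simp add: mdot_def Let_def gdot_def sum.distrib distrib_left distrib_right)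
qed

text \<open>Instead of a partition of unity, one bump \<psi> is peeled off at a time: a = \<psi> a +
  (1 - \<psi>) a. The first summand is supported in one chart. The second vanishes where \<psi> = 1,
  so what is left of \<open>K\<close> is covered by one set fewer.\<close>

theorem green:
  assumes a: "Ck_fun A 1 a" and b: "Ck_fun A 2 b" and K: "compact K" "\<And>p. p \<notin> K \<Longrightarrow> a p = 0"
  shows "integrable vol (\<lambda>p. a p * laplace_beltrami A g b p + mdot A g a b p)"
    "(\<integral>p. a p * laplace_beltrami A g b p + mdot A g a b p \<partial>vol) = 0"
proof -
  define I where "I a \<longleftrightarrow> integrable vol (\<lambda>p. a p * laplace_beltrami A g b p + mdot A g a b p) \<and>
    (\<integral>p. a p * laplace_beltrami A g b p + mdot A g a b p \<partial>vol) = 0" for a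
  have b1: "Ck_fun A 1 b" by (rule Ck_fun_mono[OF b]) simp
  have add: "I (\<lambda>p. a1 p + a2 p)" if "I a1" "I a2" "Ck_fun A 1 a1" "Ck_fun A 1 a2" for a1 a2
  proof -
    have eq: "(a1 p + a2 p) * laplace_beltrami A g b p + mdot A g (\<lambda>p. a1 p + a2 p) b p =
      (a1 p * laplace_beltrami A g b p + mdot A g a1 b p) + (a2 p * laplace_beltrami A g b p + mdot A g a2 b p)" for p
      unfolding mdot_add[OF that(3,4)] by (simp add: algebra_simps)
    show ?thesis
      using that(1,2) unfolding I_def eq by (simp add: Bochner_Integration.integral_add)
  qed
  have chart: "I a" if "c \<in> A" "Ck_fun A 1 a" "compact K" "K \<subseteq> dom_chart c" "\<And>p. p \<notin> K \<Longrightarrow> a p = 0" for a c K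
  proof -
    have "a p * laplace_beltrami A g b p = a p * chart_laplace g c b p" for p
      using laplace_beltrami_chart[OF b that(1)] that(4,5) by (cases "p \<in> K") auto
    then show ?thesis unfolding I_def using green_chart[OF that(1,2) b that(3-5)] by (simp only: simp_thms)
  qed
  have "\<exists>\<psi> V L c. c \<in> A \<and> Ck_fun A 1 \<psi> \<and> open V \<and> p \<in> V \<and> (\<forall>q\<in>V. \<psi> q = 1) \<and> compact L \<and> L \<subseteq> dom_chart c \<and>
      (\<forall>q. q \<notin> L \<longrightarrow> \<psi> q = 0)" for p
    using bump_exists[of UNIV p] by (metis open_UNIV UNIV_I)
  then obtain \<psi> V L c where \<psi>: "\<And>p. c p \<in> A" "\<And>p. Ck_fun A 1 (\<psi> p)" "\<And>p. open (V p)" "\<And>p. p \<in> V p"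
    "\<And>p q. q \<in> V p \<Longrightarrow> \<psi> p q = 1" "\<And>p. compact (L p)" "\<And>p. L p \<subseteq> dom_chart (c p)" "\<And>p q. q \<notin> L p \<Longrightarrow> \<psi> p q = 0"
    by metis
  have "I a" if "finite F" "Ck_fun A 1 a" "compact K" "\<And>p. p \<notin> K \<Longrightarrow> a p = 0" "K \<subseteq> (\<Union>p\<in>F. V p)" for F a K
    using that
  proof (induction F arbitrary: a K rule: finite_induct)
    case empty
    then have "a = (\<lambda>p. 0)" by auto
    then show ?case
      using chart[OF chart_at(1), of a "{}"] Ck_fun_const[of A 1 0] by auto
  next
    case (insert s F)
    let ?a1 = "\<lambda>p. \<psi> s p * a p" and ?a2 = "\<lambda>p. (1 - \<psi> s p) * a p"
    have C1: "Ck_fun A 1 ?a1" by (rule Ck_fun_mult[OF smooth_manifold_axioms \<psi>(2) insert.prems(1)])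
    have C2: "Ck_fun A 1 ?a2"
      by (rule Ck_fun_mult[OF smooth_manifold_axioms Ck_fun_diff[OF smooth_manifold_axioms Ck_fun_const \<psi>(2)] insert.prems(1)])
    have "I ?a1"
      by (rule chart[OF \<psi>(1) C1 \<psi>(6)[of s] \<psi>(7)[of s]]) (simp add: \<psi>(8))
    moreover have "I ?a2"
    proof (rule insert.IH[OF C2, of "K - V s"])
      show "compact (K - V s)" by (rule compact_diff[OF insert.prems(2) \<psi>(3)])
      show "?a2 p = 0" if "p \<notin> K - V s" for p
        using that insert.prems(3)[of p] \<psi>(5)[of p s] by auto
      show "K - V s \<subseteq> (\<Union>p\<in>F. V p)" using insert.prems(4) by auto
    qed
    ultimately have "I (\<lambda>p. ?a1 p + ?a2 p)" by (rule add[OF _ _ C1 C2])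
    moreover have "(\<lambda>p. ?a1 p + ?a2 p) = a" by (auto simp: algebra_simps)
    ultimately show ?case by simp
  qed
  moreover obtain F where "finite F" "K \<subseteq> (\<Union>p\<in>F. V p)"
    using compactE_image[OF K(1), of UNIV V] \<psi>(3,4) by (metis UNIV_I UN_I subsetI)
  ultimately have "I a" using a K by blast
  then show "integrable vol (\<lambda>p. a p * laplace_beltrami A g b p + mdot A g a b p)"
    "(\<integral>p. a p * laplace_beltrami A g b p + mdot A g a b p \<partial>vol) = 0"
    unfolding I_def by auto
qed

end

section \<open>Gradient terms\<close>

lemma laplace_coeff_cong:
  assumes "local_metric S G" "x \<in> S" "Ck_on S f 2" "\<And>y. y \<in> S \<Longrightarrow> f y = f' y"
  shows "laplace_coeff G f x = laplace_coeff G f' x"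
proof -
  interpret local_metric S G by fact
  have f': "Ck_on S f' 2" by (rule Ck_on_cong_imp[OF open_S assms(4,3)])
  have 1: "pder j f y = pder j f' y" if "y \<in> S" for j y
    using pder_cong[OF open_S that Ck_on_differentiable[OF assms(3) _ that] assms(4)] by simp
  have "Ck_on S (pder j f) 1" for j using Ck_on_pder[of S f 1 j] assms(3) by (simp add: numeral_2_eq_2)
  from Ck_on_differentiable[OF this order_refl assms(2)]
  have 2: "pder i (pder j f) x = pder i (pder j f') x" for i j
    by (rule pder_cong[OF open_S assms(2) _ 1])
  show ?thesis
    unfolding laplace_trace[OF assms(2,3)] laplace_trace[OF assms(2) f'] hessian_coeff_def 1[OF assms(2)] 2 ..
qed

text \<open>The discriminant criterion. For z = 0 the expression is affine in t, and a nonzero slope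
  would let it reach -1; otherwise it is evaluated at its minimum t = - y / z.\<close>

lemma quadratic_nonneg_imp:
  fixes x y z :: real
  assumes nn: "\<And>t. x + 2 * t * y + t\<^sup>2 * z \<ge> 0" and z: "z \<ge> 0"
  shows "y\<^sup>2 \<le> x * z"
proof (cases "z = 0")
  case True
  have "y = 0"
  proof (rule ccontr)
    assume "y \<noteq> 0"
    then have "2 * (- (x + 1) / (2 * y)) * y = - (x + 1)" by simp
    then show False using nn[of "- (x + 1) / (2 * y)"] True by simp
  qed
  then show ?thesis using True by simp
next
  case False
  then have "0 \<le> (x + 2 * (- y / z) * y + (- y / z)\<^sup>2 * z) * z"
    using nn[of "- y / z"] z by (intro mult_nonneg_nonneg) auto
  also have "\<dots> = x * z - y\<^sup>2" using False by (simp add: field_simps power2_eq_square)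
  finally show ?thesis by simp
qed

lemma (in local_metric) ginv_cauchy_schwarz:
  assumes x: "x \<in> S"
  shows "(\<Sum>i\<in>UNIV. \<Sum>j\<in>UNIV. ginv G i j x * a i * b j)\<^sup>2 \<le>
    (\<Sum>i\<in>UNIV. \<Sum>j\<in>UNIV. ginv G i j x * a i * a j) * (\<Sum>i\<in>UNIV. \<Sum>j\<in>UNIV. ginv G i j x * b i * b j)"
proof (rule quadratic_nonneg_imp)
  have psd: "0 \<le> (\<Sum>i\<in>UNIV. \<Sum>j\<in>UNIV. ginv G i j x * c i * c j)" for c
    using pos_semidef_ginv[OF x] unfolding pos_semidef_on_def by blast
  show "0 \<le> (\<Sum>i\<in>UNIV. \<Sum>j\<in>UNIV. ginv G i j x * b i * b j)" by (rule psd)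
  fix t
  have "(\<Sum>i\<in>UNIV. \<Sum>j\<in>UNIV. ginv G i j x * b i * a j) = (\<Sum>i\<in>UNIV. \<Sum>j\<in>UNIV. ginv G i j x * a i * b j)"
    by (subst sum.swap) (simp add: ginv_sym[OF x] mult_ac)
  moreover have "(\<Sum>i\<in>UNIV. \<Sum>j\<in>UNIV. ginv G i j x * (a i + t * b i) * (a j + t * b j)) =
      (\<Sum>i\<in>UNIV. \<Sum>j\<in>UNIV. ginv G i j x * a i * a j) + t * (\<Sum>i\<in>UNIV. \<Sum>j\<in>UNIV. ginv G i j x * a i * b j)
      + t * (\<Sum>i\<in>UNIV. \<Sum>j\<in>UNIV. ginv G i j x * b i * a j) + t\<^sup>2 * (\<Sum>i\<in>UNIV. \<Sum>j\<in>UNIV. ginv G i j x * b i * b j)"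
    by (simp add: sum_distrib_left sum.distrib[symmetric] algebra_simps power2_eq_square)
  ultimately show "0 \<le> (\<Sum>i\<in>UNIV. \<Sum>j\<in>UNIV. ginv G i j x * a i * a j) + 2 * t * (\<Sum>i\<in>UNIV. \<Sum>j\<in>UNIV. ginv G i j x * a i * b j)
      + t\<^sup>2 * (\<Sum>i\<in>UNIV. \<Sum>j\<in>UNIV. ginv G i j x * b i * b j)"
    using psd[of "\<lambda>i. a i + t * b i"] by simp
qed

text \<open>What results from applying the Cauchy-Schwarz inequality to each partial derivative of
  |\<nabla>f|^2 separately and adding absolute values. The expression depends on the
  coordinates.\<close>

definition (in local_metric) hess_bound :: "(real ^ 'n \<Rightarrow> real) \<Rightarrow> real ^ 'n \<Rightarrow> real" where
  "hess_bound f x = (\<Sum>k\<in>UNIV. \<Sum>l\<in>UNIV. \<bar>ginv G k l x\<bar> *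
    sqrt (\<Sum>i\<in>UNIV. \<Sum>j\<in>UNIV. ginv G i j x * hessian_coeff G f k i x * hessian_coeff G f k j x) *
    sqrt (\<Sum>i\<in>UNIV. \<Sum>j\<in>UNIV. ginv G i j x * hessian_coeff G f l i x * hessian_coeff G f l j x))"

text \<open>A crude form of Kato's inequality: unlike the sharp factor \<open>|H\<^sub>f|\<^sup>2\<close>, the factor \<open>hess_bound f\<close> is
  used in one fixed chart, so that its continuity yields local bounds.\<close>

lemma (in local_metric) gdot_gdot_self_le:
  assumes x: "x \<in> S" and f: "Ck_on S f 2"
  shows "gdot G (gdot G f f) (gdot G f f) x \<le> 4 * hess_bound f x * gdot G f f x"
proof -
  let ?B = "\<lambda>k. \<Sum>i\<in>UNIV. \<Sum>j\<in>UNIV. ginv G i j x * hessian_coeff G f k i x * hessian_coeff G f k j x"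
  let ?w = "gdot G f f x" and ?dw = "\<lambda>k. pder k (gdot G f f) x"
  have dw: "?dw k = 2 * (\<Sum>i\<in>UNIV. \<Sum>j\<in>UNIV. ginv G i j x * hessian_coeff G f k i x * pder j f x)" for k
    unfolding pder_gdot_self[OF x f] by (simp add: gradv_def sum_distrib_left mult_ac)
  have w0: "?w \<ge> 0"
    using spec[OF pos_semidef_ginv[OF x, unfolded pos_semidef_on_def], of "\<lambda>i. pder i f x"] by (simp add: gdot_def)
  define s where "s = sqrt ?w"
  have bd: "\<bar>?dw k\<bar> \<le> 2 * sqrt (?B k) * s" for k
  proof -
    let ?q = "\<Sum>i\<in>UNIV. \<Sum>j\<in>UNIV. ginv G i j x * hessian_coeff G f k i x * pder j f x"
    have "?q\<^sup>2 \<le> ?B k * ?w"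
      unfolding gdot_def by (rule ginv_cauchy_schwarz[OF x])
    then have "\<bar>?q\<bar> \<le> sqrt (?B k) * s"
      using real_sqrt_le_mono[of "?q\<^sup>2" "?B k * ?w"] by (simp add: real_sqrt_mult s_def)
    then show ?thesis unfolding dw by simp
  qed
  have nn: "0 \<le> 2 * sqrt (?B k) * s" for k using bd[of k] by linarith
  have "gdot G (gdot G f f) (gdot G f f) x \<le> (\<Sum>k\<in>UNIV. \<Sum>l\<in>UNIV. \<bar>ginv G k l x\<bar> * (2 * sqrt (?B k) * s) * (2 * sqrt (?B l) * s))"
    unfolding gdot_def[of G "gdot G f f" "gdot G f f"]
  proof (intro sum_mono)
    fix k l
    have "ginv G k l x * ?dw k * ?dw l \<le> \<bar>ginv G k l x\<bar> * \<bar>?dw k\<bar> * \<bar>?dw l\<bar>"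
      by (metis abs_ge_self abs_mult)
    also have "\<dots> \<le> \<bar>ginv G k l x\<bar> * (2 * sqrt (?B k) * s) * (2 * sqrt (?B l) * s)"
      by (intro mult_mono mult_nonneg_nonneg[OF abs_ge_zero] nn bd order_refl abs_ge_zero)
    finally show "ginv G k l x * ?dw k * ?dw l \<le> \<bar>ginv G k l x\<bar> * (2 * sqrt (?B k) * s) * (2 * sqrt (?B l) * s)" .
  qed
  also have "\<dots> = 4 * hess_bound f x * (s * s)"
    by (simp add: hess_bound_def sum_distrib_left sum_distrib_right mult_ac)
  finally show ?thesis using w0 by (simp add: s_def)
qed

lemma (in local_metric) continuous_hess_bound:
  assumes "Ck_on S f 2"
  shows "continuous_on S (hess_bound f)"
proof -
  have "continuous_on S (hessian_coeff G f i j)" for i j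
    using Ck_on_continuous_on[OF Ck_hessian[of f 0]] assms by (simp add: numeral_2_eq_2 del: Ck_on.simps)
  moreover have "continuous_on S (ginv G i j)" for i j by (rule Ck_on_continuous_on[OF Ck_ginv])
  ultimately show ?thesis unfolding hess_bound_def by (intro continuous_intros)
qed

section \<open>Algebra of gradient products on the manifold\<close>

context riemannian_manifold
begin

lemma ginner_nonneg: "ginner A g p v v \<ge> 0"
proof (cases "v = 0")
  case False
  then show ?thesis
    using metric_pos_def[OF chart_at(1), of "map_chart (chart_at A p) p" p v] chart_at(2) by (simp add: ginner_def Let_def less_imp_le)
qed (simp add: ginner_def Let_def)

lemma gnorm_sq: "(gnorm A g p v)\<^sup>2 = ginner A g p v v"
  unfolding gnorm_def using ginner_nonneg by simp

lemma mdot_nonneg: "Ck_fun A 1 f \<Longrightarrow> mdot A g f f p \<ge> 0"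
  using ginner_nonneg[of p "grad A g f p"] ginner_grad[of f f p] by simp

lemma gnorm_grad: "Ck_fun A 1 f \<Longrightarrow> gnorm A g p (grad A g f p) = sqrt (mdot A g f f p)"
  by (simp add: gnorm_def ginner_grad)

lemma mdot_sym:
  shows "mdot A g f1 f2 p = mdot A g f2 f1 p"
proof -
  let ?c = "chart_at A p"
  interpret C: local_metric "img_chart ?c" "g ?c" by (rule local_metric_chart[OF chart_at(1)])
  have "map_chart ?c p \<in> img_chart ?c" using chart_at(2) by auto
  note s = C.ginv_sym[OF this]
  show ?thesis
    unfolding mdot_def Let_def gdot_def by (subst sum.swap) (simp add: s mult_ac)
qed

lemma mdot_mult:
  assumes "Ck_fun A 1 a1" "Ck_fun A 1 a2"
  shows "mdot A g (\<lambda>p. a1 p * a2 p) b p = a1 p * mdot A g a2 b p + a2 p * mdot A g a1 b p"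
proof -
  let ?c = "chart_at A p"
  have e: "(\<lambda>p. a1 p * a2 p) \<circ> inv_chart ?c = (\<lambda>x. (a1 \<circ> inv_chart ?c) x * (a2 \<circ> inv_chart ?c) x)" by auto
  have "pder i ((\<lambda>p. a1 p * a2 p) \<circ> inv_chart ?c) (map_chart ?c p) =
      a2 p * pder i (a1 \<circ> inv_chart ?c) (map_chart ?c p) + a1 p * pder i (a2 \<circ> inv_chart ?c) (map_chart ?c p)" for i
    unfolding e by (subst pder_mult[OF Ck_fun_differentiable[OF assms(1) order_refl chart_at] Ck_fun_differentiable[OF assms(2) order_refl chart_at]])
      (simp add: inv_map_chart[OF chart_at])
  then show ?thesis
    by (simp add: mdot_def Let_def gdot_def sum.distrib distrib_left distrib_right sum_distrib_left mult_ac)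
qed

lemma mdot_divide:
  assumes "Ck_fun A 1 a1" "Ck_fun A 1 a2" "a2 p \<noteq> 0"
  shows "mdot A g (\<lambda>p. a1 p / a2 p) b p = mdot A g a1 b p / a2 p - a1 p * mdot A g a2 b p / (a2 p)\<^sup>2"
proof -
  let ?c = "chart_at A p"
  have e: "(\<lambda>p. a1 p / a2 p) \<circ> inv_chart ?c = (\<lambda>x. (a1 \<circ> inv_chart ?c) x / (a2 \<circ> inv_chart ?c) x)" by auto
  have "pder i ((\<lambda>p. a1 p / a2 p) \<circ> inv_chart ?c) (map_chart ?c p) =
      1 / a2 p * pder i (a1 \<circ> inv_chart ?c) (map_chart ?c p) - a1 p / (a2 p)\<^sup>2 * pder i (a2 \<circ> inv_chart ?c) (map_chart ?c p)" for i
    unfolding e using assms(3)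
    by (subst pder_divide[OF Ck_fun_differentiable[OF assms(1) order_refl chart_at] Ck_fun_differentiable[OF assms(2) order_refl chart_at]])
      (simp_all add: inv_map_chart[OF chart_at] field_simps power2_eq_square)
  then have "mdot A g (\<lambda>p. a1 p / a2 p) b p = 1 / a2 p * mdot A g a1 b p - a1 p / (a2 p)\<^sup>2 * mdot A g a2 b p"
    by (simp add: mdot_def Let_def gdot_def sum_subtractf left_diff_distrib right_diff_distrib sum_distrib_left mult_ac
        del: times_divide_eq_left times_divide_eq_right)
  then show ?thesis by simp
qed

text \<open>The square of |\<alpha> \<nabla>f1 + \<beta> \<nabla>f2 + \<gamma> \<nabla>f3| at
  \<open>p\<close>, expanded. The coefficients are mere numbers, so they may stand for values of
  functions that are not differentiable.\<close>

lemma mdot_quadratic: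
  "0 \<le> \<alpha>\<^sup>2 * mdot A g f1 f1 p + \<beta>\<^sup>2 * mdot A g f2 f2 p + \<gamma>\<^sup>2 * mdot A g f3 f3 p
    + 2 * \<alpha> * \<beta> * mdot A g f1 f2 p + 2 * \<alpha> * \<gamma> * mdot A g f1 f3 p + 2 * \<beta> * \<gamma> * mdot A g f2 f3 p"
proof -
  let ?c = "chart_at A p"
  interpret C: local_metric "img_chart ?c" "g ?c" by (rule local_metric_chart[OF chart_at(1)])
  let ?x = "map_chart ?c p"
  have x: "?x \<in> img_chart ?c" using chart_at(2) by auto
  let ?d = "\<lambda>f i. pder i (f \<circ> inv_chart ?c) ?x"
  let ?v = "\<lambda>i. \<alpha> * ?d f1 i + \<beta> * ?d f2 i + \<gamma> * ?d f3 i"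
  have "0 \<le> (\<Sum>i\<in>UNIV. \<Sum>j\<in>UNIV. ginv (g ?c) i j ?x * ?v i * ?v j)"
    using C.pos_semidef_ginv[OF x] unfolding pos_semidef_on_def by (rule allE)
  also have "\<dots> = \<alpha>\<^sup>2 * mdot A g f1 f1 p + \<beta>\<^sup>2 * mdot A g f2 f2 p + \<gamma>\<^sup>2 * mdot A g f3 f3 p
    + \<alpha> * \<beta> * mdot A g f1 f2 p + \<alpha> * \<beta> * mdot A g f2 f1 p + \<alpha> * \<gamma> * mdot A g f1 f3 p + \<alpha> * \<gamma> * mdot A g f3 f1 p
    + \<beta> * \<gamma> * mdot A g f2 f3 p + \<beta> * \<gamma> * mdot A g f3 f2 p"
    unfolding mdot_def Let_def gdot_def sum_distrib_left sum.distrib[symmetric]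
    by (intro sum.cong refl) (simp add: algebra_simps power2_eq_square)
  finally show ?thesis
    unfolding mdot_sym[of f2 f1] mdot_sym[of f3 f1] mdot_sym[of f3 f2] by simp
qed

section \<open>Bochner's formula and the gradient of |\<nabla>u|\<close>

theorem bochner_manifold:
  assumes f: "Ck_fun A 3 f"
  shows "ricci A g p (grad A g f p) (grad A g f p) + (hessian_norm A g f p)\<^sup>2 =
    1 / 2 * laplace_beltrami A g (mdot A g f f) p - mdot A g f (laplace_beltrami A g f) p"
proof -
  let ?c = "chart_at A p"
  have c: "?c \<in> A" "p \<in> dom_chart ?c" by (rule chart_at)+
  interpret C: local_metric "img_chart ?c" "g ?c" by (rule local_metric_chart[OF c(1)])
  let ?x = "map_chart ?c p" and ?f = "f \<circ> inv_chart ?c"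
  have x: "?x \<in> img_chart ?c" using c(2) by auto
  have f3: "Ck_on (img_chart ?c) ?f 3" using f c unfolding Ck_fun_def by blast
  have f1: "Ck_fun A 1 f" and f2: "Ck_fun A 2 f" by (rule Ck_fun_mono[OF f], simp)+
  have df: "?f differentiable (at ?x)" by (rule Ck_on_differentiable[OF f3 _ x]) simp
  have v: "grad A g f p $ i = C.gradv ?f i ?x" for i
    using df by (simp add: grad_def Let_def grad_coeff_def C.gradv_def ginv_def matrix_vector_mult_def)
  have 1: "laplace_beltrami A g (mdot A g f f) p = laplace_coeff (g ?c) (gdot (g ?c) ?f ?f) ?x"
    unfolding laplace_beltrami_def Let_def
  proof (rule laplace_coeff_cong[OF C.local_metric_axioms x])
    have "Ck_fun A 2 (mdot A g f f)"
      using Ck_fun_mdot[of 2 f f] f by (simp add: numeral_3_eq_3 numeral_2_eq_2)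
    then show "Ck_on (img_chart ?c) (mdot A g f f \<circ> inv_chart ?c) 2" using c unfolding Ck_fun_def by blast
  qed (rule mdot_rep[OF f1 f1 c(1)])
  \<comment> \<open>The Laplacian is differentiated here, so its expression in the chart at
    \<open>p\<close> must be valid on a whole neighbourhood; this is where chart independence
    enters.\<close>
  have 2: "mdot A g f (laplace_beltrami A g f) p = gdot (g ?c) ?f (laplace_coeff (g ?c) ?f) ?x"
  proof -
    have "Ck_fun A 1 (laplace_beltrami A g f)"
      using Ck_fun_laplace[of 1 f] f by (simp add: numeral_3_eq_3)
    then have "(laplace_beltrami A g f \<circ> inv_chart ?c) differentiable (at ?x)"
      by (rule Ck_fun_differentiable[OF _ order_refl c])
    then have "pder i (laplace_beltrami A g f \<circ> inv_chart ?c) ?x = pder i (laplace_coeff (g ?c) ?f) ?x" for i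
      by (rule pder_cong[OF open_img[OF c(1)] x]) (rule laplace_beltrami_rep[OF f2 c(1)])
    then show ?thesis by (simp add: mdot_def Let_def gdot_def)
  qed
  show ?thesis
    using C.bochner[OF x f3] unfolding 1 2 ricci_def hessian_norm_def Let_def v by linarith
qed

text \<open>At a zero of \<open>w\<close> the function \<open>sqrt w\<close> has a minimum, so its gradient vanishes there, by
  convention also if \<open>sqrt w\<close> is not differentiable.\<close>

lemma gnorm_grad_sqrt:
  assumes w: "Ck_fun A 1 w" "\<And>p. w p \<ge> 0"
  shows "(gnorm A g p (grad A g (\<lambda>q. sqrt (w q)) p))\<^sup>2 = (if w p = 0 then 0 else mdot A g w w p / (4 * w p))"
proof -
  let ?c = "chart_at A p"
  have c: "?c \<in> A" "p \<in> dom_chart ?c" by (rule chart_at)+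
  interpret C: local_metric "img_chart ?c" "g ?c" by (rule local_metric_chart[OF c(1)])
  let ?x = "map_chart ?c p" and ?w = "w \<circ> inv_chart ?c" and ?s = "(\<lambda>q. sqrt (w q)) \<circ> inv_chart ?c"
  have x: "?x \<in> img_chart ?c" using c(2) by auto
  have wx: "?w ?x = w p" using inv_map_chart[OF c] by simp
  have dw: "?w differentiable (at ?x)" by (rule Ck_fun_differentiable[OF w(1) order_refl c])
  have s: "?s = (\<lambda>y. sqrt (?w y))" by auto
  have gen: "(gnorm A g p (grad A g (\<lambda>q. sqrt (w q)) p))\<^sup>2 = gdot (g ?c) ?s ?s ?x" if d: "?s differentiable (at ?x)"
  proof -
    let ?b = "\<chi> j. pder j ?s ?x"
    have "g ?c ?x *v (matrix_inv (g ?c ?x) *v ?b) = ?b"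
      by (simp add: matrix_vector_mul_assoc matrix_inv_works[OF C.invertible_G[OF x]])
    then have "ginner A g p (grad A g (\<lambda>q. sqrt (w q)) p) (grad A g (\<lambda>q. sqrt (w q)) p) =
        (matrix_inv (g ?c ?x) *v ?b) \<bullet> ?b"
      using d by (simp add: ginner_def grad_def grad_coeff_def Let_def)
    also have "\<dots> = gdot (g ?c) ?s ?s ?x"
      by (simp add: inner_vec_def matrix_vector_mult_def ginv_def gdot_def sum_distrib_left mult_ac)
    finally show ?thesis by (simp add: gnorm_sq)
  qed
  show ?thesis
  proof (cases "w p = 0")
    case True
    show ?thesis
    proof (cases "?s differentiable (at ?x)")
      case d: True
      have "pder i ?s ?x = 0" for i
        by (rule pder_local_min[OF d open_img[OF c(1)] x]) (use wx True w(2) in auto)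
      then show ?thesis using gen[OF d] True by (simp add: gdot_def)
    next
      case False
      then have "grad A g (\<lambda>q. sqrt (w q)) p = 0" by (simp add: grad_def Let_def grad_coeff_def)
      then show ?thesis using True by (simp add: gnorm_def ginner_def Let_def)
    qed
  next
    case False
    then have pos: "?w ?x > 0" using w(2)[of p] wx by simp
    have d: "?s differentiable (at ?x)"
      unfolding s using has_derivative_real_sqrt[OF pos has_derivative_frechet[OF dw]] by (auto simp: differentiable_def)
    have "pder i ?s ?x = pder i ?w ?x / (2 * sqrt (w p))" for i
      by (simp only: s wx pder_sqrt[OF dw pos])
    then have "gdot (g ?c) ?s ?s ?x = (\<Sum>i\<in>UNIV. \<Sum>j\<in>UNIV. ginv (g ?c) i j ?x * pder i ?w ?x * pder j ?w ?x / (4 * w p))"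
      using w(2)[of p] by (simp add: gdot_def)
    also have "\<dots> = mdot A g w w p / (4 * w p)"
      by (simp add: mdot_def Let_def gdot_def sum_divide_distrib)
    finally show ?thesis using gen[OF d] False by simp
  qed
qed

text \<open>The purpose is a local bound for |\<nabla>w|^2 / (4 w) with w = |\<nabla>f|^2 that
  persists up to the zeros of w.\<close>

lemma mdot_self_locally_bounded:
  assumes f: "Ck_fun A 3 f"
  shows "\<exists>W b. open W \<and> p \<in> W \<and> (\<forall>q\<in>W. mdot A g (mdot A g f f) (mdot A g f f) q \<le> b * mdot A g f f q)"
proof -
  let ?c = "chart_at A p"
  have c: "?c \<in> A" "p \<in> dom_chart ?c" by (rule chart_at)+
  interpret C: local_metric "img_chart ?c" "g ?c" by (rule local_metric_chart[OF c(1)])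
  let ?f = "f \<circ> inv_chart ?c" and ?w = "mdot A g f f"
  have f1: "Ck_fun A 1 f" and f2: "Ck_fun A 2 f" by (rule Ck_fun_mono[OF f], simp)+
  have w2: "Ck_fun A 2 ?w" using Ck_fun_mdot[of 2 f f] f by (simp add: numeral_3_eq_3 numeral_2_eq_2)
  have w1: "Ck_fun A 1 ?w" by (rule Ck_fun_mono[OF w2]) simp
  have f2': "Ck_on (img_chart ?c) ?f 2" using f2 c unfolding Ck_fun_def by blast
  have le: "mdot A g ?w ?w q \<le> 4 * C.hess_bound ?f (map_chart ?c q) * ?w q" if q: "q \<in> dom_chart ?c" for q
  proof -
    let ?y = "map_chart ?c q"
    have y: "?y \<in> img_chart ?c" using q by auto
    have "pder i (?w \<circ> inv_chart ?c) ?y = pder i (gdot (g ?c) ?f ?f) ?y" for i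
      by (rule pder_cong[OF open_img[OF c(1)] y Ck_fun_differentiable[OF w1 order_refl c(1) q]]) (rule mdot_rep[OF f1 f1 c(1)])
    then have "mdot A g ?w ?w q = gdot (g ?c) (gdot (g ?c) ?f ?f) (gdot (g ?c) ?f ?f) ?y"
      by (simp add: mdot_eq[OF w1 w1 c(1) q] gdot_def[of _ "_ \<circ> _"] gdot_def[of _ "gdot _ _ _"])
    also have "\<dots> \<le> 4 * C.hess_bound ?f ?y * gdot (g ?c) ?f ?f ?y" by (rule C.gdot_gdot_self_le[OF y f2'])
    finally show ?thesis by (simp add: mdot_eq[OF f1 f1 c(1) q])
  qed
  let ?b = "\<lambda>q. C.hess_bound ?f (map_chart ?c q)"
  have "continuous_on (dom_chart ?c) ?b"
    using continuous_on_compose2[OF C.continuous_hess_bound[OF f2'] continuous_map_chart[OF c(1)]] by blast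
  then have "\<forall>B. open B \<longrightarrow> open (?b -` B \<inter> dom_chart ?c)"
    by (simp only: continuous_on_open_vimage[OF open_dom[OF c(1)]])
  then have oW: "open (?b -` {..<?b p + 1} \<inter> dom_chart ?c)" by (rule allE[of _ "{..<?b p + 1}"]) simp
  show ?thesis
  proof (intro exI conjI ballI)
    show "p \<in> ?b -` {..<?b p + 1} \<inter> dom_chart ?c" using c(2) by simp
    fix q assume q: "q \<in> ?b -` {..<?b p + 1} \<inter> dom_chart ?c"
    then have "mdot A g ?w ?w q \<le> 4 * ?b q * ?w q" by (intro le) auto
    also have "\<dots> \<le> 4 * (?b p + 1) * ?w q"
      using q mdot_nonneg[OF f1, of q] by (intro mult_right_mono) auto
    finally show "mdot A g ?w ?w q \<le> 4 * (?b p + 1) * ?w q" .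
  qed (rule oW)
qed

text \<open>The chain rule for \<nabla>(h(u)). Applied to the right-hand side of the system, it
  produces the coupling coefficients \<open>dH H u i j p\<close>.\<close>

lemma mdot_compose:
  fixes u :: "'m::finite \<Rightarrow> 'a \<Rightarrow> real" and h :: "real ^ 'm \<Rightarrow> real"
  assumes h: "Ck_on UNIV h 1" and u: "\<And>k. Ck_fun A 1 (u k)"
  shows "mdot A g b (\<lambda>p. h (\<chi> k. u k p)) p = (\<Sum>j\<in>UNIV. pder j h (\<chi> k. u k p) * mdot A g b (u j) p)"
proof -
  let ?c = "chart_at A p"
  let ?x = "map_chart ?c p"
  define \<tau> where "\<tau> y = (\<chi> k. u k (inv_chart ?c y))" for y
  define \<tau>' where "\<tau>' v = (\<Sum>k\<in>UNIV. frechet_derivative (u k \<circ> inv_chart ?c) (at ?x) v *\<^sub>R axis k (1::real))" for v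
  have du: "(u k \<circ> inv_chart ?c) differentiable (at ?x)" for k by (rule Ck_fun_differentiable[OF u order_refl chart_at])
  have \<tau>_sum: "\<tau> = (\<lambda>y. \<Sum>k\<in>UNIV. (u k \<circ> inv_chart ?c) y *\<^sub>R axis k 1)"
    unfolding \<tau>_def by (auto simp: vec_eq_iff axis_def if_distrib cong: if_cong)
  have \<tau>: "(\<tau> has_derivative \<tau>') (at ?x)"
    unfolding \<tau>_sum \<tau>'_def by (intro has_derivative_sum has_derivative_scaleR_left has_derivative_frechet du)
  have \<tau>'k: "\<tau>' v $ k = frechet_derivative (u k \<circ> inv_chart ?c) (at ?x) v" for v k
    unfolding \<tau>'_def by (simp add: axis_def if_distrib cong: if_cong)
  have \<tau>x: "\<tau> ?x = (\<chi> k. u k p)" by (simp add: \<tau>_def inv_map_chart[OF chart_at])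
  have m: "matrix (frechet_derivative \<tau> (at ?x)) $ k $ i = pder i (u k \<circ> inv_chart ?c) ?x" for k i
    unfolding frechet_derivative_at[OF \<tau>, symmetric] by (simp add: matrix_def \<tau>'k pder_def)
  have e: "(\<lambda>p. h (\<chi> k. u k p)) \<circ> inv_chart ?c = h \<circ> \<tau>" by (auto simp: \<tau>_def)
  have "pder i ((\<lambda>p. h (\<chi> k. u k p)) \<circ> inv_chart ?c) ?x =
      (\<Sum>k\<in>UNIV. pder i (u k \<circ> inv_chart ?c) ?x * pder k h (\<chi> k. u k p))" for i
    unfolding e using pder_comp[of \<tau> ?x h i] h \<tau> by (auto simp: m \<tau>x differentiable_def)
  then have "mdot A g b (\<lambda>p. h (\<chi> k. u k p)) p = (\<Sum>i\<in>UNIV. \<Sum>j\<in>UNIV. \<Sum>k\<in>UNIV.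
     pder k h (\<chi> k. u k p) * (ginv (g ?c) i j ?x * pder i (b \<circ> inv_chart ?c) ?x * pder j (u k \<circ> inv_chart ?c) ?x))"
    by (simp add: mdot_def Let_def gdot_def sum_distrib_left mult_ac)
  also have "\<dots> = (\<Sum>k\<in>UNIV. \<Sum>i\<in>UNIV. \<Sum>j\<in>UNIV.
     pder k h (\<chi> k. u k p) * (ginv (g ?c) i j ?x * pder i (b \<circ> inv_chart ?c) ?x * pder j (u k \<circ> inv_chart ?c) ?x))"
    by (rule sum_swap3)
  finally show ?thesis by (simp add: mdot_def Let_def gdot_def sum_distrib_left)
qed

end

section \<open>The weighted Poincare inequality\<close>

text \<open>The off-diagonal coupling terms are symmetrised and estimated by the arithmetic-geometric mean
  inequality.\<close>

lemma coupling_le: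
  fixes d :: "'m::finite \<Rightarrow> 'm \<Rightarrow> real" and z x :: "'m \<Rightarrow> real"
  assumes pos: "\<And>i j. d i j * z i * z j > 0"
  shows "(\<Sum>i\<in>UNIV. d i i * (x i)\<^sup>2) + (\<Sum>i\<in>UNIV. \<Sum>j\<in>UNIV - {i}. sqrt (d i j * d j i) * x i * x j)
    \<le> (\<Sum>i\<in>UNIV. (x i)\<^sup>2 / z i * (\<Sum>j\<in>UNIV. d i j * z j))"
proof -
  have nz: "z i \<noteq> 0" for i using pos[of i i] by auto
  define t where "t i j = (x i)\<^sup>2 / z i * (d i j * z j)" for i j
  define s where "s i j = sqrt (d i j * d j i) * x i * x j" for i j
  have st: "2 * s i j \<le> t i j + t j i" for i j
  proof -
    \<comment> \<open>Division by \<open>z i\<close> has the same effect on the sign as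
      multiplication by it.\<close>
    have zz: "d i j * (z j / z i) \<ge> 0" for i j
    proof -
      have "d i j * (z j / z i) = (d i j * z i * z j) / (z i)\<^sup>2" using nz[of i] by (simp add: power2_eq_square)
      then show ?thesis using pos[of i j] by simp
    qed
    have t: "t i j = (x i)\<^sup>2 * (d i j * (z j / z i))" for i j by (simp add: t_def)
    have "t i j \<ge> 0" "t j i \<ge> 0" unfolding t by (intro mult_nonneg_nonneg zero_le_power2 zz)+
    \<comment> \<open>The factors \<open>z\<close> cancel between the two transposed terms, which is
      why the geometric mean involves only \<open>d\<close> and \<open>x\<close>.\<close>
    moreover have "t i j * t j i = d i j * d j i * (x i * x j)\<^sup>2"
      using nz[of i] nz[of j] by (simp add: t_def power2_eq_square)
    ultimately have "sqrt (d i j * d j i) * \<bar>x i * x j\<bar> \<le> (t i j + t j i) / 2"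
      using arith_geo_mean_sqrt[of "t i j" "t j i"] by (simp add: real_sqrt_mult)
    moreover have "sqrt (d i j * d j i) * (x i * x j) \<le> sqrt (d i j * d j i) * \<bar>x i * x j\<bar>"
    proof (rule mult_left_mono)
      have "0 \<le> (d i j * z i * z j) * (d j i * z j * z i)" using pos[of i j] pos[of j i] by simp
      also have "\<dots> = (d i j * d j i) * (z i * z j)\<^sup>2" by (simp add: power2_eq_square)
      finally have "0 \<le> d i j * d j i" using nz[of i] nz[of j] by (simp add: zero_le_mult_iff)
      then show "0 \<le> sqrt (d i j * d j i)" by simp
    qed simp
    ultimately show ?thesis by (simp add: s_def mult.assoc)
  qed
  have sym: "(\<Sum>i\<in>UNIV. \<Sum>j\<in>UNIV - {i}. f i j) = (\<Sum>i\<in>UNIV. \<Sum>j\<in>UNIV - {i}. f j i)" for f :: "'m \<Rightarrow> 'm \<Rightarrow> real"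
  proof -
    have "(\<Sum>i\<in>UNIV. \<Sum>j\<in>UNIV - {i}. f i j) = (\<Sum>i\<in>UNIV. \<Sum>j\<in>UNIV. if i = j then 0 else f i j)" for f :: "'m \<Rightarrow> 'm \<Rightarrow> real"
      by (intro sum.cong refl sum.mono_neutral_cong_left) auto
    note e = this
    show ?thesis unfolding e[of f] e[of "\<lambda>i j. f j i"] by (subst sum.swap) (simp add: eq_commute)
  qed
  have "2 * (\<Sum>i\<in>UNIV. \<Sum>j\<in>UNIV - {i}. s i j) \<le> (\<Sum>i\<in>UNIV. \<Sum>j\<in>UNIV - {i}. t i j + t j i)"
    unfolding sum_distrib_left by (intro sum_mono st)
  also have "\<dots> = 2 * (\<Sum>i\<in>UNIV. \<Sum>j\<in>UNIV - {i}. t i j)"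
    using sym[of t] by (simp add: sum.distrib)
  finally have "(\<Sum>i\<in>UNIV. \<Sum>j\<in>UNIV - {i}. s i j) \<le> (\<Sum>i\<in>UNIV. \<Sum>j\<in>UNIV - {i}. t i j)" by simp
  moreover have "t i i = d i i * (x i)\<^sup>2" for i using nz[of i] by (simp add: t_def)
  ultimately have "(\<Sum>i\<in>UNIV. d i i * (x i)\<^sup>2) + (\<Sum>i\<in>UNIV. \<Sum>j\<in>UNIV - {i}. s i j)
      \<le> (\<Sum>i\<in>UNIV. t i i + (\<Sum>j\<in>UNIV - {i}. t i j))"
    by (simp add: sum.distrib)
  also have "\<dots> = (\<Sum>i\<in>UNIV. \<Sum>j\<in>UNIV. t i j)"
  proof (intro sum.cong refl)
    fix i show "t i i + (\<Sum>j\<in>UNIV - {i}. t i j) = (\<Sum>j\<in>UNIV. t i j)" by (simp add: sum.remove[of UNIV i])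
  qed
  finally show ?thesis by (simp add: s_def t_def sum_distrib_left)
qed

context riemannian_manifold
begin

text \<open>Completing the square gives \<open>\<nabla>(w\<eta>\<^sup>2/\<zeta>) \<cdot> \<nabla>\<zeta> \<le> |\<nabla>(\<eta> sqrt w)|\<^sup>2\<close>; the right-hand side is expanded, since
  \<open>sqrt w\<close> need not be differentiable at the zeros of \<open>w\<close>.\<close>

lemma stability_square:
  assumes w: "Ck_fun A 1 w" "\<And>p. w p \<ge> 0" and e: "Ck_fun A 1 e" and z: "Ck_fun A 1 z" "\<And>p. z p \<noteq> 0"
  shows "mdot A g (\<lambda>p. (e p)\<^sup>2 * w p / z p) z p \<le> w p * mdot A g e e p + e p * mdot A g e w p
     + (gnorm A g p (grad A g (\<lambda>q. sqrt (w q)) p))\<^sup>2 * (e p)\<^sup>2"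
proof -
  have e2: "Ck_fun A 1 (\<lambda>p. (e p)\<^sup>2)" unfolding power2_eq_square by (rule Ck_fun_mult[OF smooth_manifold_axioms e e])
  have "mdot A g (\<lambda>p. (e p)\<^sup>2) z p = 2 * e p * mdot A g e z p"
    unfolding power2_eq_square by (simp add: mdot_mult[OF e e])
  then have m: "mdot A g (\<lambda>p. (e p)\<^sup>2 * w p / z p) z p =
      ((e p)\<^sup>2 * mdot A g w z p + 2 * w p * e p * mdot A g e z p) / z p - (e p)\<^sup>2 * w p * mdot A g z z p / (z p)\<^sup>2"
    by (simp add: mdot_divide[OF Ck_fun_mult[OF smooth_manifold_axioms e2 w(1)] z(1) z(2)] mdot_mult[OF e2 w(1)])
  show ?thesis
  proof (cases "w p = 0")
    case True
    \<comment> \<open>A zero of \<open>w\<close> is a minimum, so \<nabla>w = 0 there. Then the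
      left-hand side vanishes and the right-hand side reduces to a square.\<close>
    have "pder i (w \<circ> inv_chart (chart_at A p)) (map_chart (chart_at A p) p) = 0" for i
      by (rule pder_local_min[OF Ck_fun_differentiable[OF w(1) order_refl chart_at] open_img[OF chart_at(1)]])
        (use chart_at inv_map_chart[OF chart_at] True w(2) in auto)
    then have "mdot A g w z p = 0" "mdot A g w e p = 0" by (simp_all add: mdot_def Let_def gdot_def)
    then show ?thesis unfolding m using True mdot_sym[of e w] by (simp add: mdot_nonneg)
  next
    case False
    then have pos: "w p > 0" using w(2)[of p] by simp
    have s: "sqrt (w p) * sqrt (w p) = w p" "sqrt (w p) \<noteq> 0" using pos by auto
    \<comment> \<open>The coefficients are those of \<nabla>(e sqrt w) - (e sqrt w / z) \<nabla>z,
      with \<nabla>(sqrt w) written as \<nabla>w / (2 sqrt w).\<close>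
    have q: "0 \<le> (sqrt (w p))\<^sup>2 * mdot A g e e p + (e p / (2 * sqrt (w p)))\<^sup>2 * mdot A g w w p
        + (- (sqrt (w p) * e p / z p))\<^sup>2 * mdot A g z z p + 2 * sqrt (w p) * (e p / (2 * sqrt (w p))) * mdot A g e w p
        + 2 * sqrt (w p) * (- (sqrt (w p) * e p / z p)) * mdot A g e z p
        + 2 * (e p / (2 * sqrt (w p))) * (- (sqrt (w p) * e p / z p)) * mdot A g w z p"
      by (rule mdot_quadratic)
    have e1: "(sqrt (w p))\<^sup>2 = w p" using pos by simp
    have e2: "(e p / (2 * sqrt (w p)))\<^sup>2 = (e p)\<^sup>2 / (4 * w p)" using pos by (simp add: power_divide power_mult_distrib)
    have e3: "(- (sqrt (w p) * e p / z p))\<^sup>2 = (e p)\<^sup>2 * w p / (z p)\<^sup>2" using pos by (simp add: power_divide power_mult_distrib)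
    have e4: "2 * sqrt (w p) * (e p / (2 * sqrt (w p))) = e p" using s(2) by simp
    have e5: "2 * sqrt (w p) * (- (sqrt (w p) * e p / z p)) = - (2 * w p * e p / z p)"
      using s(1) by (simp add: mult.assoc[symmetric])
    have e6: "2 * (e p / (2 * sqrt (w p))) * (- (sqrt (w p) * e p / z p)) = - ((e p)\<^sup>2 / z p)"
      using s(2) by (simp add: power2_eq_square)
    have "0 \<le> w p * mdot A g e e p + (e p)\<^sup>2 / (4 * w p) * mdot A g w w p
        + (e p)\<^sup>2 * w p / (z p)\<^sup>2 * mdot A g z z p + e p * mdot A g e w p
        - 2 * w p * e p / z p * mdot A g e z p - (e p)\<^sup>2 / z p * mdot A g w z p"
      using q unfolding e1 e2 e3 e4 e5 e6 by (simp only: mult_minus_left diff_conv_add_uminus)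
    then show ?thesis
      unfolding m gnorm_grad_sqrt[OF w] using False by (simp add: add_divide_distrib mult_ac)
  qed
qed

theorem weighted_poincare:
  fixes H :: "'m::finite \<Rightarrow> real ^ 'm \<Rightarrow> real" and u \<eta> :: "'m \<Rightarrow> 'a \<Rightarrow> real"
  assumes H: "\<And>i. Ck_on UNIV (H i) 1" and u: "\<And>i. Ck_fun A 3 (u i)" and stable: "stable_solution A g H u"
    and \<eta>: "\<And>k. Ck_fun A 1 (\<eta> k)" and cpt: "\<And>k. compact (closure {p. \<eta> k p \<noteq> 0})"
  defines "L1 \<equiv> \<lambda>i p. (ricci A g p (grad A g (u i) p) (grad A g (u i) p) + (hessian_norm A g (u i) p)\<^sup>2
      - (gnorm A g p (grad A g (\<lambda>q. gnorm A g q (grad A g (u i) q)) p))\<^sup>2) * (\<eta> i p)\<^sup>2"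
    and "L2 \<equiv> \<lambda>i j p. sqrt (dH H u i j p * dH H u j i p) * gnorm A g p (grad A g (u i) p) * gnorm A g p (grad A g (u j) p)
      * \<eta> i p * \<eta> j p - dH H u i j p * ginner A g p (grad A g (u i) p) (grad A g (u j) p) * (\<eta> i p)\<^sup>2"
    and "R \<equiv> \<lambda>i p. (gnorm A g p (grad A g (u i) p))\<^sup>2 * (gnorm A g p (grad A g (\<eta> i) p))\<^sup>2"
  shows "(\<Sum>i\<in>UNIV. \<integral>p. L1 i p \<partial>vol) + (\<Sum>i\<in>UNIV. \<Sum>j\<in>UNIV - {i}. \<integral>p. L2 i j p \<partial>vol) \<le> (\<Sum>i\<in>UNIV. \<integral>p. R i p \<partial>vol)"
proof -
  let ?d = "\<lambda>i j p. dH H u i j p"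
  define w where "w i = mdot A g (u i) (u i)" for i
  define GG where "GG i p = (gnorm A g p (grad A g (\<lambda>q. sqrt (w i q)) p))\<^sup>2" for i p
  obtain \<zeta> :: "'m \<Rightarrow> 'a \<Rightarrow> real" and lam where lam: "lam \<ge> 0" and \<zeta>: "\<And>i. Ck_fun A 3 (\<zeta> i)"
    and eq\<zeta>: "\<And>i p. - laplace_beltrami A g (\<zeta> i) p = (\<Sum>j\<in>UNIV. ?d i j p * \<zeta> j p) + lam * \<zeta> i p"
    and pos: "\<And>i j p. ?d i j p * \<zeta> i p * \<zeta> j p > 0"
    using stable unfolding stable_solution_def by blast
  have sol: "- laplace_beltrami A g (u i) p = H i (\<chi> k. u k p)" for i p
    using stable unfolding stable_solution_def solves_system_def by blast
  have \<zeta>0: "\<zeta> i p \<noteq> 0" for i p using pos[of i i p] by auto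
  have u1: "Ck_fun A 1 (u i)" and u2: "Ck_fun A 2 (u i)" for i by (rule Ck_fun_mono[OF u], simp)+
  have \<zeta>1: "Ck_fun A 1 (\<zeta> i)" and \<zeta>2: "Ck_fun A 2 (\<zeta> i)" for i by (rule Ck_fun_mono[OF \<zeta>], simp)+
  have w2: "Ck_fun A 2 (w i)" for i
    unfolding w_def using Ck_fun_mdot[of 2 "u i" "u i"] u[of i] by (simp add: numeral_3_eq_3 numeral_2_eq_2)
  have w1: "Ck_fun A 1 (w i)" for i by (rule Ck_fun_mono[OF w2]) simp
  have w0: "w i p \<ge> 0" for i p unfolding w_def by (rule mdot_nonneg[OF u1])
  have gn: "gnorm A g p (grad A g (u i) p) = sqrt (w i p)" for i p
    unfolding w_def by (rule gnorm_grad[OF u1])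
  define K where "K i = closure {p. \<eta> i p \<noteq> 0}" for i
  have K: "compact (K i)" "closed (K i)" for i unfolding K_def using cpt by auto
  have \<eta>0: "\<eta> i p = 0" if "p \<notin> K i" for i p
    using that closure_subset[of "{p. \<eta> i p \<noteq> 0}"] unfolding K_def by auto
  have \<eta>2: "Ck_fun A 1 (\<lambda>p. (\<eta> i p)\<^sup>2)" for i unfolding power2_eq_square by (rule Ck_fun_mult[OF smooth_manifold_axioms \<eta> \<eta>])

  have cont_u: "continuous_on UNIV (\<lambda>p. \<chi> k. u k p)"
    by (intro continuous_on_vec_lambda Ck_fun_continuous[OF u])
  have cont_d: "continuous_on UNIV (?d i j)" for i j
  proof -
    have "continuous_on UNIV (pder j (H i))" using Ck_on_pder[of UNIV "H i" 0 j] H[of i] by simp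
    then show ?thesis unfolding dH_def by (rule continuous_on_compose2[OF _ cont_u]) simp
  qed
  have cont_mdot: "continuous_on UNIV (mdot A g f1 f2)" if "Ck_fun A 1 f1" "Ck_fun A 1 f2" for f1 f2
    using Ck_fun_mdot[of 0 f1 f2] that by (intro Ck_fun_continuous[of 0]) simp
  have cont_\<eta>: "continuous_on UNIV (\<eta> i)" for i by (rule Ck_fun_continuous[OF \<eta>])
  have cont_w: "continuous_on UNIV (w i)" for i by (rule Ck_fun_continuous[OF w2])
  have cont_lw: "continuous_on UNIV (laplace_beltrami A g (w i))" for i
    using Ck_fun_laplace[of 0 "w i"] w2[of i] by (intro Ck_fun_continuous[of 0]) (simp add: numeral_2_eq_2)

  \<comment> \<open>Replacing \<Delta>u_i by -H_i(u) before differentiating means that only first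
    derivatives of H_i and of \<open>u\<close> occur.\<close>
  have lap: "mdot A g (u i) (laplace_beltrami A g (u i)) p = - (\<Sum>j\<in>UNIV. ?d i j p * mdot A g (u i) (u j) p)" for i p
  proof -
    have "laplace_beltrami A g (u i) = (\<lambda>p. (\<lambda>y. - H i y) (\<chi> k. u k p))"
      using sol[of i] by (auto simp: fun_eq_iff minus_equation_iff[of _ "H i _"])
    moreover have "mdot A g (u i) (\<lambda>p. (\<lambda>y. - H i y) (\<chi> k. u k p)) p =
        (\<Sum>j\<in>UNIV. pder j (\<lambda>y. - H i y) (\<chi> k. u k p) * mdot A g (u i) (u j) p)"
      by (rule mdot_compose[OF Ck_on_minus[OF open_UNIV H] u1])
    moreover have "pder j (\<lambda>y. - H i y) y = - pder j (H i) y" for j y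
      using H[of i] by (intro pder_minus) auto
    ultimately show ?thesis by (simp add: dH_def sum_negf)
  qed
  have L1: "L1 i p = (1 / 2 * laplace_beltrami A g (w i) p + (\<Sum>j\<in>UNIV. ?d i j p * mdot A g (u i) (u j) p)) * (\<eta> i p)\<^sup>2
      - GG i p * (\<eta> i p)\<^sup>2" for i p
    unfolding L1_def gn bochner_manifold[OF u] lap GG_def w_def by (simp add: left_diff_distrib)
  have L2: "L2 i j p = sqrt (?d i j p * ?d j i p) * (sqrt (w i p) * \<eta> i p) * (sqrt (w j p) * \<eta> j p)
      - ?d i j p * mdot A g (u i) (u j) p * (\<eta> i p)\<^sup>2" for i j p
    unfolding L2_def gn ginner_grad[OF u1 u1] by simp
  have R: "R i p = w i p * mdot A g (\<eta> i) (\<eta> i) p" for i p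
    unfolding R_def gnorm_sq ginner_grad[OF u1 u1] ginner_grad[OF \<eta> \<eta>] w_def ..

  have GG_eq: "GG i p = (if w i p = 0 then 0 else mdot A g (w i) (w i) p / (4 * w i p))" for i p
    unfolding GG_def by (rule gnorm_grad_sqrt[OF w1 w0])
  \<comment> \<open>Continuity may fail at the zeros of \<open>w i\<close>, so local bounds are
    used: |\<nabla>w|^2 \<le> b w gives \<open>GG\<close> \<le> |b| / 4 nearby, the value 0 at zeros
    included.\<close>
  have int_GG: "integrable vol (\<lambda>p. GG i p * (\<eta> i p)\<^sup>2)" for i
  proof (rule integrable_vol[OF _ K(1)[of i]])
    have "(\<lambda>p. mdot A g (w i) (w i) p) \<in> borel_measurable borel" "w i \<in> borel_measurable borel" "\<eta> i \<in> borel_measurable borel"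
      using cont_mdot[OF w1 w1] cont_w cont_\<eta> borel_measurable_continuous_onI by blast+
    then show "(\<lambda>p. GG i p * (\<eta> i p)\<^sup>2) \<in> borel_measurable borel" unfolding GG_eq by measurable
    show "GG i p * (\<eta> i p)\<^sup>2 = 0" if "p \<notin> K i" for p using \<eta>0[OF that] by simp
    fix p
    obtain W b where W: "open W" "p \<in> W" "\<And>q. q \<in> W \<Longrightarrow> mdot A g (w i) (w i) q \<le> b * w i q"
      using mdot_self_locally_bounded[OF u, of p i] unfolding w_def by blast
    let ?W = "W \<inter> \<eta> i -` {\<eta> i p - 1<..<\<eta> i p + 1}"
    have "open ?W" using W(1) cont_\<eta>[of i] by (intro open_Int open_vimage) auto
    moreover have "\<bar>GG i q * (\<eta> i q)\<^sup>2\<bar> \<le> \<bar>b\<bar> / 4 * (\<bar>\<eta> i p\<bar> + 1)\<^sup>2" if q: "q \<in> ?W" for q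
    proof -
      have "0 \<le> GG i q" unfolding GG_def by simp
      moreover have "GG i q \<le> \<bar>b\<bar> / 4"
      proof (cases "w i q = 0")
        case False
        then have "w i q > 0" using w0[of i q] by simp
        moreover have "mdot A g (w i) (w i) q \<le> b * w i q" using W(3) q by blast
        ultimately have "mdot A g (w i) (w i) q / (4 * w i q) \<le> b / 4" by (simp add: field_simps)
        then show ?thesis using False by (simp add: GG_eq)
      qed (simp add: GG_eq)
      moreover have "(\<eta> i q)\<^sup>2 \<le> (\<bar>\<eta> i p\<bar> + 1)\<^sup>2"
        using q by (intro power2_le_iff_abs_le[THEN iffD2]) auto
      ultimately have "0 \<le> GG i q * (\<eta> i q)\<^sup>2" "GG i q * (\<eta> i q)\<^sup>2 \<le> \<bar>b\<bar> / 4 * (\<bar>\<eta> i p\<bar> + 1)\<^sup>2"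
        by (auto intro!: mult_mono simp del: times_divide_eq_left)
      then show ?thesis by simp
    qed
    ultimately show "\<exists>W b. open W \<and> p \<in> W \<and> (\<forall>q\<in>W. \<bar>GG i q * (\<eta> i q)\<^sup>2\<bar> \<le> b)"
      using W(2) by (intro exI[of _ ?W] exI[of _ "\<bar>b\<bar> / 4 * (\<bar>\<eta> i p\<bar> + 1)\<^sup>2"]) auto
  qed
  have int_L1: "integrable vol (L1 i)" for i
    unfolding L1[abs_def]
    by (intro Bochner_Integration.integrable_diff int_GG integrable_vol_continuous[OF _ K(1)[of i]]
        continuous_intros cont_lw cont_d cont_mdot u1 cont_\<eta>) (simp add: \<eta>0)
  have int_L2: "integrable vol (L2 i j)" for i j
    unfolding L2[abs_def]
    by (intro integrable_vol_continuous[OF _ K(1)[of i]] continuous_intros cont_d cont_mdot u1 cont_\<eta> cont_w) (simp add: \<eta>0)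
  have int_R: "integrable vol (R i)" for i
    unfolding R[abs_def]
  proof (intro integrable_vol_continuous[OF _ K(1)[of i]] continuous_intros cont_mdot \<eta> cont_w)
    show "w i p * mdot A g (\<eta> i) (\<eta> i) p = 0" if "p \<notin> K i" for p
      using mdot_zero_outside[OF \<eta> \<eta> K(2) \<eta>0 that] by simp
  qed

  \<comment> \<open>The factor by which the stability equation for \<zeta>_i is multiplied; it is
    C^1 because \<zeta>_i has no zeros. \<open>Z1\<close> and \<open>Z2\<close> are the divergences
    of \<eta>_i^2 \<nabla>w_i and of \<open>?a i\<close> \<nabla>\<zeta>_i.\<close>
  let ?a = "\<lambda>i p. (\<eta> i p)\<^sup>2 * w i p / \<zeta> i p"
  define Z1 where "Z1 i p = (\<eta> i p)\<^sup>2 * laplace_beltrami A g (w i) p + mdot A g (\<lambda>p. (\<eta> i p)\<^sup>2) (w i) p" for i p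
  define Z2 where "Z2 i p = ?a i p * laplace_beltrami A g (\<zeta> i) p + mdot A g (?a i) (\<zeta> i) p" for i p
  have Z1: "integrable vol (Z1 i)" "(\<integral>p. Z1 i p \<partial>vol) = 0" for i
    unfolding Z1_def[abs_def] by (rule green[OF \<eta>2 w2 K(1)[of i]], simp add: \<eta>0)+
  have a1: "Ck_fun A 1 (?a i)" for i
    by (rule Ck_fun_divide[OF smooth_manifold_axioms Ck_fun_mult[OF smooth_manifold_axioms \<eta>2 w1] \<zeta>1 \<zeta>0])
  have Z2: "integrable vol (Z2 i)" "(\<integral>p. Z2 i p \<partial>vol) = 0" for i
    unfolding Z2_def[abs_def] by (rule green[OF a1 \<zeta>2 K(1)[of i]], simp add: \<eta>0)+

  have pointwise: "(\<Sum>i\<in>UNIV. L1 i p) + (\<Sum>i\<in>UNIV. \<Sum>j\<in>UNIV - {i}. L2 i j p) \<le>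
      (\<Sum>i\<in>UNIV. R i p + 1 / 2 * Z1 i p - Z2 i p)" for p
  proof -
    let ?x = "\<lambda>i. sqrt (w i p) * \<eta> i p"
    let ?s = "\<lambda>i j. sqrt (?d i j p * ?d j i p) * ?x i * ?x j"
    have x2: "(?x i)\<^sup>2 = w i p * (\<eta> i p)\<^sup>2" for i using w0[of i p] by (simp add: power_mult_distrib)
    \<comment> \<open>The products \<nabla>u_i \<cdot> \<nabla>u_j with j \<noteq> i from the
      Bochner formula cancel against \<open>L2\<close>. The diagonal one remains and supplies the
      first sum in \<open>coupling_le\<close>.\<close>
    have split: "(\<Sum>j\<in>UNIV. ?d i j p * mdot A g (u i) (u j) p) * (\<eta> i p)\<^sup>2 + (\<Sum>j\<in>UNIV - {i}. L2 i j p) =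
        ?d i i p * (?x i)\<^sup>2 + (\<Sum>j\<in>UNIV - {i}. ?s i j)" for i
    proof -
      have "(\<Sum>j\<in>UNIV. ?d i j p * mdot A g (u i) (u j) p) = ?d i i p * w i p + (\<Sum>j\<in>UNIV - {i}. ?d i j p * mdot A g (u i) (u j) p)"
        by (simp add: sum.remove[of UNIV i] w_def)
      then show ?thesis unfolding L2 x2 by (simp add: sum_subtractf sum_distrib_right distrib_right)
    qed
    have stab: "mdot A g (?a i) (\<zeta> i) p \<le> R i p + \<eta> i p * mdot A g (\<eta> i) (w i) p + GG i p * (\<eta> i p)\<^sup>2" for i
      unfolding R GG_def by (rule stability_square[OF w1 w0 \<eta> \<zeta>1 \<zeta>0])
    have z1: "1 / 2 * Z1 i p = 1 / 2 * ((\<eta> i p)\<^sup>2 * laplace_beltrami A g (w i) p) + \<eta> i p * mdot A g (\<eta> i) (w i) p" for i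
      unfolding Z1_def power2_eq_square by (simp add: mdot_mult[OF \<eta> \<eta>])
    \<comment> \<open>The eigenvalue contributes \<open>lam * (?x i)\<^sup>2\<close>, which is
      nonnegative and is discarded.\<close>
    have coup: "(?x i)\<^sup>2 / \<zeta> i p * (\<Sum>j\<in>UNIV. ?d i j p * \<zeta> j p) \<le> - (?a i p * laplace_beltrami A g (\<zeta> i) p)" for i
    proof -
      have "- (?a i p * laplace_beltrami A g (\<zeta> i) p) = ?a i p * (- laplace_beltrami A g (\<zeta> i) p)" by simp
      also have "\<dots> = ?a i p * ((\<Sum>j\<in>UNIV. ?d i j p * \<zeta> j p) + lam * \<zeta> i p)"
        unfolding eq\<zeta> ..
      also have "\<dots> = (?x i)\<^sup>2 / \<zeta> i p * (\<Sum>j\<in>UNIV. ?d i j p * \<zeta> j p) + lam * (?x i)\<^sup>2"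
        unfolding x2 using \<zeta>0[of i p] by (simp add: distrib_left mult_ac)
      finally show ?thesis using lam by simp
    qed
    have "(\<Sum>i\<in>UNIV. L1 i p) + (\<Sum>i\<in>UNIV. \<Sum>j\<in>UNIV - {i}. L2 i j p) =
        (\<Sum>i\<in>UNIV. 1 / 2 * ((\<eta> i p)\<^sup>2 * laplace_beltrami A g (w i) p) - GG i p * (\<eta> i p)\<^sup>2
          + ((\<Sum>j\<in>UNIV. ?d i j p * mdot A g (u i) (u j) p) * (\<eta> i p)\<^sup>2 + (\<Sum>j\<in>UNIV - {i}. L2 i j p)))"
      unfolding L1 by (simp add: sum.distrib sum_subtractf algebra_simps)
    also have "\<dots> = (\<Sum>i\<in>UNIV. 1 / 2 * ((\<eta> i p)\<^sup>2 * laplace_beltrami A g (w i) p) - GG i p * (\<eta> i p)\<^sup>2)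
        + ((\<Sum>i\<in>UNIV. ?d i i p * (?x i)\<^sup>2) + (\<Sum>i\<in>UNIV. \<Sum>j\<in>UNIV - {i}. ?s i j))"
      unfolding split by (simp add: sum.distrib)
    also have "\<dots> \<le> (\<Sum>i\<in>UNIV. 1 / 2 * ((\<eta> i p)\<^sup>2 * laplace_beltrami A g (w i) p) - GG i p * (\<eta> i p)\<^sup>2)
        + (\<Sum>i\<in>UNIV. (?x i)\<^sup>2 / \<zeta> i p * (\<Sum>j\<in>UNIV. ?d i j p * \<zeta> j p))"
      by (intro add_left_mono coupling_le) (rule pos)
    also have "\<dots> \<le> (\<Sum>i\<in>UNIV. 1 / 2 * ((\<eta> i p)\<^sup>2 * laplace_beltrami A g (w i) p) - GG i p * (\<eta> i p)\<^sup>2)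
        + (\<Sum>i\<in>UNIV. - (?a i p * laplace_beltrami A g (\<zeta> i) p))"
      by (intro add_left_mono sum_mono coup)
    also have "\<dots> = (\<Sum>i\<in>UNIV. 1 / 2 * ((\<eta> i p)\<^sup>2 * laplace_beltrami A g (w i) p) - GG i p * (\<eta> i p)\<^sup>2
        - ?a i p * laplace_beltrami A g (\<zeta> i) p)"
      by (simp add: sum_subtractf sum_negf)
    \<comment> \<open>The term \<open>GG i p * (\<eta> i p)\<^sup>2\<close> that \<open>stab\<close>
      costs is exactly the one subtracted in \<open>L1\<close>, and the mixed term in
      \<nabla>\<eta>_i and \<nabla>w_i is absorbed by \<open>Z1\<close>.\<close>
    also have "\<dots> \<le> (\<Sum>i\<in>UNIV. R i p + 1 / 2 * Z1 i p - Z2 i p)"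
    proof (rule sum_mono)
      fix i
      show "1 / 2 * ((\<eta> i p)\<^sup>2 * laplace_beltrami A g (w i) p) - GG i p * (\<eta> i p)\<^sup>2 - ?a i p * laplace_beltrami A g (\<zeta> i) p
          \<le> R i p + 1 / 2 * Z1 i p - Z2 i p"
        using stab[of i] unfolding z1 Z2_def by linarith
    qed
    finally show ?thesis .
  qed
  have "(\<Sum>i\<in>UNIV. \<integral>p. L1 i p \<partial>vol) + (\<Sum>i\<in>UNIV. \<Sum>j\<in>UNIV - {i}. \<integral>p. L2 i j p \<partial>vol) =
      (\<integral>p. (\<Sum>i\<in>UNIV. L1 i p) + (\<Sum>i\<in>UNIV. \<Sum>j\<in>UNIV - {i}. L2 i j p) \<partial>vol)"
    using int_L1 int_L2 by (simp add: Bochner_Integration.integral_add Bochner_Integration.integral_sum)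
  also have "\<dots> \<le> (\<integral>p. (\<Sum>i\<in>UNIV. R i p + 1 / 2 * Z1 i p - Z2 i p) \<partial>vol)"
    using int_L1 int_L2 int_R Z1(1) Z2(1)
    by (intro integral_mono pointwise Bochner_Integration.integrable_add Bochner_Integration.integrable_sum
        Bochner_Integration.integrable_diff integrable_mult_right)
  also have "\<dots> = (\<Sum>i\<in>UNIV. \<integral>p. R i p \<partial>vol)"
    using int_R Z1 Z2 by (simp add: Bochner_Integration.integral_sum)
  finally show ?thesis .
qed

end

theorem theorem2p1:
  fixes A :: "('a::{t2_space, second_countable_topology}, 'n::finite) chart set"
    and g :: "('a, 'n) metric"
    and H :: "'m::finite \<Rightarrow> real ^ 'm \<Rightarrow> real"
    and u \<eta> :: "'m \<Rightarrow> 'a \<Rightarrow> real"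
  assumes "riemannian_manifold A g"
    and "connected (UNIV :: 'a set)"
    and "riemannian_complete A g"
    and "\<And>i. Ck_on UNIV (H i) 1"
    and "\<And>i. Ck_fun A 3 (u i)"
    and "\<And>i j p. dH H u j i p * dH H u i j p > 0"
    and "stable_solution A g H u"
    and "\<And>k. Ck_fun A 1 (\<eta> k)"
    and "\<And>k. compact (closure {p. \<eta> k p \<noteq> 0})"
  shows "(\<Sum>i\<in>UNIV. \<integral>p. (ricci A g p (grad A g (u i) p) (grad A g (u i) p)
              + (hessian_norm A g (u i) p)\<^sup>2
              - (gnorm A g p (grad A g (\<lambda>q. gnorm A g q (grad A g (u i) q)) p))\<^sup>2)
            * (\<eta> i p)\<^sup>2 \<partial>riemannian_volume A g)
       + (\<Sum>i\<in>UNIV. \<Sum>j\<in>UNIV - {i}. \<integral>p.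
              (sqrt (dH H u i j p * dH H u j i p)
                 * gnorm A g p (grad A g (u i) p) * gnorm A g p (grad A g (u j) p)
                 * \<eta> i p * \<eta> j p
               - dH H u i j p * ginner A g p (grad A g (u i) p) (grad A g (u j) p)
                 * (\<eta> i p)\<^sup>2) \<partial>riemannian_volume A g)
     \<le> (\<Sum>i\<in>UNIV. \<integral>p. (gnorm A g p (grad A g (u i) p))\<^sup>2
            * (gnorm A g p (grad A g (\<eta> i) p))\<^sup>2 \<partial>riemannian_volume A g)"
proof -
  interpret riemannian_manifold A g by fact
  show ?thesis by (rule weighted_poincare) (use assms in auto)
qed

end
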